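(* Assume Setting (S) and the Distinctness assumptions (D). Assume moreover $\gamma>4\alpha$. Then for every $T>\frac{2\pi}{\sqrt{\gamma^2-16\alpha^2}}$, $$\int_0^T\big(|u_1(t)|^2+|u_2(t)|^2\big)dt\asymp\sum_{n=1}^\infty\big(|C_n|^2+|d_nD_n|^2\big),$$ i.e. there are constants $0<A\le B$ (depending on $T$ and the sequences $\omega_n,\zeta_n,r_n,c_n,d_n$ and the constants in (S), but not on $C_n,D_n,R_n,\mathcal{E}$) such that $A\sum_n(|C_n|^2+|d_nD_n|^2)\le\int_0^T(|u_1|^2+|u_2|^2)dt\le B\sum_n(|C_n|^2+|d_nD_n|^2)$.
   Context: Setting (S): $(\omega_n),(\zeta_n),(C_n),(D_n),(c_n),(d_n)$ ($n\ge1$) are complex sequences and $(r_n),(R_n)$ are real sequences. There are constants $\gamma>0$, $\alpha>0$, $\chi<0$, $n'\in\mathbb{N}$, $\mu>0$, $\nu>1/2$, $M>0$, $0<c_1\le c_2$ such that: (H1) $\liminf_{n\to\infty}(\operatorname{Re}\omega_{n+1}-\operatorname{Re}\omega_n)=\liminf_{n\to\infty}(\operatorname{Re}\zeta_{n+1}-\operatorname{Re}\zeta_n)=\gamma$; (H2) $\operatorname{Im}\omega_n\to\alpha$, $r_n\to\chi$, $\operatorname{Im}\zeta_n\to0$; (H3) $\omega_n\ne0$, $\zeta_n\neq0$, $c_1|\zeta_n|\le|d_n|\le c_2|\zeta_n|$ and $|c_n|\le M/|\omega_n|$ for all $n$; (H4) $|R_n|\le\mu n^{-\nu}(|C_n|^2+|d_nD_n|^2)^{1/2}$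 for $n\ge n'$ and $|R_n|\le\mu(|C_n|^2+|d_nD_n|^2)^{1/2}$ for $n\le n'$; (H5) $\sum_n(|C_n|^2+|d_nD_n|^2)<\infty$. For $n_0\in\mathbb{N}$ and $t\in\mathbb{R}$, $u_1^{n_0}(t)=\sum_{n\ge n_0}\big(C_ne^{i\omega_nt}+\overline{C_n}e^{-i\overline{\omega_n}t}+R_ne^{r_nt}+D_ne^{i\zeta_nt}+\overline{D_n}e^{-i\overline{\zeta_n}t}\big)$, $u_2^{n_0}(t)=\sum_{n\ge n_0}\big(d_nD_ne^{i\zeta_nt}+\overline{d_nD_n}e^{-i\overline{\zeta_n}t}+c_nC_ne^{i\omega_nt}+\overline{c_nC_n}e^{-i\overline{\omega_n}t}\big)$. Distinctness assumptions (D): $\eta\in\mathbb{R}$ and $\mathcal{E}\in\mathbb{R}$ with $|\mathcal{E}|^2\le M\sum_{n\ge1}(|C_n|^2+|d_nD_n|^2)$; the sequences $(\omega_n)$, $(r_n)$, $(\zeta_n)$ each consist of pairwise distinct numbers; $\omega_n\ne\zeta_m$, $\omega_n\ne\overline{\zeta_m}$, $r_n\ne i\omega_m$, $r_n\ne i\zeta_m$, $r_n\ne-\eta$ for all $n,m$; and $\operatorname{Re}\omega_n>0$, $\operatorname{Re}\zeta_n>0$ for all $n$. Set $u_1(t):=u_1^{1}(t)$ and $u_2(t):=u_2^{1}(t)+\mathcal{E}e^{-\eta t}$. *)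

theory Defs
  imports "HOL-Analysis.Analysis"
begin

text \<open>Sequences are indexed from 1; the value at index 0 is ignored.\<close>

definition energy :: "(nat \<Rightarrow> complex) \<Rightarrow> (nat \<Rightarrow> complex) \<Rightarrow> (nat \<Rightarrow> complex) \<Rightarrow> real" where
  "energy C D d = (\<Sum>n. (cmod (C (Suc n)))\<^sup>2 + (cmod (d (Suc n) * D (Suc n)))\<^sup>2)"

definition u1_part ::
  "(nat \<Rightarrow> complex) \<Rightarrow> (nat \<Rightarrow> complex) \<Rightarrow> (nat \<Rightarrow> real) \<Rightarrow>
   (nat \<Rightarrow> complex) \<Rightarrow> (nat \<Rightarrow> complex) \<Rightarrow> (nat \<Rightarrow> real) \<Rightarrow> nat \<Rightarrow> real \<Rightarrow> complex" where
  "u1_part \<omega> \<zeta> r C D R N t =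
     (\<Sum>n=1..N. C n * exp (\<i> * \<omega> n * of_real t) + cnj (C n) * exp (- \<i> * cnj (\<omega> n) * of_real t)
        + of_real (R n * exp (r n * t))
        + D n * exp (\<i> * \<zeta> n * of_real t) + cnj (D n) * exp (- \<i> * cnj (\<zeta> n) * of_real t))"

definition u2_part ::
  "(nat \<Rightarrow> complex) \<Rightarrow> (nat \<Rightarrow> complex) \<Rightarrow> (nat \<Rightarrow> complex) \<Rightarrow> (nat \<Rightarrow> complex) \<Rightarrow>
   (nat \<Rightarrow> complex) \<Rightarrow> (nat \<Rightarrow> complex) \<Rightarrow> real \<Rightarrow> real \<Rightarrow> nat \<Rightarrow> real \<Rightarrow> complex" where
  "u2_part \<omega> \<zeta> c d C D \<E> \<eta> N t =
     (\<Sum>n=1..N. d n * D n * exp (\<i> * \<zeta> n * of_real t) + cnj (d n * D n) * exp (- \<i> * cnj (\<zeta> n) * of_real t)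
        + c n * C n * exp (\<i> * \<omega> n * of_real t) + cnj (c n * C n) * exp (- \<i> * cnj (\<omega> n) * of_real t))
     + of_real (\<E> * exp (- \<eta> * t))"

end

theory Submission
  imports Defs "HOL-Complex_Analysis.Great_Picard"
begin

text \<open>
  Both observations are real: a conjugate pair contributes \<open>2 Re (g e\<^bsup>i\<sigma>t\<^esup>)\<close>. Multiplying by
  \<open>e\<^bsup>\<beta>t\<^esup>\<close> moves imaginary parts tending to \<open>\<beta>\<close> close to zero, so Ingham's inequality with the
  kernel \<open>sin (\<pi>t/T)\<close> on \<open>[0,T]\<close>, which tolerates small imaginary parts, applies to the tails of
  each family as soon as \<open>T > 2\<pi>/\<gamma>\<close>. Since \<open>1/d\<^sub>n\<close> and \<open>c\<^sub>n\<close> tend to zero, the coupled system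
  is a compact perturbation of the two decoupled ones, which gives the lower estimate up to
  finitely many modes, the \<open>R\<close>-part and the \<open>E\<close>-part.

  These remainders are removed by contradiction. A normalised sequence with vanishing
  observation has a coefficientwise limit. Applying \<open>j\<close>-fold difference quotients and letting
  first the step tend to \<open>0\<close> and then \<open>j\<close> to infinity shows that the limit contains no modes of
  high frequency; by the bound on \<open>R\<close> it is then a finite exponential sum. The estimate modulo
  finitely many modes, applied to differences, makes the convergence strong, so this finite sum
  vanishes on \<open>[0,T]\<close>, all its coefficients are zero, and the normalisation is contradicted.
\<close>

subsection \<open>Ingham inequalities for exponents with small imaginary part\<close>

text \<open>With \<open>C n\<close> and \<open>d n * D n\<close> as unknowns, each family is seen
  with weight 1 in one component and with a vanishing weight in the other. All inequalities are
  proved for partial sums, with constants uniform in their length; infinite sums enter only as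
  mean-square limits. The obstacle is the \<open>R\<close>-part: its real exponents converge, so
  they have no gap and can be estimated only from above, through the sum of the absolute values of
  \<open>R\<close>. The decay with exponent \<open>\<nu> > 1/2\<close> makes the weights square
  summable; by Cauchy-Schwarz the tails of \<open>R\<close> are then uniformly small for bounded
  energy, which is the compactness that is used. The number \<open>\<E>\<close> is an independent
  coordinate of the normalisation. Difference quotients replace derivatives because only square
  integrals of the observations are controlled. For fixed step \<open>h\<close> and order
  \<open>j\<close> they cost a constant factor, harmless against an observation tending to zero, and
  the time \<open>j * h\<close>, which disappears with \<open>h\<close>; hence one interval of
  length \<open>T' < T\<close> serves every \<open>j\<close>.\<close>

lemma integral_sin_exp:
  fixes z :: complex and T :: real
  assumes "T > 0" "z \<noteq> of_real (pi / T)" "z \<noteq> - of_real (pi / T)"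
  shows "((\<lambda>t. of_real (sin (pi / T * t)) * exp (\<i> * z * of_real t)) has_integral
          - (1 + exp (\<i> * z * of_real T)) * of_real (pi / T) / (z\<^sup>2 - (of_real (pi / T))\<^sup>2)) {0..T}"
proof -
  define p :: complex where "p = of_real (pi / T)"
  have zp: "z + p \<noteq> 0" "z - p \<noteq> 0" using assms by (auto simp: p_def add_eq_0_iff2)
  define F where "F = (\<lambda>w. - (exp (\<i> * (z + p) * w) / (z + p) - exp (\<i> * (z - p) * w) / (z - p)) / 2)"
  have F: "(F has_field_derivative (sin (p * w) * exp (\<i> * z * w))) (at w)" for w
  proof -
    have *: "(F has_field_derivative - (\<i> * exp (\<i> * (z + p) * w) - \<i> * exp (\<i> * (z - p) * w)) / 2) (at w)"
    proof -
      have e: "((\<lambda>w. exp (\<i> * a * w) / a) has_field_derivative \<i> * exp (\<i> * a * w)) (at w)" if "a \<noteq> 0" for a :: complex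
        using that by (auto intro!: derivative_eq_intros)
      show ?thesis unfolding F_def
        by (intro DERIV_cdivide DERIV_minus DERIV_diff e zp)
    qed
    have "- (\<i> * exp (\<i> * (z + p) * w) - \<i> * exp (\<i> * (z - p) * w)) / 2 = sin (p * w) * exp (\<i> * z * w)"
      by (simp add: sin_exp_eq exp_add[symmetric] field_simps flip: exp_minus)
    then show ?thesis using * by simp
  qed
  have "((\<lambda>t. sin (p * of_real t) * exp (\<i> * z * of_real t)) has_integral F (of_real T) - F (of_real 0)) {0..T}"
  proof (rule fundamental_theorem_of_calculus)
    show "0 \<le> T" using assms by simp
    fix x :: real
    show "((\<lambda>x. F (of_real x)) has_vector_derivative (sin (p * of_real x) * exp (\<i> * z * of_real x))) (at x within {0..T})"
      by (rule has_vector_derivative_real_field[OF F])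
  qed
  moreover have "sin (p * of_real t) = of_real (sin (pi / T * t))" for t
    by (simp add: p_def sin_of_real flip: of_real_mult of_real_divide)
  moreover have "F (of_real T) - F (of_real 0) = - (1 + exp (\<i> * z * of_real T)) * p / (z\<^sup>2 - p\<^sup>2)"
  proof -
    \<comment> \<open>Half a period of the sine fits into \<open>{0..T}\<close>, so both boundary
      factors at \<open>T\<close> are -1 and the two simple poles combine into
      \<open>1 / (z\<^sup>2 - p\<^sup>2)\<close>. This quadratic decay is what makes the row sums of
      the Gram matrix bounded.\<close>
    have pT: "p * of_real T = of_real pi" using assms by (simp add: p_def)
    have "exp (\<i> * (z + p) * of_real T) = exp (\<i> * z * of_real T) * exp (\<i> * (p * of_real T))"
      by (simp add: exp_add[symmetric] algebra_simps)
    moreover have "exp (\<i> * (z - p) * of_real T) = exp (\<i> * z * of_real T) / exp (\<i> * (p * of_real T))"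
      by (simp add: exp_diff[symmetric] algebra_simps)
    ultimately have e: "exp (\<i> * (z + p) * of_real T) = - exp (\<i> * z * of_real T)"
       "exp (\<i> * (z - p) * of_real T) = - exp (\<i> * z * of_real T)"
      unfolding pT by simp_all
    have d: "z\<^sup>2 - p\<^sup>2 = (z + p) * (z - p)" by (simp add: algebra_simps power2_eq_square)
    have "F (of_real T) - F (of_real 0) = (1 + exp (\<i> * z * of_real T)) * (1 / (z + p) - 1 / (z - p)) / 2"
      unfolding F_def e by (simp add: diff_divide_distrib add_divide_distrib ring_distribs)
    also have "1 / (z + p) - 1 / (z - p) = - 2 * p / ((z + p) * (z - p))"
      using zp by (simp add: field_simps)
    also have "x * (- 2 * p / y) / 2 = - x * p / y" for x y by simp
    finally show ?thesis unfolding d .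
  qed
  ultimately show ?thesis by (simp add: p_def)
qed

text \<open>Only the real part has to stay beyond the poles at plus and minus \<open>pi / T\<close>;
  the imaginary part then enters through the numerator alone. So exponents with bounded imaginary
  part behave like real ones up to a constant.\<close>

lemma norm_integral_sin_exp_le:
  fixes z :: complex and T :: real
  assumes T: "T > 0" and x: "T * \<bar>Re z\<bar> > pi" and y: "\<bar>Im z\<bar> \<le> b"
  shows "cmod (integral {0..T} (\<lambda>t. of_real (sin (pi / T * t)) * exp (\<i> * z * of_real t)))
          \<le> (1 + exp (b * T)) * (pi / T) / ((Re z)\<^sup>2 - (pi / T)\<^sup>2)"
proof -
  define p where "p = pi / T"
  have p: "p > 0" "\<bar>Re z\<bar> > p" using T x by (auto simp: p_def field_simps)
  have nz: "z \<noteq> of_real p" "z \<noteq> - of_real p" using p by auto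
  have "cmod (z\<^sup>2 - (of_real p)\<^sup>2) = cmod (z - of_real p) * cmod (z + of_real p)"
    by (simp add: norm_mult[symmetric] algebra_simps power2_eq_square)
  also have "\<dots> \<ge> \<bar>Re z - p\<bar> * \<bar>Re z + p\<bar>"
    using abs_Re_le_cmod[of "z - of_real p"] abs_Re_le_cmod[of "z + of_real p"] by (intro mult_mono) auto
  also have "\<bar>Re z - p\<bar> * \<bar>Re z + p\<bar> = \<bar>(Re z)\<^sup>2 - p\<^sup>2\<bar>"
    by (simp add: abs_mult[symmetric] algebra_simps power2_eq_square)
  finally have 1: "cmod (z\<^sup>2 - (of_real p)\<^sup>2) \<ge> (Re z)\<^sup>2 - p\<^sup>2" by simp
  have 2: "(Re z)\<^sup>2 - p\<^sup>2 > 0" using p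
    by (metis abs_of_pos diff_gt_0_iff_gt power2_abs power_strict_mono less_imp_le pos2)
  have "- (Im z * T) \<le> b * T" using y T by (smt (verit) mult_minus_left mult_right_mono)
  then have 3: "cmod (1 + exp (\<i> * z * of_real T)) \<le> 1 + exp (b * T)"
    by (intro order_trans[OF norm_triangle_ineq]) (simp add: norm_exp_eq_Re)
  have "integral {0..T} (\<lambda>t. of_real (sin (pi / T * t)) * exp (\<i> * z * of_real t)) =
     - (1 + exp (\<i> * z * of_real T)) * of_real p / (z\<^sup>2 - (of_real p)\<^sup>2)"
    using integral_sin_exp[OF T, of z] nz unfolding p_def by (auto intro: integral_unique)
  also have "cmod \<dots> = cmod (1 + exp (\<i> * z * of_real T)) * p / cmod (z\<^sup>2 - (of_real p)\<^sup>2)"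
    using p by (simp add: norm_divide norm_mult flip: norm_minus_cancel[of "1 + exp (\<i> * z * of_real T)"])
  also have "\<dots> \<le> (1 + exp (b * T)) * p / ((Re z)\<^sup>2 - p\<^sup>2)"
    using 1 2 3 p by (intro frac_le mult_right_mono mult_nonneg_nonneg) auto
  finally show ?thesis by (simp add: p_def)
qed

text \<open>Telescoping: each term is half the difference of \<open>1 / (2 * j - 1)\<close> and
  \<open>1 / (2 * j + 1)\<close>.\<close>

lemma sum_inverse_four_squares_le:
  fixes n :: nat
  shows "(\<Sum>j=1..n. 1 / (4 * (real j)\<^sup>2 - 1)) \<le> 1 / 2"
proof -
  have "(\<Sum>j=1..n. 1 / (4 * (real j)\<^sup>2 - 1)) = (1 - 1 / (2 * real n + 1)) / 2"
  proof (induction n)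
    case (Suc n)
    have "4 * (real (Suc n))\<^sup>2 - 1 = (2 * real n + 1) * (2 * real n + 3)"
      by (simp add: power2_eq_square algebra_simps)
    then have "(\<Sum>j=1..Suc n. 1 / (4 * (real j)\<^sup>2 - 1))
        = (1 - 1 / (2 * real n + 1)) / 2 + 1 / ((2 * real n + 1) * (2 * real n + 3))"
      using Suc by simp
    also have "\<dots> = (1 - 1 / (2 * real (Suc n) + 1)) / 2"
      by (simp add: divide_simps) (simp add: algebra_simps)
    finally show ?case .
  qed simp
  then show ?thesis by simp
qed

text \<open>The differences \<open>i - j\<close> are distinct nonzero integers, so the sum is
  dominated by the two-sided series, twice the bound 1/2. The value 1 is what puts the threshold of
  the inverse inequality at \<open>2 * pi / \<gamma>\<close>.\<close>

lemma sum_int_inverse_four_squares_le: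
  fixes J :: "int set"
  assumes "finite J" "i \<notin> J"
  shows "(\<Sum>j\<in>J. 1 / (4 * (real_of_int (i - j))\<^sup>2 - 1)) \<le> 1"
proof -
  define f where "f = (\<lambda>k::int. 1 / (4 * (real_of_int k)\<^sup>2 - 1))"
  have fpos: "f k \<ge> 0" if "k \<noteq> 0" for k
  proof -
    have "1 \<le> k\<^sup>2" using that by (simp add: int_one_le_iff_zero_less)
    then have "1 \<le> (real_of_int k)\<^sup>2" by (metis of_int_1_le_iff of_int_power)
    then show ?thesis by (simp add: f_def)
  qed
  obtain n :: nat where n: "\<forall>j\<in>J. \<bar>i - j\<bar> \<le> int n"
  proof -
    have "\<forall>j\<in>J. \<bar>i - j\<bar> \<le> (\<Sum>j\<in>J. \<bar>i - j\<bar>)" using assms(1) by (auto intro: member_le_sum)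
    then show ?thesis using that[of "nat (\<Sum>j\<in>J. \<bar>i - j\<bar>)"] by (simp add: sum_nonneg)
  qed
  have inj: "inj_on (\<lambda>j. i - j) J" by (auto simp: inj_on_def)
  have "(\<Sum>j\<in>J. f (i - j)) = sum f ((\<lambda>j. i - j) ` J)" using inj by (simp add: sum.reindex)
  also have "\<dots> \<le> sum f (int ` {1..n} \<union> (\<lambda>k. - int k) ` {1..n})"
  proof (rule sum_mono2)
    show "(\<lambda>j. i - j) ` J \<subseteq> int ` {1..n} \<union> (\<lambda>k. - int k) ` {1..n}"
    proof
      fix k assume "k \<in> (\<lambda>j. i - j) ` J"
      then have k: "k \<noteq> 0" "\<bar>k\<bar> \<le> int n" using assms n by auto
      then have "nat \<bar>k\<bar> \<in> {1..n}" by auto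
      moreover have "k = int (nat \<bar>k\<bar>) \<or> k = - int (nat \<bar>k\<bar>)" by auto
      ultimately show "k \<in> int ` {1..n} \<union> (\<lambda>k. - int k) ` {1..n}" by blast
    qed
  qed (auto intro: fpos)
  also have "\<dots> = sum f (int ` {1..n}) + sum f ((\<lambda>k. - int k) ` {1..n})"
    by (rule sum.union_disjoint) auto
  also have "\<dots> = (\<Sum>j=1..n. 1 / (4 * (real j)\<^sup>2 - 1)) + (\<Sum>j=1..n. 1 / (4 * (real j)\<^sup>2 - 1))"
    by (simp add: sum.reindex inj_on_def f_def)
  also have "\<dots> \<le> 1" using sum_inverse_four_squares_le[of n] by simp
  finally show ?thesis by (simp add: f_def)
qed

text \<open>These are the diagonal entries of the Gram matrix, with \<open>y\<close> twice the
  imaginary part of an exponent. The mass of the kernel is \<open>2 * T / pi\<close>, and damping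
  changes it by a factor between \<open>exp (- b * T)\<close> and
  \<open>exp (b * T)\<close>.\<close>

lemma integral_sin_exp_damped:
  fixes T y b :: real
  assumes T: "T > 0" and y: "\<bar>y\<bar> \<le> b"
  shows "exp (- b * T) * (2 * T / pi) \<le> integral {0..T} (\<lambda>t. sin (pi / T * t) * exp (- y * t))"
    and "integral {0..T} (\<lambda>t. sin (pi / T * t) * exp (- y * t)) \<le> exp (b * T) * (2 * T / pi)"
proof -
  have pos: "sin (pi / T * t) \<ge> 0" if "t \<in> {0..T}" for t
    using that T by (intro sin_ge_zero) (auto simp: field_simps)
  have I: "((\<lambda>t. sin (pi / T * t)) has_integral 2 * T / pi) {0..T}"
  proof -
    have "((\<lambda>t. sin (pi / T * t)) has_integral (- cos (pi / T * T) * (T / pi)) - (- cos (pi / T * 0) * (T / pi))) {0..T}"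
      using T by (intro fundamental_theorem_of_calculus)
        (auto intro!: derivative_eq_intros simp flip: has_real_derivative_iff_has_vector_derivative)
    then show ?thesis using T by simp
  qed
  have yt: "\<bar>y * t\<bar> \<le> b * T" if "t \<in> {0..T}" for t
    using that y by (auto simp: abs_mult intro!: mult_mono)
  have int: "(\<lambda>t. sin (pi / T * t) * exp (- y * t)) integrable_on {0..T}"
    by (intro integrable_continuous_interval continuous_intros)
  have "((\<lambda>t. exp (- b * T) * sin (pi / T * t)) has_integral exp (- b * T) * (2 * T / pi)) {0..T}"
    using I by (rule has_integral_mult_right)
  moreover have "exp (- b * T) * sin (pi / T * t) \<le> sin (pi / T * t) * exp (- y * t)" if "t \<in> {0..T}" for t
    using pos[OF that] yt[OF that] by (subst mult.commute) (intro mult_left_mono, auto)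
  ultimately show "exp (- b * T) * (2 * T / pi) \<le> integral {0..T} (\<lambda>t. sin (pi / T * t) * exp (- y * t))"
    using int by (intro has_integral_le[OF _ integrable_integral]) auto
  have "((\<lambda>t. exp (b * T) * sin (pi / T * t)) has_integral exp (b * T) * (2 * T / pi)) {0..T}"
    using I by (rule has_integral_mult_right)
  moreover have "sin (pi / T * t) * exp (- y * t) \<le> exp (b * T) * sin (pi / T * t)" if "t \<in> {0..T}" for t
    using pos[OF that] yt[OF that] by (subst (2) mult.commute) (intro mult_left_mono, auto)
  ultimately show "integral {0..T} (\<lambda>t. sin (pi / T * t) * exp (- y * t)) \<le> exp (b * T) * (2 * T / pi)"
    using int by (intro has_integral_le[OF integrable_integral]) auto
qed

definition exp_sum :: "'i set \<Rightarrow> ('i \<Rightarrow> complex) \<Rightarrow> ('i \<Rightarrow> complex) \<Rightarrow> real \<Rightarrow> complex" where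
  "exp_sum J \<sigma> a t = (\<Sum>j\<in>J. a j * exp (\<i> * \<sigma> j * of_real t))"

lemma continuous_on_exp_sum [continuous_intros]: "continuous_on S (exp_sum J \<sigma> a)"
  unfolding exp_sum_def by (intro continuous_intros)

text \<open>Expanding the square gives the Gram matrix of the exponentials for the weight
  \<open>sin (pi / T * t)\<close>. Its diagonal is kept exactly; the rest is controlled by Schur's
  test, the entries being dominated by a symmetric matrix with row sums at most
  \<open>\<kappa>\<close>. Integer indices allow two-sided families with separation proportional to
  the distance of the indices.\<close>

lemma ingham_kernel_estimate:
  fixes \<sigma> :: "int \<Rightarrow> complex"
  assumes J: "finite J" and T: "T > 0" and \<gamma>: "\<gamma> > 0" "T * \<gamma> > 2 * pi"
    and gap: "\<And>i j. i \<in> J \<Longrightarrow> j \<in> J \<Longrightarrow> \<gamma> * \<bar>real_of_int (i - j)\<bar> \<le> \<bar>Re (\<sigma> i) - Re (\<sigma> j)\<bar>"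
    and im: "\<And>i. i \<in> J \<Longrightarrow> \<bar>Im (\<sigma> i)\<bar> \<le> b"
  shows "\<bar>integral {0..T} (\<lambda>t. sin (pi / T * t) * (cmod (exp_sum J \<sigma> a t))\<^sup>2)
      - (\<Sum>i\<in>J. (cmod (a i))\<^sup>2 * integral {0..T} (\<lambda>t. sin (pi / T * t) * exp (- (2 * Im (\<sigma> i)) * t)))\<bar>
    \<le> (1 + exp (2 * b * T)) / 2 * (2 * pi / (T * \<gamma>))\<^sup>2 * (2 * T / pi) * (\<Sum>i\<in>J. (cmod (a i))\<^sup>2)"
proof -
  define p where "p = pi / T"
  define G where "G = (\<lambda>z. integral {0..T} (\<lambda>t. complex_of_real (sin (p * t)) * exp (\<i> * z * of_real t)))"
  define \<kappa> where "\<kappa> = (1 + exp (2 * b * T)) / 2 * (2 * pi / (T * \<gamma>))\<^sup>2 * (2 * T / pi)"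
  define k where "k = (\<lambda>i j::int. if i = j then 0 else \<kappa> * (1 / (4 * (real_of_int (i - j))\<^sup>2 - 1)))"
  have p0: "p > 0" using T by (simp add: p_def)
  have \<kappa>0: "\<kappa> \<ge> 0" using T by (simp add: \<kappa>_def add_nonneg_nonneg)
  have k_sym: "k i j = k j i" for i j by (simp add: k_def power2_commute)
  have off: "cmod (G (\<sigma> i - cnj (\<sigma> j))) \<le> k i j" if ij: "i \<in> J" "j \<in> J" "i \<noteq> j" for i j
  proof -
    define z where "z = \<sigma> i - cnj (\<sigma> j)"
    define m where "m = \<bar>real_of_int (i - j)\<bar>"
    define q where "q = (T * \<gamma> / (2 * pi))\<^sup>2"
    have m: "m \<ge> 1" "m\<^sup>2 = (real_of_int (i - j))\<^sup>2" using ij by (auto simp: m_def)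
    have "T * \<gamma> / (2 * pi) \<ge> 1" using \<gamma> by simp
    then have q: "q \<ge> 1" unfolding q_def by (rule one_le_power)
    have x: "\<bar>Re z\<bar> \<ge> \<gamma> * m" using gap[OF ij(1,2)] by (simp add: z_def m_def)
    have "pi < T * \<gamma> * 1" using \<gamma> pi_gt_zero by linarith
    also have "\<dots> \<le> T * \<gamma> * m" using m T \<gamma> by (intro mult_left_mono) auto
    also have "\<dots> \<le> T * \<bar>Re z\<bar>" using x T by (simp add: mult.assoc)
    finally have 1: "T * \<bar>Re z\<bar> > pi" .
    have y: "\<bar>Im z\<bar> \<le> 2 * b" using im[OF ij(1)] im[OF ij(2)] by (simp add: z_def)
    \<comment> \<open>The product \<open>p\<^sup>2 * q\<close> is
      \<open>\<gamma>\<^sup>2 / 4\<close>. Enlarging the subtracted \<open>p\<^sup>2\<close> to this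
      value, possible since \<open>q \<ge> 1\<close>, brings the denominator to the telescoping
      shape \<open>4 * m\<^sup>2 - 1\<close>.\<close>
    have "p\<^sup>2 * q * (4 * m\<^sup>2 - 1) = (\<gamma> * m)\<^sup>2 - p\<^sup>2 * q"
      using T by (simp add: p_def q_def field_simps power2_eq_square)
    also have "\<dots> \<le> (Re z)\<^sup>2 - p\<^sup>2"
    proof -
      have "(\<gamma> * m)\<^sup>2 \<le> \<bar>Re z\<bar>\<^sup>2" using x m \<gamma> by (intro power_mono) auto
      moreover have "p\<^sup>2 * 1 \<le> p\<^sup>2 * q" using q by (intro mult_left_mono) auto
      ultimately show ?thesis by simp
    qed
    finally have 2: "p\<^sup>2 * q * (4 * m\<^sup>2 - 1) \<le> (Re z)\<^sup>2 - p\<^sup>2" .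
    have m2: "4 * m\<^sup>2 - 1 > 0" using m(1) one_le_power[of m 2] by linarith
    then have 3: "p\<^sup>2 * q * (4 * m\<^sup>2 - 1) > 0" using p0 q by (intro mult_pos_pos) auto
    have "cmod (G z) \<le> (1 + exp (2 * b * T)) * p / ((Re z)\<^sup>2 - p\<^sup>2)"
      unfolding G_def p_def by (rule norm_integral_sin_exp_le[OF T 1 y])
    also have "\<dots> \<le> (1 + exp (2 * b * T)) * p / (p\<^sup>2 * q * (4 * m\<^sup>2 - 1))"
      using 2 3 p0 by (intro frac_le mult_nonneg_nonneg) (auto simp: add_nonneg_nonneg)
    also have "\<dots> = ((1 + exp (2 * b * T)) / (p * q)) * (1 / (4 * m\<^sup>2 - 1))"
      using p0 by (simp add: power2_eq_square)
    also have "(1 + exp (2 * b * T)) / (p * q) = \<kappa>"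
      using T \<gamma> by (simp add: \<kappa>_def p_def q_def power_divide mult_ac)
    finally show ?thesis using ij m by (simp add: k_def z_def)
  qed
  have diag: "G (\<sigma> i - cnj (\<sigma> i)) = of_real (integral {0..T} (\<lambda>t. sin (p * t) * exp (- (2 * Im (\<sigma> i)) * t)))" for i
  proof -
    have e: "\<i> * (\<sigma> i - cnj (\<sigma> i)) * of_real t = of_real (- (2 * Im (\<sigma> i)) * t)" for t
      by (simp add: complex_eq_iff)
    have "G (\<sigma> i - cnj (\<sigma> i)) = integral {0..T} (\<lambda>t. of_real (sin (p * t) * exp (- (2 * Im (\<sigma> i)) * t)))"
      unfolding G_def e exp_of_real by (simp only: of_real_mult)
    also have "\<dots> = of_real (integral {0..T} (\<lambda>t. sin (p * t) * exp (- (2 * Im (\<sigma> i)) * t)))"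
      by (intro integral_unique has_integral_of_real integrable_integral integrable_continuous_interval continuous_intros)
    finally show ?thesis .
  qed
  have expand: "complex_of_real (integral {0..T} (\<lambda>t. sin (p * t) * (cmod (exp_sum J \<sigma> a t))\<^sup>2))
     = (\<Sum>i\<in>J. \<Sum>j\<in>J. a i * cnj (a j) * G (\<sigma> i - cnj (\<sigma> j)))"
  proof -
    have pt: "complex_of_real (sin (p * t) * (cmod (exp_sum J \<sigma> a t))\<^sup>2) =
        (\<Sum>i\<in>J. \<Sum>j\<in>J. a i * cnj (a j) * (of_real (sin (p * t)) * exp (\<i> * (\<sigma> i - cnj (\<sigma> j)) * of_real t)))" for t
    proof -
      have "complex_of_real ((cmod (exp_sum J \<sigma> a t))\<^sup>2) = exp_sum J \<sigma> a t * cnj (exp_sum J \<sigma> a t)"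
        by (simp only: complex_norm_square)
      also have "cnj (exp_sum J \<sigma> a t) = (\<Sum>j\<in>J. cnj (a j) * exp (- \<i> * cnj (\<sigma> j) * of_real t))"
        by (simp add: exp_sum_def exp_cnj)
      also have "exp_sum J \<sigma> a t * \<dots> = (\<Sum>i\<in>J. \<Sum>j\<in>J. a i * cnj (a j) * exp (\<i> * (\<sigma> i - cnj (\<sigma> j)) * of_real t))"
        unfolding exp_sum_def sum_product
        by (intro sum.cong refl) (simp add: algebra_simps flip: exp_add)
      finally show ?thesis
        by (simp only: of_real_mult sum_distrib_left) (intro sum.cong refl, simp only: mult.left_commute)
    qed
    have "complex_of_real (integral {0..T} (\<lambda>t. sin (p * t) * (cmod (exp_sum J \<sigma> a t))\<^sup>2)) =
       integral {0..T} (\<lambda>t. complex_of_real (sin (p * t) * (cmod (exp_sum J \<sigma> a t))\<^sup>2))"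
      by (rule sym, intro integral_unique has_integral_of_real integrable_integral integrable_continuous_interval continuous_intros)
    also have "\<dots> = (\<Sum>i\<in>J. \<Sum>j\<in>J. a i * cnj (a j) * G (\<sigma> i - cnj (\<sigma> j)))"
      unfolding pt G_def
      by (intro integral_unique has_integral_sum J has_integral_mult_right integrable_integral
          integrable_continuous_interval continuous_intros)
    finally show ?thesis .
  qed
  let ?D = "(\<Sum>i\<in>J. (cmod (a i))\<^sup>2 * integral {0..T} (\<lambda>t. sin (p * t) * exp (- (2 * Im (\<sigma> i)) * t)))"
  have split: "(\<Sum>i\<in>J. \<Sum>j\<in>J. a i * cnj (a j) * G (\<sigma> i - cnj (\<sigma> j)))
      = of_real ?D + (\<Sum>i\<in>J. \<Sum>j\<in>J-{i}. a i * cnj (a j) * G (\<sigma> i - cnj (\<sigma> j)))"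
    unfolding of_real_sum sum.distrib[symmetric]
    by (intro sum.cong refl, subst sum.remove[OF J]) (auto simp: diag complex_norm_square simp del: of_real_power)
  \<comment> \<open>Schur's test: each product of two coefficients is at most the mean of their
    squares, and the symmetry of \<open>k\<close> turns both halves into the same sum over
    rows.\<close>
  have "cmod (\<Sum>i\<in>J. \<Sum>j\<in>J-{i}. a i * cnj (a j) * G (\<sigma> i - cnj (\<sigma> j)))
      \<le> (\<Sum>i\<in>J. \<Sum>j\<in>J-{i}. ((cmod (a i))\<^sup>2 + (cmod (a j))\<^sup>2) / 2 * k i j)"
  proof (intro sum_norm_le order_trans[OF norm_sum] sum_mono)
    fix i j assume ij: "i \<in> J" "j \<in> J - {i}"
    have "cmod (a i) * cmod (a j) \<le> ((cmod (a i))\<^sup>2 + (cmod (a j))\<^sup>2) / 2"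
      using sum_squares_bound[of "cmod (a i)" "cmod (a j)"] by simp
    then show "cmod (a i * cnj (a j) * G (\<sigma> i - cnj (\<sigma> j))) \<le> ((cmod (a i))\<^sup>2 + (cmod (a j))\<^sup>2) / 2 * k i j"
      unfolding norm_mult complex_mod_cnj using off[of i j] ij by (intro mult_mono) auto
  qed
  also have "\<dots> = (\<Sum>i\<in>J. \<Sum>j\<in>J. ((cmod (a i))\<^sup>2 + (cmod (a j))\<^sup>2) / 2 * k i j)"
    by (intro sum.cong refl sum.mono_neutral_left J) (auto simp: k_def)
  also have "\<dots> = ((\<Sum>i\<in>J. \<Sum>j\<in>J. (cmod (a i))\<^sup>2 * k i j) + (\<Sum>i\<in>J. \<Sum>j\<in>J. (cmod (a j))\<^sup>2 * k i j)) / 2"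
    unfolding sum.distrib[symmetric] sum_divide_distrib by (intro sum.cong refl) (simp add: ring_distribs add_divide_distrib)
  also have "(\<Sum>i\<in>J. \<Sum>j\<in>J. (cmod (a j))\<^sup>2 * k i j) = (\<Sum>i\<in>J. \<Sum>j\<in>J. (cmod (a i))\<^sup>2 * k i j)"
    by (subst sum.swap) (simp add: k_sym)
  also have "((\<Sum>i\<in>J. \<Sum>j\<in>J. (cmod (a i))\<^sup>2 * k i j) + (\<Sum>i\<in>J. \<Sum>j\<in>J. (cmod (a i))\<^sup>2 * k i j)) / 2
      = (\<Sum>i\<in>J. (cmod (a i))\<^sup>2 * (\<Sum>j\<in>J. k i j))"
    unfolding sum_distrib_left[of "(cmod (a _))\<^sup>2", symmetric] by simp
  also have "\<dots> \<le> (\<Sum>i\<in>J. (cmod (a i))\<^sup>2 * \<kappa>)"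
  proof (intro sum_mono mult_left_mono)
    fix i assume "i \<in> J"
    have "(\<Sum>j\<in>J. k i j) = (\<Sum>j\<in>J-{i}. \<kappa> * (1 / (4 * (real_of_int (i - j))\<^sup>2 - 1)))"
      by (intro sum.mono_neutral_cong_right J) (auto simp: k_def)
    also have "\<dots> = \<kappa> * (\<Sum>j\<in>J-{i}. 1 / (4 * (real_of_int (i - j))\<^sup>2 - 1))"
      by (simp add: sum_distrib_left)
    also have "\<dots> \<le> \<kappa> * 1"
      using \<kappa>0 J by (intro mult_left_mono sum_int_inverse_four_squares_le) auto
    finally show "(\<Sum>j\<in>J. k i j) \<le> \<kappa>" by simp
  qed simp
  finally have fin: "cmod (\<Sum>i\<in>J. \<Sum>j\<in>J-{i}. a i * cnj (a j) * G (\<sigma> i - cnj (\<sigma> j))) \<le> \<kappa> * (\<Sum>i\<in>J. (cmod (a i))\<^sup>2)"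
    by (simp add: sum_distrib_left mult.commute)
  have "\<bar>integral {0..T} (\<lambda>t. sin (p * t) * (cmod (exp_sum J \<sigma> a t))\<^sup>2) - ?D\<bar>
    = cmod (of_real (integral {0..T} (\<lambda>t. sin (p * t) * (cmod (exp_sum J \<sigma> a t))\<^sup>2)) - of_real ?D)"
    by (simp only: of_real_diff[symmetric] norm_of_real)
  also have "\<dots> \<le> \<kappa> * (\<Sum>i\<in>J. (cmod (a i))\<^sup>2)"
    unfolding expand split using fin by simp
  finally show ?thesis by (simp add: \<kappa>_def p_def)
qed

text \<open>The ratio of the off-diagonal row sums to the diagonal is at most
  \<open>(2\<pi>/T\<gamma>)\<^sup>2\<close> for real exponents, so the gap condition leaves room for a small imaginary part.\<close>

lemma ingham_inverse:
  assumes T: "T > 0" and \<gamma>: "\<gamma> > 0" "T * \<gamma> > 2 * pi"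
  shows "\<exists>b>0. \<exists>\<delta>>0. \<forall>(J :: int set) \<sigma> a. finite J
     \<longrightarrow> (\<forall>i\<in>J. \<forall>j\<in>J. \<gamma> * \<bar>real_of_int (i - j)\<bar> \<le> \<bar>Re (\<sigma> i) - Re (\<sigma> j)\<bar>)
     \<longrightarrow> (\<forall>i\<in>J. \<bar>Im (\<sigma> i)\<bar> \<le> b)
     \<longrightarrow> \<delta> * (\<Sum>i\<in>J. (cmod (a i))\<^sup>2) \<le> integral {0..T} (\<lambda>t. (cmod (exp_sum J \<sigma> a t))\<^sup>2)"
proof -
  define \<theta> where "\<theta> = (2 * pi / (T * \<gamma>))\<^sup>2"
  have "\<bar>2 * pi / (T * \<gamma>)\<bar> < 1" using \<gamma> T by simp
  then have \<theta>1: "\<theta> < 1" unfolding \<theta>_def by (simp only: abs_square_less_1)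
  \<comment> \<open>In units of \<open>2 * T / pi\<close>, the lower bound of the diagonal minus the
    off-diagonal bound tends to \<open>1 - \<theta> > 0\<close> as \<open>b\<close> tends to 0, so
    some positive \<open>b\<close> still leaves a positive margin.\<close>
  have "((\<lambda>b. exp (- (2 * b) * T) - (1 + exp (2 * b * T)) / 2 * \<theta>) \<longlongrightarrow> exp (- (2 * 0) * T) - (1 + exp (2 * 0 * T)) / 2 * \<theta>) (at_right 0)"
    by (intro tendsto_intros) auto
  then have "((\<lambda>b. exp (- (2 * b) * T) - (1 + exp (2 * b * T)) / 2 * \<theta>) \<longlongrightarrow> 1 - \<theta>) (at_right 0)" by simp
  then have "eventually (\<lambda>b. exp (- (2 * b) * T) - (1 + exp (2 * b * T)) / 2 * \<theta> > 0) (at_right (0::real))"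
    using \<theta>1 by (intro order_tendstoD) auto
  then obtain b where b: "b > 0" "exp (- (2 * b) * T) - (1 + exp (2 * b * T)) / 2 * \<theta> > 0"
    by (metis (mono_tags, lifting) dense eventually_at_right_field)
  define \<delta> where "\<delta> = (exp (- (2 * b) * T) - (1 + exp (2 * b * T)) / 2 * \<theta>) * (2 * T / pi)"
  have \<delta>: "\<delta> > 0" unfolding \<delta>_def using b T by (intro mult_pos_pos) auto
  have "\<delta> * (\<Sum>i\<in>J. (cmod (a i))\<^sup>2) \<le> integral {0..T} (\<lambda>t. (cmod (exp_sum J \<sigma> a t))\<^sup>2)"
    if J: "finite J" and gap: "\<forall>i\<in>J. \<forall>j\<in>J. \<gamma> * \<bar>real_of_int (i - j)\<bar> \<le> \<bar>Re (\<sigma> i) - Re (\<sigma> j)\<bar>"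
      and im: "\<forall>i\<in>J. \<bar>Im (\<sigma> i)\<bar> \<le> b" for J :: "int set" and \<sigma> a
  proof -
    let ?D = "\<Sum>i\<in>J. (cmod (a i))\<^sup>2 * integral {0..T} (\<lambda>t. sin (pi / T * t) * exp (- (2 * Im (\<sigma> i)) * t))"
    have "(\<Sum>i\<in>J. (cmod (a i))\<^sup>2 * (exp (- (2 * b) * T) * (2 * T / pi))) \<le> ?D"
      using im by (intro sum_mono mult_left_mono integral_sin_exp_damped(1) T) auto
    then have "(\<Sum>i\<in>J. (cmod (a i))\<^sup>2) * (exp (- (2 * b) * T) * (2 * T / pi)) \<le> ?D"
      by (simp only: sum_distrib_right)
    moreover have "?D - integral {0..T} (\<lambda>t. sin (pi / T * t) * (cmod (exp_sum J \<sigma> a t))\<^sup>2)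
        \<le> (1 + exp (2 * b * T)) / 2 * \<theta> * (2 * T / pi) * (\<Sum>i\<in>J. (cmod (a i))\<^sup>2)"
      using ingham_kernel_estimate[OF J T \<gamma>, of \<sigma> b a] gap im unfolding \<theta>_def by (auto simp: abs_le_iff)
    moreover have "integral {0..T} (\<lambda>t. sin (pi / T * t) * (cmod (exp_sum J \<sigma> a t))\<^sup>2)
         \<le> integral {0..T} (\<lambda>t. (cmod (exp_sum J \<sigma> a t))\<^sup>2)"
    proof (intro integral_le integrable_continuous_interval continuous_intros)
      fix t show "sin (pi / T * t) * (cmod (exp_sum J \<sigma> a t))\<^sup>2 \<le> (cmod (exp_sum J \<sigma> a t))\<^sup>2"
        using mult_right_mono[of "sin (pi / T * t)" 1 "(cmod (exp_sum J \<sigma> a t))\<^sup>2"] by simp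
    qed
    ultimately show ?thesis
      unfolding \<delta>_def left_diff_distrib by (simp only: mult.commute[of _ "\<Sum>i\<in>J. (cmod (a i))\<^sup>2"] right_diff_distrib)
  qed
  then show ?thesis using b(1) \<delta> by blast
qed

text \<open>Here \<open>T\<close> may be short, and the kernel vanishes at the ends of its interval.
  The observation interval is therefore shifted into the middle third of a longer interval
  \<open>{0..L}\<close>, on which the sine is at least 1/2 and for which the kernel estimate is
  available.\<close>

lemma ingham_direct:
  assumes T: "T > 0" and \<gamma>: "\<gamma> > 0" and b: "b \<ge> 0"
  shows "\<exists>B>0. \<forall>(J :: int set) \<sigma> a. finite J
     \<longrightarrow> (\<forall>i\<in>J. \<forall>j\<in>J. \<gamma> * \<bar>real_of_int (i - j)\<bar> \<le> \<bar>Re (\<sigma> i) - Re (\<sigma> j)\<bar>)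
     \<longrightarrow> (\<forall>i\<in>J. \<bar>Im (\<sigma> i)\<bar> \<le> b)
     \<longrightarrow> integral {0..T} (\<lambda>t. (cmod (exp_sum J \<sigma> a t))\<^sup>2) \<le> B * (\<Sum>i\<in>J. (cmod (a i))\<^sup>2)"
proof -
  \<comment> \<open>\<open>s \<ge> 2 * pi / \<gamma>\<close> gives
    \<open>L * \<gamma> \<ge> 6 * pi\<close>, and \<open>s \<ge> T\<close> puts
    \<open>{s..T + s}\<close> into the middle third \<open>{s..2 * s}\<close>.\<close>
  define s where "s = max T (2 * pi / \<gamma>)"
  define L where "L = 3 * s"
  have s: "s > 0" "T \<le> s" "s * \<gamma> \<ge> 2 * pi" using T \<gamma> by (auto simp: s_def field_simps max_def)
  have "L * \<gamma> = 3 * (s * \<gamma>)" by (simp add: L_def)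
  then have L: "L > 0" "L * \<gamma> > 2 * pi" using s pi_gt_zero by (simp add: L_def, linarith)
  define \<kappa> where "\<kappa> = exp (2 * b * L) * (2 * L / pi) + (1 + exp (2 * b * L)) / 2 * (2 * pi / (L * \<gamma>))\<^sup>2 * (2 * L / pi)"
  have \<kappa>: "\<kappa> > 0" unfolding \<kappa>_def using L by (intro add_pos_nonneg mult_nonneg_nonneg mult_pos_pos) auto
  have main: "integral {0..T} (\<lambda>t. (cmod (exp_sum J \<sigma> a t))\<^sup>2) \<le> 2 * \<kappa> * exp (2 * b * s) * (\<Sum>i\<in>J. (cmod (a i))\<^sup>2)"
    if J: "finite J" and gap: "\<forall>i\<in>J. \<forall>j\<in>J. \<gamma> * \<bar>real_of_int (i - j)\<bar> \<le> \<bar>Re (\<sigma> i) - Re (\<sigma> j)\<bar>"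
      and im: "\<forall>i\<in>J. \<bar>Im (\<sigma> i)\<bar> \<le> b" for J :: "int set" and \<sigma> a
  proof -
    \<comment> \<open>The time shift by \<open>s\<close> is absorbed into the coefficients, which
      grow by at most the factor \<open>exp (b * s)\<close>.\<close>
    define a' where "a' = (\<lambda>i. a i * exp (- \<i> * \<sigma> i * of_real s))"
    let ?f = "\<lambda>t. (cmod (exp_sum J \<sigma> a t))\<^sup>2" and ?g = "\<lambda>t. (cmod (exp_sum J \<sigma> a' t))\<^sup>2"
    have shift: "exp_sum J \<sigma> a t = exp_sum J \<sigma> a' (t + s)" for t
      unfolding exp_sum_def a'_def
      by (intro sum.cong refl) (simp add: algebra_simps flip: exp_add)
    have "integral {0..T} ?f = integral {0..T} (\<lambda>t. ?g (t + s))" by (simp only: shift)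
    also have "\<dots> = integral {0 + s..T + s} ?g"
      using integral_shift_Icc_real[of 0 T ?g s] by (simp add: comp_def add.commute)
    also have "\<dots> = integral {s..T + s} ?g" by simp
    also have "\<dots> \<le> integral {s..T + s} (\<lambda>t. 2 * (sin (pi / L * t) * ?g t))"
    proof (intro integral_le integrable_continuous_interval continuous_intros)
      fix t assume t: "t \<in> {s..T + s}"
      have "sin (pi / 6) \<le> sin (pi / L * t)"
      proof -
        have t2: "pi / 3 \<le> pi / L * t" "pi / L * t \<le> 2 * pi / 3"
          using t s by (auto simp: L_def field_simps)
        show ?thesis
        proof (cases "pi / L * t \<le> pi / 2")
          case True
          have "pi / 6 \<le> pi / L * t" using t2(1) pi_gt_zero by linarith
          then show ?thesis using True by (intro sin_monotone_2pi_le) auto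
        next
          case False
          have "pi / 6 \<le> pi - pi / L * t" "pi - pi / L * t \<le> pi / 2"
            using t2(2) False pi_gt_zero by linarith+
          then have "sin (pi / 6) \<le> sin (pi - pi / L * t)" by (intro sin_monotone_2pi_le) auto
          then show ?thesis by simp
        qed
      qed
      then have "1 \<le> 2 * sin (pi / L * t)" by (simp add: sin_30)
      then have "1 * ?g t \<le> (2 * sin (pi / L * t)) * ?g t" by (intro mult_right_mono) auto
      then show "?g t \<le> 2 * (sin (pi / L * t) * ?g t)" by simp
    qed
    also have "\<dots> \<le> integral {0..L} (\<lambda>t. 2 * (sin (pi / L * t) * ?g t))"
    proof (intro integral_subset_le ballI integrable_continuous_interval continuous_intros)
      show "{s..T + s} \<subseteq> {0..L}" using s by (auto simp: L_def)
      fix t assume "t \<in> {0..L}"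
      then have "sin (pi / L * t) \<ge> 0" using L by (intro sin_ge_zero) (auto simp: field_simps)
      then show "0 \<le> 2 * (sin (pi / L * t) * ?g t)" by simp
    qed
    also have "\<dots> = 2 * integral {0..L} (\<lambda>t. sin (pi / L * t) * ?g t)" by simp
    also have "integral {0..L} (\<lambda>t. sin (pi / L * t) * ?g t) \<le> \<kappa> * (\<Sum>i\<in>J. (cmod (a' i))\<^sup>2)"
    proof -
      let ?D = "\<Sum>i\<in>J. (cmod (a' i))\<^sup>2 * integral {0..L} (\<lambda>t. sin (pi / L * t) * exp (- (2 * Im (\<sigma> i)) * t))"
      have "?D \<le> (\<Sum>i\<in>J. (cmod (a' i))\<^sup>2 * (exp (2 * b * L) * (2 * L / pi)))"
        using im by (intro sum_mono mult_left_mono integral_sin_exp_damped(2) L(1)) auto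
      then have "?D \<le> (\<Sum>i\<in>J. (cmod (a' i))\<^sup>2) * (exp (2 * b * L) * (2 * L / pi))"
        by (simp only: sum_distrib_right)
      moreover have "integral {0..L} (\<lambda>t. sin (pi / L * t) * ?g t) - ?D
          \<le> (1 + exp (2 * b * L)) / 2 * (2 * pi / (L * \<gamma>))\<^sup>2 * (2 * L / pi) * (\<Sum>i\<in>J. (cmod (a' i))\<^sup>2)"
        using ingham_kernel_estimate[OF J L(1) \<gamma> L(2), of \<sigma> b a'] gap im by (auto simp: abs_le_iff)
      ultimately show ?thesis
        unfolding \<kappa>_def by (simp only: mult.commute[of _ "\<Sum>i\<in>J. (cmod (a' i))\<^sup>2"] distrib_left)
    qed
    also have "(\<Sum>i\<in>J. (cmod (a' i))\<^sup>2) \<le> (\<Sum>i\<in>J. exp (2 * b * s) * (cmod (a i))\<^sup>2)"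
    proof (intro sum_mono)
      fix i assume i: "i \<in> J"
      have "Im (\<sigma> i) * s \<le> b * s" using im i s by (intro mult_right_mono) auto
      then have "cmod (exp (- \<i> * \<sigma> i * of_real s)) \<le> exp (b * s)" by (simp add: norm_exp_eq_Re)
      then have "(cmod (a' i))\<^sup>2 \<le> (cmod (a i) * exp (b * s))\<^sup>2"
        unfolding a'_def norm_mult by (intro power_mono mult_left_mono) auto
      also have "\<dots> = exp (2 * b * s) * (cmod (a i))\<^sup>2"
        by (simp add: power_mult_distrib mult.commute mult.left_commute flip: exp_double)
      finally show "(cmod (a' i))\<^sup>2 \<le> exp (2 * b * s) * (cmod (a i))\<^sup>2" .
    qed
    finally show ?thesis using \<kappa> by (simp add: sum_distrib_left mult.assoc)
  qed
  show ?thesis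
    by (rule exI[of _ "2 * \<kappa> * exp (2 * b * s)"]) (use \<kappa> main in auto)
qed

subsection \<open>Real oscillating sums\<close>

definition osc :: "(nat \<Rightarrow> complex) \<Rightarrow> (nat \<Rightarrow> complex) \<Rightarrow> nat \<Rightarrow> real \<Rightarrow> real" where
  "osc \<sigma> g N t = (\<Sum>n=1..N. 2 * Re (g n * exp (\<i> * \<sigma> n * of_real t)))"

lemma continuous_on_osc [continuous_intros]: "continuous_on S (osc \<sigma> g N)"
  unfolding osc_def by (intro continuous_intros)

lemma osc_add: "osc \<sigma> (\<lambda>n. g n + h n) N t = osc \<sigma> g N t + osc \<sigma> h N t"
  by (simp add: osc_def sum.distrib ring_distribs)

lemma osc_diff: "osc \<sigma> (\<lambda>n. g n - h n) N t = osc \<sigma> g N t - osc \<sigma> h N t"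
  by (simp add: osc_def sum_subtractf ring_distribs)

text \<open>A gap \<open>\<gamma>\<close> of the real parts beyond \<open>n\<^sub>0\<close> persists after adjoining the mirror images
  \<open>-cnj \<sigma>\<^sub>n\<close>, indexed by negative integers, once \<open>Re \<sigma>\<^sub>n \<ge> \<gamma> n\<close>.\<close>

lemma osc_as_exp_sum:
  fixes \<sigma> g :: "nat \<Rightarrow> complex"
  assumes n0: "n0 \<ge> 1" and g: "\<forall>n<n0. g n = 0" and \<gamma>: "\<gamma> > 0"
    and gap: "\<forall>n\<ge>n0. \<gamma> \<le> Re (\<sigma> (Suc n)) - Re (\<sigma> n)" and lin: "\<forall>n\<ge>n0. \<gamma> * real n \<le> Re (\<sigma> n)"
    and im: "\<forall>n\<ge>n0. \<bar>Im (\<sigma> n)\<bar> \<le> b"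
  obtains J :: "int set" and \<sigma>' a where "finite J"
    "\<forall>i\<in>J. \<forall>j\<in>J. \<gamma> * \<bar>real_of_int (i - j)\<bar> \<le> \<bar>Re (\<sigma>' i) - Re (\<sigma>' j)\<bar>"
    "\<forall>i\<in>J. \<bar>Im (\<sigma>' i)\<bar> \<le> b"
    "\<And>t. (cmod (exp_sum J \<sigma>' a t))\<^sup>2 = (osc \<sigma> g N t)\<^sup>2"
    "(\<Sum>i\<in>J. (cmod (a i))\<^sup>2) = 2 * (\<Sum>n=1..N. (cmod (g n))\<^sup>2)"
proof -
  define J1 where "J1 = int ` {n0..N}"
  define J2 where "J2 = (\<lambda>n. - int n) ` {n0..N}"
  define \<sigma>' where "\<sigma>' = (\<lambda>i. if i > 0 then \<sigma> (nat i) else - cnj (\<sigma> (nat (- i))))"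
  define a where "a = (\<lambda>i. if i > 0 then g (nat i) else cnj (g (nat (- i))))"
  have dj: "J1 \<inter> J2 = {}" using n0 by (auto simp: J1_def J2_def)
  have fin: "finite J1" "finite J2" by (auto simp: J1_def J2_def)
  have sum1: "sum f J1 = (\<Sum>n=n0..N. f (int n))" for f :: "int \<Rightarrow> 'a::comm_monoid_add"
    unfolding J1_def by (subst sum.reindex) (auto simp: inj_on_def)
  have sum2: "sum f J2 = (\<Sum>n=n0..N. f (- int n))" for f :: "int \<Rightarrow> 'a::comm_monoid_add"
    unfolding J2_def by (subst sum.reindex) (auto simp: inj_on_def)
  have tail: "sum f {1..N} = sum f {n0..N}" if "\<And>n. n < n0 \<Longrightarrow> f n = 0" for f :: "nat \<Rightarrow> real"
    using that n0 by (intro sum.mono_neutral_right) auto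
  have pos: "\<sigma>' (int n) = \<sigma> n" "a (int n) = g n" "\<sigma>' (- int n) = - cnj (\<sigma> n)" "a (- int n) = cnj (g n)"
    if "n \<ge> n0" for n using that n0 by (auto simp: \<sigma>'_def a_def)
  have inc: "\<gamma> * real k \<le> Re (\<sigma> (n + k)) - Re (\<sigma> n)" if "n \<ge> n0" for n k
  proof (induction k)
    case (Suc k)
    have "\<gamma> \<le> Re (\<sigma> (Suc (n + k))) - Re (\<sigma> (n + k))" using gap that by auto
    then show ?case using Suc by (simp add: ring_distribs)
  qed simp
  have inc': "\<gamma> * \<bar>real n - real m\<bar> \<le> \<bar>Re (\<sigma> n) - Re (\<sigma> m)\<bar>" if "n \<ge> n0" "m \<ge> n0" for n m
  proof (cases "n \<le> m")
    case True
    then show ?thesis using inc[OF that(1), of "m - n"] by (simp add: of_nat_diff)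
  next
    case False
    then show ?thesis using inc[OF that(2), of "n - m"] by (simp add: of_nat_diff)
  qed
  have inc2: "\<gamma> * (real n + real m) \<le> \<bar>Re (\<sigma> n) + Re (\<sigma> m)\<bar>" if "n \<ge> n0" "m \<ge> n0" for n m
    using lin that by (smt (verit) distrib_left)
  show ?thesis
  proof
    show "finite (J1 \<union> J2)" using fin by simp
    show "\<forall>i\<in>J1 \<union> J2. \<forall>j\<in>J1 \<union> J2. \<gamma> * \<bar>real_of_int (i - j)\<bar> \<le> \<bar>Re (\<sigma>' i) - Re (\<sigma>' j)\<bar>"
    proof (intro ballI)
      fix i j assume "i \<in> J1 \<union> J2" "j \<in> J1 \<union> J2"
      then obtain n m where nm: "n \<ge> n0" "m \<ge> n0" "i = int n \<or> i = - int n" "j = int m \<or> j = - int m"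
        by (auto simp: J1_def J2_def)
      have "\<bar>- real n - real m\<bar> = real n + real m" by simp
      moreover have "\<bar>- Re (\<sigma> n) - Re (\<sigma> m)\<bar> = \<bar>Re (\<sigma> n) + Re (\<sigma> m)\<bar>" by simp
      moreover have "\<bar>real m - real n\<bar> = \<bar>real n - real m\<bar>" "\<bar>Re (\<sigma> m) - Re (\<sigma> n)\<bar> = \<bar>Re (\<sigma> n) - Re (\<sigma> m)\<bar>" by simp_all
      ultimately show "\<gamma> * \<bar>real_of_int (i - j)\<bar> \<le> \<bar>Re (\<sigma>' i) - Re (\<sigma>' j)\<bar>"
        using nm(3,4) inc'[OF nm(1,2)] inc2[OF nm(1,2)] nm(1,2)
        by (elim disjE) (simp_all add: pos add.commute[of "real m" "real n"])
    qed
    show "\<forall>i\<in>J1 \<union> J2. \<bar>Im (\<sigma>' i)\<bar> \<le> b" using im by (auto simp: J1_def J2_def pos)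
    show "(cmod (exp_sum (J1 \<union> J2) \<sigma>' a t))\<^sup>2 = (osc \<sigma> g N t)\<^sup>2" for t
    proof -
      have "exp_sum (J1 \<union> J2) \<sigma>' a t = (\<Sum>n=n0..N. of_real (2 * Re (g n * exp (\<i> * \<sigma> n * of_real t))))"
        unfolding exp_sum_def sum.union_disjoint[OF fin dj] sum1 sum2 sum.distrib[symmetric]
      proof (intro sum.cong refl)
        fix n assume "n \<in> {n0..N}"
        then have n: "n \<ge> n0" by simp
        have "exp (\<i> * - cnj (\<sigma> n) * of_real t) = cnj (exp (\<i> * \<sigma> n * of_real t))"
          by (simp add: exp_cnj)
        then have "a (int n) * exp (\<i> * \<sigma>' (int n) * of_real t) + a (- int n) * exp (\<i> * \<sigma>' (- int n) * of_real t)
          = g n * exp (\<i> * \<sigma> n * of_real t) + cnj (g n * exp (\<i> * \<sigma> n * of_real t))"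
          unfolding pos[OF n] complex_cnj_mult by simp
        also have "\<dots> = of_real (2 * Re (g n * exp (\<i> * \<sigma> n * of_real t)))"
          by (rule complex_add_cnj)
        finally show "a (int n) * exp (\<i> * \<sigma>' (int n) * of_real t) + a (- int n) * exp (\<i> * \<sigma>' (- int n) * of_real t)
          = of_real (2 * Re (g n * exp (\<i> * \<sigma> n * of_real t)))" .
      qed
      also have "\<dots> = of_real (osc \<sigma> g N t)"
        unfolding osc_def of_real_sum[symmetric] by (subst tail) (use g in auto)
      finally show ?thesis by simp
    qed
    show "(\<Sum>i\<in>J1 \<union> J2. (cmod (a i))\<^sup>2) = 2 * (\<Sum>n=1..N. (cmod (g n))\<^sup>2)"
      unfolding sum.union_disjoint[OF fin dj] sum1 sum2 by (subst tail) (use g pos in auto)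
  qed
qed

text \<open>Take a slope strictly between \<open>\<gamma>'\<close> and \<open>\<gamma>\<close>: it
  bounds the increments from some index on, and its surplus over \<open>\<gamma>'\<close> eventually
  outweighs the value of the sequence at that index, however negative. Hence the linear bound has no
  additive constant, as the mirror images require.\<close>

lemma eventually_gap_linear:
  fixes x :: "nat \<Rightarrow> real"
  assumes gap: "\<And>\<gamma>'. \<gamma>' < \<gamma> \<Longrightarrow> eventually (\<lambda>n. \<gamma>' < x (Suc n) - x n) sequentially" and "\<gamma>' < \<gamma>"
  obtains n0 where "n0 \<ge> 1" "\<forall>n\<ge>n0. \<gamma>' \<le> x (Suc n) - x n" "\<forall>n\<ge>n0. \<gamma>' * real n \<le> x n"
proof -
  obtain g where g: "\<gamma>' < g" "g < \<gamma>" using assms(2) dense by blast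
  obtain n1 where n1: "\<forall>n\<ge>n1. g < x (Suc n) - x n" using gap[OF g(2)] by (auto simp: eventually_sequentially)
  have inc: "g * real k \<le> x (n1 + k) - x n1" for k
  proof (induction k)
    case (Suc k)
    have "g < x (Suc (n1 + k)) - x (n1 + k)" using n1 by auto
    then show ?case using Suc by (simp add: ring_distribs)
  qed simp
  obtain m :: nat where m: "(g * real n1 - x n1) / (g - \<gamma>') \<le> real m" using real_arch_simple by blast
  have lin: "\<gamma>' * real n \<le> x n" if "n \<ge> max n1 m" for n
  proof -
    have "(g * real n1 - x n1) / (g - \<gamma>') \<le> real n" using m that by linarith
    then have "g * real n1 - x n1 \<le> (g - \<gamma>') * real n" using g by (simp add: field_simps)
    moreover have "g * real (n - n1) \<le> x n - x n1" using inc[of "n - n1"] that by simp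
    ultimately show ?thesis using that by (simp add: of_nat_diff algebra_simps)
  qed
  show ?thesis
    by (rule that[of "max 1 (max n1 m)"]) (use lin n1 g in \<open>auto intro!: less_imp_le intro: less_trans\<close>)
qed

lemma osc_inverse:
  fixes \<sigma> :: "nat \<Rightarrow> complex"
  assumes gap: "\<And>\<gamma>'. \<gamma>' < \<gamma> \<Longrightarrow> eventually (\<lambda>n. \<gamma>' < Re (\<sigma> (Suc n)) - Re (\<sigma> n)) sequentially"
    and im: "(\<lambda>n. Im (\<sigma> n)) \<longlonglongrightarrow> \<beta>" and \<gamma>: "\<gamma> > 0" and T: "T > 2 * pi / \<gamma>"
  shows "\<exists>n0\<ge>1. \<exists>\<delta>>0. \<forall>g N. (\<forall>n<n0. g n = 0) \<longrightarrow>
     \<delta> * (\<Sum>n=1..N. (cmod (g n))\<^sup>2) \<le> integral {0..T} (\<lambda>t. (osc \<sigma> g N t)\<^sup>2)"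
proof -
  have T0: "T > 0" using T \<gamma> pi_gt_zero by (smt (verit) divide_pos_pos)
  have "2 * pi / T < \<gamma>" using T T0 \<gamma> by (simp add: field_simps)
  \<comment> \<open>The gap is \<open>\<gamma>\<close> only in the limit; the strict inequality for
    \<open>T\<close> leaves room for a smaller gap that holds from some index on.\<close>
  then obtain \<gamma>' where \<gamma>': "2 * pi / T < \<gamma>'" "\<gamma>' < \<gamma>" using dense by blast
  have \<gamma>'0: "\<gamma>' > 0" using \<gamma>' T0 pi_gt_zero by (smt (verit) divide_pos_pos)
  have T\<gamma>: "T * \<gamma>' > 2 * pi" using \<gamma>' T0 by (simp add: field_simps)
  obtain b \<delta> where b: "b > 0" and \<delta>: "\<delta> > 0" and ing: "\<And>(J :: int set) \<sigma> a. finite J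
     \<Longrightarrow> (\<forall>i\<in>J. \<forall>j\<in>J. \<gamma>' * \<bar>real_of_int (i - j)\<bar> \<le> \<bar>Re (\<sigma> i) - Re (\<sigma> j)\<bar>)
     \<Longrightarrow> (\<forall>i\<in>J. \<bar>Im (\<sigma> i)\<bar> \<le> b)
     \<Longrightarrow> \<delta> * (\<Sum>i\<in>J. (cmod (a i))\<^sup>2) \<le> integral {0..T} (\<lambda>t. (cmod (exp_sum J \<sigma> a t))\<^sup>2)"
    using ingham_inverse[OF T0 \<gamma>'0 T\<gamma>] by blast
  define \<tau> where "\<tau> = (\<lambda>n. \<sigma> n - \<i> * of_real \<beta>)"
  obtain n1 where n1: "n1 \<ge> 1" "\<forall>n\<ge>n1. \<gamma>' \<le> Re (\<tau> (Suc n)) - Re (\<tau> n)" "\<forall>n\<ge>n1. \<gamma>' * real n \<le> Re (\<tau> n)"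
    using eventually_gap_linear[of \<gamma> "\<lambda>n. Re (\<tau> n)" \<gamma>'] gap \<gamma>' by (auto simp: \<tau>_def)
  obtain n2 where n2: "\<forall>n\<ge>n2. \<bar>Im (\<tau> n)\<bar> \<le> b"
    using LIMSEQ_D[OF im b] by (auto simp: \<tau>_def intro: less_imp_le)
  define n0 where "n0 = max n1 n2"
  have n0: "n0 \<ge> 1" "\<forall>n\<ge>n0. \<gamma>' \<le> Re (\<tau> (Suc n)) - Re (\<tau> n)" "\<forall>n\<ge>n0. \<gamma>' * real n \<le> Re (\<tau> n)"
    "\<forall>n\<ge>n0. \<bar>Im (\<tau> n)\<bar> \<le> b" using n1 n2 by (auto simp: n0_def)
  \<comment> \<open>The price of removing the squared weight \<open>exp (\<beta> * t)\<close> on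
    \<open>{0..T}\<close>, for either sign of \<open>\<beta>\<close>.\<close>
  define K where "K = exp (2 * \<bar>\<beta>\<bar> * T)"
  have shift: "osc \<tau> g N t = exp (\<beta> * t) * osc \<sigma> g N t" for g N t
  proof -
    have e: "exp (\<i> * \<tau> n * of_real t) = of_real (exp (\<beta> * t)) * exp (\<i> * \<sigma> n * of_real t)" for n
      by (simp add: \<tau>_def algebra_simps flip: exp_of_real exp_add)
    have "Re (g n * exp (\<i> * \<tau> n * of_real t)) = exp (\<beta> * t) * Re (g n * exp (\<i> * \<sigma> n * of_real t))" for n
      unfolding e mult.left_commute[of "g n"] by simp
    then show ?thesis unfolding osc_def sum_distrib_left
      by (intro sum.cong refl) (simp only: mult.left_commute)
  qed
  \<comment> \<open>The factor 2 counts each mode together with its mirror image.\<close>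
  have "(2 * \<delta> / K) * (\<Sum>n=1..N. (cmod (g n))\<^sup>2) \<le> integral {0..T} (\<lambda>t. (osc \<sigma> g N t)\<^sup>2)"
    if g: "\<forall>n<n0. g n = 0" for g N
  proof -
    obtain J :: "int set" and \<sigma>' a where J: "finite J"
      "\<forall>i\<in>J. \<forall>j\<in>J. \<gamma>' * \<bar>real_of_int (i - j)\<bar> \<le> \<bar>Re (\<sigma>' i) - Re (\<sigma>' j)\<bar>"
      "\<forall>i\<in>J. \<bar>Im (\<sigma>' i)\<bar> \<le> b"
      and J2: "\<And>t. (cmod (exp_sum J \<sigma>' a t))\<^sup>2 = (osc \<tau> g N t)\<^sup>2"
      "(\<Sum>i\<in>J. (cmod (a i))\<^sup>2) = 2 * (\<Sum>n=1..N. (cmod (g n))\<^sup>2)"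
      by (rule osc_as_exp_sum[OF n0(1) g \<gamma>'0 n0(2-4), of N]) (rule that)
    have "2 * \<delta> * (\<Sum>n=1..N. (cmod (g n))\<^sup>2) \<le> integral {0..T} (\<lambda>t. (osc \<tau> g N t)\<^sup>2)"
      using ing[OF J, of a] unfolding J2 by simp
    also have "\<dots> \<le> integral {0..T} (\<lambda>t. K * (osc \<sigma> g N t)\<^sup>2)"
    proof (intro integral_le integrable_continuous_interval continuous_intros)
      fix t assume t: "t \<in> {0..T}"
      have "\<beta> * t \<le> \<bar>\<beta>\<bar> * T" using t by (intro mult_mono) auto
      then have "exp (2 * (\<beta> * t)) \<le> K" by (simp add: K_def)
      then show "(osc \<tau> g N t)\<^sup>2 \<le> K * (osc \<sigma> g N t)\<^sup>2"
        unfolding shift power_mult_distrib exp_double[symmetric] by (intro mult_right_mono) auto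
    qed
    also have "\<dots> = K * integral {0..T} (\<lambda>t. (osc \<sigma> g N t)\<^sup>2)" by simp
    finally show ?thesis by (simp add: K_def field_simps)
  qed
  moreover have "n0 \<ge> 1" "2 * \<delta> / K > 0" using n1 \<delta> by (auto simp: n0_def K_def)
  ultimately show ?thesis by blast
qed

lemma abs_osc_le:
  assumes "\<And>n. \<bar>Im (\<sigma> n)\<bar> \<le> b" "t \<in> {0..T}"
  shows "\<bar>osc \<sigma> g N t\<bar> \<le> 2 * exp (b * T) * (\<Sum>n=1..N. cmod (g n))"
proof -
  have b: "b \<ge> 0" using assms(1)[of 0] by linarith
  have "\<bar>2 * Re (g n * exp (\<i> * \<sigma> n * of_real t))\<bar> \<le> 2 * exp (b * T) * cmod (g n)" for n
  proof -
    have "- (Im (\<sigma> n) * t) \<le> b * t" using assms(1)[of n] assms(2)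
      by (metis abs_le_D2 atLeastAtMost_iff mult_minus_left mult_right_mono)
    also have "\<dots> \<le> b * T" using assms(2) b by (intro mult_left_mono) auto
    finally have "cmod (exp (\<i> * \<sigma> n * of_real t)) \<le> exp (b * T)" by (simp add: norm_exp_eq_Re)
    then have "cmod (g n * exp (\<i> * \<sigma> n * of_real t)) \<le> cmod (g n) * exp (b * T)"
      unfolding norm_mult by (intro mult_left_mono) auto
    then show ?thesis using abs_Re_le_cmod[of "g n * exp (\<i> * \<sigma> n * of_real t)"]
      by (simp add: abs_mult mult.commute)
  qed
  then show ?thesis unfolding osc_def sum_distrib_left by (intro order_trans[OF sum_abs] sum_mono)
qed

text \<open>From \<open>n0\<close> on there is a uniform gap and \<open>ingham_direct\<close>
  applies with any bound on the imaginary parts, so the exponents stay where they are. The modes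
  below \<open>n0\<close> have no guaranteed gap but are few: by Cauchy-Schwarz the square of their
  absolute sum is at most \<open>n0\<close> times their energy.\<close>

lemma osc_direct:
  fixes \<sigma> :: "nat \<Rightarrow> complex"
  assumes gap: "\<And>\<gamma>'. \<gamma>' < \<gamma> \<Longrightarrow> eventually (\<lambda>n. \<gamma>' < Re (\<sigma> (Suc n)) - Re (\<sigma> n)) sequentially"
    and im: "(\<lambda>n. Im (\<sigma> n)) \<longlonglongrightarrow> \<beta>" and \<gamma>: "\<gamma> > 0" and T: "T > 0"
  shows "\<exists>B>0. \<forall>g N. integral {0..T} (\<lambda>t. (osc \<sigma> g N t)\<^sup>2) \<le> B * (\<Sum>n=1..N. (cmod (g n))\<^sup>2)"
proof -
  obtain \<gamma>' where \<gamma>': "0 < \<gamma>'" "\<gamma>' < \<gamma>" using dense \<gamma> by blast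
  obtain b where b: "\<And>n. \<bar>Im (\<sigma> n)\<bar> \<le> b"
    using convergent_imp_Bseq[OF convergentI[OF im]] by (auto simp: Bseq_def)
  have b0: "b \<ge> 0" using b[of 0] by linarith
  obtain n0 where n0: "n0 \<ge> 1" "\<forall>n\<ge>n0. \<gamma>' \<le> Re (\<sigma> (Suc n)) - Re (\<sigma> n)" "\<forall>n\<ge>n0. \<gamma>' * real n \<le> Re (\<sigma> n)"
    using eventually_gap_linear[of \<gamma> "\<lambda>n. Re (\<sigma> n)" \<gamma>'] gap \<gamma>' by auto
  obtain B where B: "B > 0" and ing: "\<And>(J :: int set) \<sigma> a. finite J
     \<Longrightarrow> (\<forall>i\<in>J. \<forall>j\<in>J. \<gamma>' * \<bar>real_of_int (i - j)\<bar> \<le> \<bar>Re (\<sigma> i) - Re (\<sigma> j)\<bar>)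
     \<Longrightarrow> (\<forall>i\<in>J. \<bar>Im (\<sigma> i)\<bar> \<le> b)
     \<Longrightarrow> integral {0..T} (\<lambda>t. (cmod (exp_sum J \<sigma> a t))\<^sup>2) \<le> B * (\<Sum>i\<in>J. (cmod (a i))\<^sup>2)"
    using ingham_direct[OF T \<gamma>'(1) b0] by blast
  define H where "H = T * (4 * exp (2 * b * T) * real n0)"
  have H: "H \<ge> 0" using T by (simp add: H_def)
  have "integral {0..T} (\<lambda>t. (osc \<sigma> g N t)\<^sup>2) \<le> (2 * H + 4 * B) * (\<Sum>n=1..N. (cmod (g n))\<^sup>2)" for g N
  proof -
    define g1 where "g1 = (\<lambda>n. if n < n0 then g n else 0)"
    define g2 where "g2 = (\<lambda>n. if n < n0 then 0 else g n)"
    have g12: "osc \<sigma> g N t = osc \<sigma> g1 N t + osc \<sigma> g2 N t" for t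
      unfolding osc_add[symmetric] by (rule arg_cong[of _ _ "\<lambda>g. osc \<sigma> g N t"]) (auto simp: g1_def g2_def)
    have le: "(\<Sum>n=1..N. (cmod (g1 n))\<^sup>2) \<le> (\<Sum>n=1..N. (cmod (g n))\<^sup>2)"
       "(\<Sum>n=1..N. (cmod (g2 n))\<^sup>2) \<le> (\<Sum>n=1..N. (cmod (g n))\<^sup>2)"
      by (auto intro!: sum_mono simp: g1_def g2_def)
    obtain J :: "int set" and \<sigma>' a where J: "finite J"
      "\<forall>i\<in>J. \<forall>j\<in>J. \<gamma>' * \<bar>real_of_int (i - j)\<bar> \<le> \<bar>Re (\<sigma>' i) - Re (\<sigma>' j)\<bar>"
      "\<forall>i\<in>J. \<bar>Im (\<sigma>' i)\<bar> \<le> b"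
      and J2: "\<And>t. (cmod (exp_sum J \<sigma>' a t))\<^sup>2 = (osc \<sigma> g2 N t)\<^sup>2"
      "(\<Sum>i\<in>J. (cmod (a i))\<^sup>2) = 2 * (\<Sum>n=1..N. (cmod (g2 n))\<^sup>2)"
      by (rule osc_as_exp_sum[OF n0(1) _ \<gamma>'(1) n0(2,3), of g2 b N]) (auto simp: g2_def b intro: that)
    have tail: "integral {0..T} (\<lambda>t. (osc \<sigma> g2 N t)\<^sup>2) \<le> 2 * B * (\<Sum>n=1..N. (cmod (g2 n))\<^sup>2)"
      using ing[OF J, of a] unfolding J2 by simp
    have hsum: "(\<Sum>n=1..N. cmod (g1 n))\<^sup>2 \<le> real n0 * (\<Sum>n=1..N. (cmod (g1 n))\<^sup>2)"
    proof -
      let ?A = "{1..N} \<inter> {..<n0}"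
      have "(\<Sum>n=1..N. cmod (g1 n)) = (\<Sum>n\<in>?A. cmod (g1 n))"
        by (intro sum.mono_neutral_right) (auto simp: g1_def)
      also have "\<dots>\<^sup>2 \<le> (\<Sum>n\<in>?A. (cmod (g1 n))\<^sup>2) * real (card ?A)"
        by (rule sum_squared_le_sum_of_squares)
      also have "(\<Sum>n\<in>?A. (cmod (g1 n))\<^sup>2) = (\<Sum>n=1..N. (cmod (g1 n))\<^sup>2)"
        by (intro sum.mono_neutral_left) (auto simp: g1_def)
      also have "\<dots> * real (card ?A) \<le> \<dots> * real n0"
        using card_mono[of "{..<n0}" ?A] by (intro mult_left_mono) (auto intro: sum_nonneg)
      finally show ?thesis by (simp add: mult.commute)
    qed
    have "integral {0..T} (\<lambda>t. (osc \<sigma> g1 N t)\<^sup>2) \<le> integral {0..T} (\<lambda>t. 4 * exp (2 * b * T) * real n0 * (\<Sum>n=1..N. (cmod (g1 n))\<^sup>2))"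
    proof (intro integral_le integrable_continuous_interval continuous_intros)
      fix t assume t: "t \<in> {0..T}"
      have "\<bar>osc \<sigma> g1 N t\<bar>\<^sup>2 \<le> (2 * exp (b * T) * (\<Sum>n=1..N. cmod (g1 n)))\<^sup>2"
        using abs_osc_le[OF b t] by (intro power_mono) auto
      also have "\<dots> = 4 * exp (2 * b * T) * (\<Sum>n=1..N. cmod (g1 n))\<^sup>2"
        by (simp add: power_mult_distrib mult.assoc flip: exp_double)
      also have "\<dots> \<le> 4 * exp (2 * b * T) * (real n0 * (\<Sum>n=1..N. (cmod (g1 n))\<^sup>2))"
        using hsum by (intro mult_left_mono) auto
      finally show "(osc \<sigma> g1 N t)\<^sup>2 \<le> 4 * exp (2 * b * T) * real n0 * (\<Sum>n=1..N. (cmod (g1 n))\<^sup>2)" by simp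
    qed
    also have "\<dots> = H * (\<Sum>n=1..N. (cmod (g1 n))\<^sup>2)" using T by (simp add: H_def)
    finally have head: "integral {0..T} (\<lambda>t. (osc \<sigma> g1 N t)\<^sup>2) \<le> H * (\<Sum>n=1..N. (cmod (g1 n))\<^sup>2)" .
    have "integral {0..T} (\<lambda>t. (osc \<sigma> g N t)\<^sup>2) \<le> integral {0..T} (\<lambda>t. 2 * (osc \<sigma> g1 N t)\<^sup>2 + 2 * (osc \<sigma> g2 N t)\<^sup>2)"
    proof (intro integral_le integrable_continuous_interval continuous_intros)
      fix t show "(osc \<sigma> g N t)\<^sup>2 \<le> 2 * (osc \<sigma> g1 N t)\<^sup>2 + 2 * (osc \<sigma> g2 N t)\<^sup>2"
        unfolding g12 using sum_squares_bound[of "osc \<sigma> g1 N t" "osc \<sigma> g2 N t"] by (simp add: power2_sum)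
    qed
    also have "\<dots> = 2 * integral {0..T} (\<lambda>t. (osc \<sigma> g1 N t)\<^sup>2) + 2 * integral {0..T} (\<lambda>t. (osc \<sigma> g2 N t)\<^sup>2)"
      by (subst integral_add) (auto intro!: integrable_continuous_interval continuous_intros)
    also have "\<dots> \<le> 2 * (H * (\<Sum>n=1..N. (cmod (g n))\<^sup>2)) + 2 * (2 * B * (\<Sum>n=1..N. (cmod (g n))\<^sup>2))"
      using head tail mult_left_mono[OF le(1) H] mult_left_mono[OF le(2), of "2 * B"] B by linarith
    finally show ?thesis by (simp add: algebra_simps)
  qed
  moreover have "2 * H + 4 * B > 0" using H B by simp
  ultimately show ?thesis by blast
qed

subsection \<open>The coupled system up to finitely many modes\<close>

lemma power2_sum4_le: "((x::real) + y + z + w)\<^sup>2 \<le> 4 * (x\<^sup>2 + y\<^sup>2 + z\<^sup>2 + w\<^sup>2)"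
  using sum_squares_bound[of x y] sum_squares_bound[of x z] sum_squares_bound[of x w]
    sum_squares_bound[of y z] sum_squares_bound[of y w] sum_squares_bound[of z w]
  by (simp add: power2_eq_square algebra_simps)

lemma osc_coupled_inverse:
  fixes \<sigma> \<tau> k :: "nat \<Rightarrow> complex"
  assumes gap: "\<And>\<gamma>'. \<gamma>' < \<gamma> \<Longrightarrow> eventually (\<lambda>n. \<gamma>' < Re (\<sigma> (Suc n)) - Re (\<sigma> n)) sequentially"
      "\<And>\<gamma>'. \<gamma>' < \<gamma> \<Longrightarrow> eventually (\<lambda>n. \<gamma>' < Re (\<tau> (Suc n)) - Re (\<tau> n)) sequentially"
    and im: "(\<lambda>n. Im (\<sigma> n)) \<longlonglongrightarrow> \<beta>" "(\<lambda>n. Im (\<tau> n)) \<longlonglongrightarrow> \<beta>'"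
    and \<gamma>: "\<gamma> > 0" and T: "T > 2 * pi / \<gamma>" and k: "k \<longlonglongrightarrow> 0"
  shows "\<exists>K>0. \<forall>\<epsilon>>0. \<exists>n0\<ge>1. \<forall>m\<ge>n0. \<forall>a b N f. continuous_on {0..T} f \<longrightarrow>
     (\<Sum>n=m..N. (cmod (a n))\<^sup>2) \<le>
       K * (integral {0..T} (\<lambda>t. (osc \<sigma> a N t + osc \<tau> (\<lambda>n. k n * b n) N t + f t)\<^sup>2)
          + (\<Sum>n=1..<m. (cmod (a n))\<^sup>2 + (cmod (b n))\<^sup>2) + integral {0..T} (\<lambda>t. (f t)\<^sup>2))
       + \<epsilon> * (\<Sum>n=m..N. (cmod (b n))\<^sup>2)"
proof -
  have T0: "T > 0" using T \<gamma> pi_gt_zero by (smt (verit) divide_pos_pos)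
  obtain n1 \<delta> where n1: "n1 \<ge> 1" and \<delta>: "\<delta> > 0" and low: "\<And>g N. (\<forall>n<n1. g n = 0) \<Longrightarrow>
     \<delta> * (\<Sum>n=1..N. (cmod (g n))\<^sup>2) \<le> integral {0..T} (\<lambda>t. (osc \<sigma> g N t)\<^sup>2)"
    using osc_inverse[OF gap(1) im(1) \<gamma> T] by blast
  obtain B1 where B1: "B1 > 0" "\<And>g N. integral {0..T} (\<lambda>t. (osc \<sigma> g N t)\<^sup>2) \<le> B1 * (\<Sum>n=1..N. (cmod (g n))\<^sup>2)"
    using osc_direct[OF gap(1) im(1) \<gamma> T0] by blast
  obtain B2 where B2: "B2 > 0" "\<And>g N. integral {0..T} (\<lambda>t. (osc \<tau> g N t)\<^sup>2) \<le> B2 * (\<Sum>n=1..N. (cmod (g n))\<^sup>2)"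
    using osc_direct[OF gap(2) im(2) \<gamma> T0] by blast
  obtain k0 where k0: "k0 > 0" "\<And>n. cmod (k n) \<le> k0"
    using convergent_imp_Bseq[OF convergentI[OF k]] by (auto simp: Bseq_def)
  define P where "P = 1 + B1 + B2 * k0\<^sup>2"
  have P: "P \<ge> 1" using B1(1) B2(1) by (simp add: P_def)
  define K where "K = 4 * P / \<delta>"
  have main: "\<exists>n0\<ge>1. \<forall>m\<ge>n0. \<forall>a b N f. continuous_on {0..T} f \<longrightarrow>
     (\<Sum>n=m..N. (cmod (a n))\<^sup>2) \<le>
       K * (integral {0..T} (\<lambda>t. (osc \<sigma> a N t + osc \<tau> (\<lambda>n. k n * b n) N t + f t)\<^sup>2)
          + (\<Sum>n=1..<m. (cmod (a n))\<^sup>2 + (cmod (b n))\<^sup>2) + integral {0..T} (\<lambda>t. (f t)\<^sup>2))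
       + \<epsilon> * (\<Sum>n=m..N. (cmod (b n))\<^sup>2)" if \<epsilon>: "\<epsilon> > 0" for \<epsilon>
  proof -
    \<comment> \<open>Chosen so that the factor \<open>4 * B2 * \<kappa> / \<delta>\<close> in front
      of the tail of \<open>b\<close> becomes \<open>\<epsilon>\<close>.\<close>
    define \<kappa> where "\<kappa> = \<epsilon> * \<delta> / (4 * B2)"
    have \<kappa>: "\<kappa> > 0" using \<epsilon> \<delta> B2 by (simp add: \<kappa>_def)
    obtain n2 where n2: "\<And>n. n \<ge> n2 \<Longrightarrow> cmod (k n) < sqrt \<kappa>"
      using LIMSEQ_D[OF k, of "sqrt \<kappa>"] \<kappa> by auto
    have km: "(cmod (k n))\<^sup>2 \<le> \<kappa>" if "n \<ge> n2" for n
      using power_mono[OF less_imp_le[OF n2[OF that]], of 2] \<kappa> by simp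
    show ?thesis
    proof (rule exI[of _ "max n1 n2"], intro conjI allI impI)
      show "1 \<le> max n1 n2" using n1 by simp
      fix m N and a b :: "nat \<Rightarrow> complex" and f assume m: "m \<ge> max n1 n2" and f: "continuous_on {0..T} (f :: real \<Rightarrow> real)"
      define a1 where "a1 = (\<lambda>n. if n < m then a n else 0)"
      define a2 where "a2 = (\<lambda>n. if n < m then 0 else a n)"
      define kb where "kb = (\<lambda>n. k n * b n)"
      let ?v = "\<lambda>t. osc \<sigma> a N t + osc \<tau> kb N t + f t"
      have osca: "osc \<sigma> a N t = osc \<sigma> a1 N t + osc \<sigma> a2 N t" for t
        unfolding osc_add[symmetric] by (rule arg_cong[of _ _ "\<lambda>g. osc \<sigma> g N t"]) (auto simp: a1_def a2_def)
      have sum_a2: "(\<Sum>n=1..N. (cmod (a2 n))\<^sup>2) = (\<Sum>n=m..N. (cmod (a n))\<^sup>2)"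
        using m n1 by (intro sum.mono_neutral_cong_right) (auto simp: a2_def)
      have sum_a1: "(\<Sum>n=1..N. (cmod (a1 n))\<^sup>2) \<le> (\<Sum>n=1..<m. (cmod (a n))\<^sup>2)"
      proof -
        have "(\<Sum>n=1..N. (cmod (a1 n))\<^sup>2) = (\<Sum>n\<in>{1..N} \<inter> {1..<m}. (cmod (a n))\<^sup>2)"
          by (intro sum.mono_neutral_cong_right) (auto simp: a1_def)
        also have "\<dots> \<le> (\<Sum>n=1..<m. (cmod (a n))\<^sup>2)" by (intro sum_mono2) auto
        finally show ?thesis .
      qed
      have sum_kb: "(\<Sum>n=1..N. (cmod (kb n))\<^sup>2) \<le> k0\<^sup>2 * (\<Sum>n=1..<m. (cmod (b n))\<^sup>2) + \<kappa> * (\<Sum>n=m..N. (cmod (b n))\<^sup>2)"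
      proof -
        have "(\<Sum>n=1..N. (cmod (kb n))\<^sup>2) \<le> (\<Sum>n\<in>{1..<m} \<union> {m..N}. (cmod (kb n))\<^sup>2)"
          by (intro sum_mono2) auto
        also have "\<dots> = (\<Sum>n=1..<m. (cmod (kb n))\<^sup>2) + (\<Sum>n=m..N. (cmod (kb n))\<^sup>2)"
          by (intro sum.union_disjoint) auto
        also have "\<dots> \<le> (\<Sum>n=1..<m. k0\<^sup>2 * (cmod (b n))\<^sup>2) + (\<Sum>n=m..N. \<kappa> * (cmod (b n))\<^sup>2)"
          unfolding kb_def norm_mult power_mult_distrib
          using km k0 m by (intro add_mono sum_mono mult_right_mono power_mono) auto
        finally show ?thesis by (simp add: sum_distrib_left)
      qed
      have "\<delta> * (\<Sum>n=m..N. (cmod (a n))\<^sup>2) \<le> integral {0..T} (\<lambda>t. (osc \<sigma> a2 N t)\<^sup>2)"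
        using low[of a2 N] m unfolding sum_a2 by (simp add: a2_def)
      also have "\<dots> \<le> integral {0..T} (\<lambda>t. 4 * ((?v t)\<^sup>2 + (osc \<sigma> a1 N t)\<^sup>2 + (osc \<tau> kb N t)\<^sup>2 + (f t)\<^sup>2))"
      proof (intro integral_le integrable_continuous_interval continuous_intros f)
        fix t
        have "osc \<sigma> a2 N t = ?v t + (- osc \<sigma> a1 N t) + (- osc \<tau> kb N t) + (- f t)" by (simp add: osca)
        then show "(osc \<sigma> a2 N t)\<^sup>2 \<le> 4 * ((?v t)\<^sup>2 + (osc \<sigma> a1 N t)\<^sup>2 + (osc \<tau> kb N t)\<^sup>2 + (f t)\<^sup>2)"
          using power2_sum4_le[of "?v t" "- osc \<sigma> a1 N t" "- osc \<tau> kb N t" "- f t"] by simp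
      qed
      also have "\<dots> = 4 * (integral {0..T} (\<lambda>t. (?v t)\<^sup>2) + integral {0..T} (\<lambda>t. (osc \<sigma> a1 N t)\<^sup>2)
          + integral {0..T} (\<lambda>t. (osc \<tau> kb N t)\<^sup>2) + integral {0..T} (\<lambda>t. (f t)\<^sup>2))"
        by (intro integral_unique has_integral_mult_right has_integral_add integrable_integral
            integrable_continuous_interval continuous_intros f)
      also have "\<dots> \<le> 4 * (integral {0..T} (\<lambda>t. (?v t)\<^sup>2) + B1 * (\<Sum>n=1..<m. (cmod (a n))\<^sup>2)
          + B2 * (k0\<^sup>2 * (\<Sum>n=1..<m. (cmod (b n))\<^sup>2) + \<kappa> * (\<Sum>n=m..N. (cmod (b n))\<^sup>2)) + integral {0..T} (\<lambda>t. (f t)\<^sup>2))"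
        by (intro mult_left_mono add_mono order_refl order_trans[OF B1(2) mult_left_mono[OF sum_a1 less_imp_le[OF B1(1)]]]
            order_trans[OF B2(2) mult_left_mono[OF sum_kb less_imp_le[OF B2(1)]]]) simp
      also have "\<dots> \<le> 4 * (P * (integral {0..T} (\<lambda>t. (?v t)\<^sup>2) + (\<Sum>n=1..<m. (cmod (a n))\<^sup>2 + (cmod (b n))\<^sup>2)
          + integral {0..T} (\<lambda>t. (f t)\<^sup>2))) + \<epsilon> * \<delta> * (\<Sum>n=m..N. (cmod (b n))\<^sup>2)"
      proof -
        have c: "4 * (B2 * (\<kappa> * x)) = \<epsilon> * \<delta> * x" for x using B2 by (simp add: \<kappa>_def)
        have i: "integral {0..T} (\<lambda>t. (?v t)\<^sup>2) \<ge> 0" "integral {0..T} (\<lambda>t. (f t)\<^sup>2) \<ge> 0"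
          by (rule integral_nonneg; auto intro!: integrable_continuous_interval continuous_intros f)+
        have s: "(\<Sum>n=1..<m. (cmod (a n))\<^sup>2) \<ge> 0" "(\<Sum>n=1..<m. (cmod (b n))\<^sup>2) \<ge> 0"
          by (auto intro: sum_nonneg)
        have p: "1 \<le> P" "B1 \<le> P" "B2 * k0\<^sup>2 \<le> P" using P B1(1) B2(1) by (auto simp: P_def)
        show ?thesis
          using mult_right_mono[OF p(1) i(1)] mult_right_mono[OF p(1) i(2)] mult_right_mono[OF p(2) s(1)]
            mult_right_mono[OF p(3) s(2)]
          unfolding c[symmetric] sum.distrib by (simp add: algebra_simps)
      qed
      finally have "(\<Sum>n=m..N. (cmod (a n))\<^sup>2) \<le> (4 * (P * (integral {0..T} (\<lambda>t. (?v t)\<^sup>2) + (\<Sum>n=1..<m. (cmod (a n))\<^sup>2 + (cmod (b n))\<^sup>2)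
          + integral {0..T} (\<lambda>t. (f t)\<^sup>2))) + \<epsilon> * \<delta> * (\<Sum>n=m..N. (cmod (b n))\<^sup>2)) / \<delta>"
        using \<delta> by (simp add: pos_le_divide_eq mult.commute)
      also have "\<dots> = K * (integral {0..T} (\<lambda>t. (?v t)\<^sup>2) + (\<Sum>n=1..<m. (cmod (a n))\<^sup>2 + (cmod (b n))\<^sup>2)
          + integral {0..T} (\<lambda>t. (f t)\<^sup>2)) + \<epsilon> * (\<Sum>n=m..N. (cmod (b n))\<^sup>2)"
        using \<delta> by (simp add: K_def add_divide_distrib)
      finally show "(\<Sum>n=m..N. (cmod (a n))\<^sup>2) \<le>
       K * (integral {0..T} (\<lambda>t. (osc \<sigma> a N t + osc \<tau> (\<lambda>n. k n * b n) N t + f t)\<^sup>2)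
          + (\<Sum>n=1..<m. (cmod (a n))\<^sup>2 + (cmod (b n))\<^sup>2) + integral {0..T} (\<lambda>t. (f t)\<^sup>2))
       + \<epsilon> * (\<Sum>n=m..N. (cmod (b n))\<^sup>2)" by (simp add: kb_def)
    qed
  qed
  have "K > 0" using P \<delta> by (simp add: K_def)
  with main show ?thesis by blast
qed

text \<open>The system in symmetric form. In the application \<open>e n = 1 / d n\<close> and
  \<open>\<beta> = 0\<close>, and the coefficients called \<open>a n\<close> and \<open>b n\<close>
  below are \<open>C n\<close> and \<open>d n * D n\<close>. The number \<open>\<rho>\<close> bounds
  all real exponents.\<close>

locale coupled_oscillators =
  fixes \<omega> \<zeta> c e :: "nat \<Rightarrow> complex" and r :: "nat \<Rightarrow> real" and \<gamma> \<alpha> \<beta> \<eta> \<rho> :: real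
  assumes gap_\<omega>: "\<And>\<gamma>'. \<gamma>' < \<gamma> \<Longrightarrow> eventually (\<lambda>n. \<gamma>' < Re (\<omega> (Suc n)) - Re (\<omega> n)) sequentially"
    and gap_\<zeta>: "\<And>\<gamma>'. \<gamma>' < \<gamma> \<Longrightarrow> eventually (\<lambda>n. \<gamma>' < Re (\<zeta> (Suc n)) - Re (\<zeta> n)) sequentially"
    and im_\<omega>: "(\<lambda>n. Im (\<omega> n)) \<longlonglongrightarrow> \<alpha>" and im_\<zeta>: "(\<lambda>n. Im (\<zeta> n)) \<longlonglongrightarrow> \<beta>"
    and \<gamma>_pos: "\<gamma> > 0" and c_lim: "c \<longlonglongrightarrow> 0" and e_lim: "e \<longlonglongrightarrow> 0"
    and r_le: "\<bar>r n\<bar> \<le> \<rho>" and \<eta>_le: "\<bar>\<eta>\<bar> \<le> \<rho>"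
begin

definition v1 :: "(nat \<Rightarrow> complex) \<Rightarrow> (nat \<Rightarrow> complex) \<Rightarrow> (nat \<Rightarrow> real) \<Rightarrow> nat \<Rightarrow> real \<Rightarrow> real" where
  "v1 a b R N t = osc \<omega> a N t + osc \<zeta> (\<lambda>n. e n * b n) N t + (\<Sum>n=1..N. R n * exp (r n * t))"

definition v2 :: "(nat \<Rightarrow> complex) \<Rightarrow> (nat \<Rightarrow> complex) \<Rightarrow> real \<Rightarrow> nat \<Rightarrow> real \<Rightarrow> real" where
  "v2 a b E N t = osc \<zeta> b N t + osc \<omega> (\<lambda>n. c n * a n) N t + E * exp (- \<eta> * t)"

definition nrg :: "(nat \<Rightarrow> complex) \<Rightarrow> (nat \<Rightarrow> complex) \<Rightarrow> nat \<Rightarrow> real" where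
  "nrg a b N = (\<Sum>n=1..N. (cmod (a n))\<^sup>2 + (cmod (b n))\<^sup>2)"

definition observed :: "real \<Rightarrow> (nat \<Rightarrow> complex) \<Rightarrow> (nat \<Rightarrow> complex) \<Rightarrow> (nat \<Rightarrow> real) \<Rightarrow> real \<Rightarrow> nat \<Rightarrow> real" where
  "observed T a b R E N = integral {0..T} (\<lambda>t. (v1 a b R N t)\<^sup>2 + (v2 a b E N t)\<^sup>2)"

lemma continuous_on_v [continuous_intros]: "continuous_on S (v1 a b R N)" "continuous_on S (v2 a b E N)"
  unfolding v1_def v2_def by (intro continuous_intros)+

lemma \<rho>_nonneg: "\<rho> \<ge> 0" using \<eta>_le by linarith

lemma nrg_nonneg: "nrg a b N \<ge> 0"
  unfolding nrg_def by (intro sum_nonneg) auto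

lemma nrg_mono: "N \<le> M \<Longrightarrow> nrg a b N \<le> nrg a b M"
  unfolding nrg_def by (intro sum_mono2) auto

lemma observed_split:
  "observed T a b R E N = integral {0..T} (\<lambda>t. (v1 a b R N t)\<^sup>2) + integral {0..T} (\<lambda>t. (v2 a b E N t)\<^sup>2)"
  unfolding observed_def by (intro integral_add integrable_continuous_interval continuous_intros)

lemma integral_v_nonneg:
  "integral {0..T} (\<lambda>t. (v1 a b R N t)\<^sup>2) \<ge> 0" "integral {0..T} (\<lambda>t. (v2 a b E N t)\<^sup>2) \<ge> 0"
  by (rule integral_nonneg; auto intro!: integrable_continuous_interval continuous_intros)+

lemma observed_nonneg: "observed T a b R E N \<ge> 0"
  using integral_v_nonneg by (auto simp: observed_split intro: add_nonneg_nonneg)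

lemma integral_const_exp_le:
  assumes "T > 0"
  shows "integral {0..T} (\<lambda>t. (\<Sum>n=1..N. R n * exp (r n * t))\<^sup>2) \<le> T * exp (2 * \<rho> * T) * (\<Sum>n=1..N. \<bar>R n\<bar>)\<^sup>2"
    and "integral {0..T} (\<lambda>t. (E * exp (- \<eta> * t))\<^sup>2) \<le> T * exp (2 * \<rho> * T) * E\<^sup>2"
proof -
  have ex: "exp (x * t) \<le> exp (\<rho> * T)" if "t \<in> {0..T}" "\<bar>x\<bar> \<le> \<rho>" for x t :: real
  proof -
    have "x * t \<le> \<rho> * T" using that \<rho>_nonneg by (intro mult_mono) auto
    then show ?thesis by simp
  qed
  have "integral {0..T} (\<lambda>t. (\<Sum>n=1..N. R n * exp (r n * t))\<^sup>2) \<le> integral {0..T} (\<lambda>t. exp (2 * \<rho> * T) * (\<Sum>n=1..N. \<bar>R n\<bar>)\<^sup>2)"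
  proof (intro integral_le integrable_continuous_interval continuous_intros)
    fix t assume t: "t \<in> {0..T}"
    have "\<bar>\<Sum>n=1..N. R n * exp (r n * t)\<bar> \<le> (\<Sum>n=1..N. \<bar>R n\<bar> * exp (\<rho> * T))"
      using ex[OF t r_le] by (intro order_trans[OF sum_abs] sum_mono) (auto simp: abs_mult intro!: mult_left_mono)
    then have "\<bar>\<Sum>n=1..N. R n * exp (r n * t)\<bar>\<^sup>2 \<le> ((\<Sum>n=1..N. \<bar>R n\<bar>) * exp (\<rho> * T))\<^sup>2"
      by (intro power_mono) (auto simp: sum_distrib_right)
    then show "(\<Sum>n=1..N. R n * exp (r n * t))\<^sup>2 \<le> exp (2 * \<rho> * T) * (\<Sum>n=1..N. \<bar>R n\<bar>)\<^sup>2"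
      by (simp add: power_mult_distrib mult_ac flip: exp_double)
  qed
  then show "integral {0..T} (\<lambda>t. (\<Sum>n=1..N. R n * exp (r n * t))\<^sup>2) \<le> T * exp (2 * \<rho> * T) * (\<Sum>n=1..N. \<bar>R n\<bar>)\<^sup>2"
    using assms by (simp add: mult_ac)
  have "integral {0..T} (\<lambda>t. (E * exp (- \<eta> * t))\<^sup>2) \<le> integral {0..T} (\<lambda>t. exp (2 * \<rho> * T) * E\<^sup>2)"
  proof (intro integral_le integrable_continuous_interval continuous_intros)
    fix t assume t: "t \<in> {0..T}"
    have "(exp (- \<eta> * t))\<^sup>2 \<le> (exp (\<rho> * T))\<^sup>2"
      using ex[OF t, of "- \<eta>"] \<eta>_le by (intro power_mono) auto
    then have "E\<^sup>2 * (exp (- \<eta> * t))\<^sup>2 \<le> E\<^sup>2 * (exp (\<rho> * T))\<^sup>2" by (intro mult_left_mono) auto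
    then show "(E * exp (- \<eta> * t))\<^sup>2 \<le> exp (2 * \<rho> * T) * E\<^sup>2"
      by (simp add: power_mult_distrib mult_ac flip: exp_double)
  qed
  then show "integral {0..T} (\<lambda>t. (E * exp (- \<eta> * t))\<^sup>2) \<le> T * exp (2 * \<rho> * T) * E\<^sup>2"
    using assms by (simp add: mult_ac)
qed

text \<open>The oscillating parts are bounded by their energies through \<open>osc_direct\<close>.
  For the real exponents, bounded but possibly accumulating, the triangle inequality is used
  instead, whence the square of the absolute sum of \<open>R\<close>.\<close>

lemma observed_le:
  assumes T: "T > 0"
  shows "\<exists>B>0. \<forall>a b R E N. observed T a b R E N \<le> B * (nrg a b N + (\<Sum>n=1..N. \<bar>R n\<bar>)\<^sup>2 + E\<^sup>2)"
proof -
  obtain B1 where B1: "B1 > 0" "\<And>g N. integral {0..T} (\<lambda>t. (osc \<omega> g N t)\<^sup>2) \<le> B1 * (\<Sum>n=1..N. (cmod (g n))\<^sup>2)"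
    using osc_direct[OF gap_\<omega> im_\<omega> \<gamma>_pos T] by blast
  obtain B2 where B2: "B2 > 0" "\<And>g N. integral {0..T} (\<lambda>t. (osc \<zeta> g N t)\<^sup>2) \<le> B2 * (\<Sum>n=1..N. (cmod (g n))\<^sup>2)"
    using osc_direct[OF gap_\<zeta> im_\<zeta> \<gamma>_pos T] by blast
  obtain e0 where e0: "e0 > 0" "\<And>n. cmod (e n) \<le> e0"
    using convergent_imp_Bseq[OF convergentI[OF e_lim]] by (auto simp: Bseq_def)
  obtain c0 where c0: "c0 > 0" "\<And>n. cmod (c n) \<le> c0"
    using convergent_imp_Bseq[OF convergentI[OF c_lim]] by (auto simp: Bseq_def)
  define P where "P = B1 * (1 + c0\<^sup>2) + B2 * (1 + e0\<^sup>2) + T * exp (2 * \<rho> * T)"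
  have "0 < B1 * (1 + c0\<^sup>2)" "0 < B2 * (1 + e0\<^sup>2)" "0 < T * exp (2 * \<rho> * T)"
    using B1(1) B2(1) T by (auto intro!: mult_pos_pos add_pos_nonneg)
  then have P: "B1 * (1 + c0\<^sup>2) \<le> P" "B2 * (1 + e0\<^sup>2) \<le> P" "T * exp (2 * \<rho> * T) \<le> P" "P > 0"
    by (auto simp: P_def)
  have "observed T a b R E N \<le> 4 * P * (nrg a b N + (\<Sum>n=1..N. \<bar>R n\<bar>)\<^sup>2 + E\<^sup>2)" for a b R E N
  proof -
    define SA where "SA = (\<Sum>n=1..N. (cmod (a n))\<^sup>2)"
    define SB where "SB = (\<Sum>n=1..N. (cmod (b n))\<^sup>2)"
    have S0: "SA \<ge> 0" "SB \<ge> 0" by (auto simp: SA_def SB_def intro: sum_nonneg)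
    have "(\<Sum>n=1..N. (cmod (c n * a n))\<^sup>2) \<le> (\<Sum>n=1..N. c0\<^sup>2 * (cmod (a n))\<^sup>2)"
      unfolding norm_mult power_mult_distrib using c0 by (intro sum_mono mult_right_mono power_mono) auto
    then have sc: "(\<Sum>n=1..N. (cmod (c n * a n))\<^sup>2) \<le> c0\<^sup>2 * SA" by (simp add: SA_def sum_distrib_left)
    have "(\<Sum>n=1..N. (cmod (e n * b n))\<^sup>2) \<le> (\<Sum>n=1..N. e0\<^sup>2 * (cmod (b n))\<^sup>2)"
      unfolding norm_mult power_mult_distrib using e0 by (intro sum_mono mult_right_mono power_mono) auto
    then have se: "(\<Sum>n=1..N. (cmod (e n * b n))\<^sup>2) \<le> e0\<^sup>2 * SB" by (simp add: SB_def sum_distrib_left)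
    have three: "(x + y + z)\<^sup>2 \<le> 4 * (x\<^sup>2 + y\<^sup>2 + z\<^sup>2)" for x y z :: real
      using power2_sum4_le[of x y z 0] by simp
    have "integral {0..T} (\<lambda>t. (v1 a b R N t)\<^sup>2) \<le> integral {0..T} (\<lambda>t. 4 * ((osc \<omega> a N t)\<^sup>2 + (osc \<zeta> (\<lambda>n. e n * b n) N t)\<^sup>2 + (\<Sum>n=1..N. R n * exp (r n * t))\<^sup>2))"
      unfolding v1_def by (intro integral_le integrable_continuous_interval continuous_intros three)
    also have "\<dots> = 4 * (integral {0..T} (\<lambda>t. (osc \<omega> a N t)\<^sup>2) + integral {0..T} (\<lambda>t. (osc \<zeta> (\<lambda>n. e n * b n) N t)\<^sup>2)
         + integral {0..T} (\<lambda>t. (\<Sum>n=1..N. R n * exp (r n * t))\<^sup>2))"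
      by (intro integral_unique has_integral_mult_right has_integral_add integrable_integral
          integrable_continuous_interval continuous_intros)
    also have "\<dots> \<le> 4 * (B1 * SA + B2 * (e0\<^sup>2 * SB) + T * exp (2 * \<rho> * T) * (\<Sum>n=1..N. \<bar>R n\<bar>)\<^sup>2)"
      using B1(2)[of a N] integral_const_exp_le(1)[OF T, of R N] unfolding SA_def
      by (intro mult_left_mono add_mono order_trans[OF B2(2) mult_left_mono[OF se less_imp_le[OF B2(1)]]]) auto
    finally have 1: "integral {0..T} (\<lambda>t. (v1 a b R N t)\<^sup>2) \<le> 4 * (B1 * SA + B2 * (e0\<^sup>2 * SB) + T * exp (2 * \<rho> * T) * (\<Sum>n=1..N. \<bar>R n\<bar>)\<^sup>2)" .
    have "integral {0..T} (\<lambda>t. (v2 a b E N t)\<^sup>2) \<le> integral {0..T} (\<lambda>t. 4 * ((osc \<zeta> b N t)\<^sup>2 + (osc \<omega> (\<lambda>n. c n * a n) N t)\<^sup>2 + (E * exp (- \<eta> * t))\<^sup>2))"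
      unfolding v2_def by (intro integral_le integrable_continuous_interval continuous_intros three)
    also have "\<dots> = 4 * (integral {0..T} (\<lambda>t. (osc \<zeta> b N t)\<^sup>2) + integral {0..T} (\<lambda>t. (osc \<omega> (\<lambda>n. c n * a n) N t)\<^sup>2)
         + integral {0..T} (\<lambda>t. (E * exp (- \<eta> * t))\<^sup>2))"
      by (intro integral_unique has_integral_mult_right has_integral_add integrable_integral
          integrable_continuous_interval continuous_intros)
    also have "\<dots> \<le> 4 * (B2 * SB + B1 * (c0\<^sup>2 * SA) + T * exp (2 * \<rho> * T) * E\<^sup>2)"
      using B2(2)[of b N] integral_const_exp_le(2)[OF T, of E] unfolding SB_def
      by (intro mult_left_mono add_mono order_trans[OF B1(2) mult_left_mono[OF sc less_imp_le[OF B1(1)]]]) auto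
    finally have 2: "integral {0..T} (\<lambda>t. (v2 a b E N t)\<^sup>2) \<le> 4 * (B2 * SB + B1 * (c0\<^sup>2 * SA) + T * exp (2 * \<rho> * T) * E\<^sup>2)" .
    have "observed T a b R E N \<le> 4 * ((B1 * (1 + c0\<^sup>2)) * SA + (B2 * (1 + e0\<^sup>2)) * SB
        + T * exp (2 * \<rho> * T) * (\<Sum>n=1..N. \<bar>R n\<bar>)\<^sup>2 + T * exp (2 * \<rho> * T) * E\<^sup>2)"
      unfolding observed_split using 1 2 by (simp add: algebra_simps)
    also have "\<dots> \<le> 4 * (P * SA + P * SB + P * (\<Sum>n=1..N. \<bar>R n\<bar>)\<^sup>2 + P * E\<^sup>2)"
      using P S0 by (intro mult_left_mono add_mono mult_right_mono) auto
    also have "\<dots> = 4 * P * (nrg a b N + (\<Sum>n=1..N. \<bar>R n\<bar>)\<^sup>2 + E\<^sup>2)"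
      by (simp add: nrg_def SA_def SB_def sum.distrib algebra_simps)
    finally show ?thesis .
  qed
  moreover have "4 * P > 0" using P by simp
  ultimately show ?thesis by blast
qed

text \<open>With \<open>\<epsilon> = 1/2\<close> in both components each tail is at most known terms
  plus half of the other tail, so the two inequalities can be added and the tails absorbed. The last
  three terms on the right are what the compactness argument later removes.\<close>

lemma nrg_le_observed_mod_finite:
  assumes T: "T > 2 * pi / \<gamma>"
  shows "\<exists>K>0. \<exists>n0. \<forall>a b R E N. nrg a b N \<le> K * (observed T a b R E N + nrg a b n0 + (\<Sum>n=1..N. \<bar>R n\<bar>)\<^sup>2 + E\<^sup>2)"
proof -
  have T0: "T > 0" using T \<gamma>_pos pi_gt_zero by (smt (verit) divide_pos_pos)
  obtain K1 n1 where K1: "K1 > 0" "n1 \<ge> 1" and inv1: "\<And>m a b N f. m \<ge> n1 \<Longrightarrow> continuous_on {0..T} f \<Longrightarrow>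
     (\<Sum>n=m..N. (cmod (a n))\<^sup>2) \<le>
       K1 * (integral {0..T} (\<lambda>t. (osc \<omega> a N t + osc \<zeta> (\<lambda>n. e n * b n) N t + f t)\<^sup>2)
          + (\<Sum>n=1..<m. (cmod (a n))\<^sup>2 + (cmod (b n))\<^sup>2) + integral {0..T} (\<lambda>t. (f t)\<^sup>2))
       + 1/2 * (\<Sum>n=m..N. (cmod (b n))\<^sup>2)"
    using osc_coupled_inverse[OF gap_\<omega> gap_\<zeta> im_\<omega> im_\<zeta> \<gamma>_pos T e_lim] zero_less_divide_1_iff[of "2::real"] zero_less_numeral by meson
  obtain K2 n2 where K2: "K2 > 0" "n2 \<ge> 1" and inv2: "\<And>m a b N f. m \<ge> n2 \<Longrightarrow> continuous_on {0..T} f \<Longrightarrow>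
     (\<Sum>n=m..N. (cmod (a n))\<^sup>2) \<le>
       K2 * (integral {0..T} (\<lambda>t. (osc \<zeta> a N t + osc \<omega> (\<lambda>n. c n * b n) N t + f t)\<^sup>2)
          + (\<Sum>n=1..<m. (cmod (a n))\<^sup>2 + (cmod (b n))\<^sup>2) + integral {0..T} (\<lambda>t. (f t)\<^sup>2))
       + 1/2 * (\<Sum>n=m..N. (cmod (b n))\<^sup>2)"
    using osc_coupled_inverse[OF gap_\<zeta> gap_\<omega> im_\<zeta> im_\<omega> \<gamma>_pos T c_lim] zero_less_divide_1_iff[of "2::real"] zero_less_numeral by meson
  define m where "m = max n1 n2"
  define L where "L = max 1 (T * exp (2 * \<rho> * T))"
  have L: "L \<ge> 1" "T * exp (2 * \<rho> * T) \<le> L" by (auto simp: L_def)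
  define K where "K = 1 + 4 * (K1 + K2) * L"
  have "nrg a b N \<le> K * (observed T a b R E N + nrg a b m + (\<Sum>n=1..N. \<bar>R n\<bar>)\<^sup>2 + E\<^sup>2)" for a b R E N
  proof -
    define h where "h = (\<Sum>n=1..<m. (cmod (a n))\<^sup>2 + (cmod (b n))\<^sup>2)"
    define SA where "SA = (\<Sum>n=m..N. (cmod (a n))\<^sup>2)"
    define SB where "SB = (\<Sum>n=m..N. (cmod (b n))\<^sup>2)"
    define RE where "RE = (\<Sum>n=1..N. \<bar>R n\<bar>)\<^sup>2 + E\<^sup>2"
    define O1 where "O1 = integral {0..T} (\<lambda>t. (v1 a b R N t)\<^sup>2)"
    define O2 where "O2 = integral {0..T} (\<lambda>t. (v2 a b E N t)\<^sup>2)"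
    have O: "O1 \<ge> 0" "O2 \<ge> 0" using integral_v_nonneg by (auto simp: O1_def O2_def)
    have h: "h \<ge> 0" "h \<le> nrg a b m"
      unfolding h_def nrg_def by (intro sum_nonneg sum_mono2; auto)+
    have h': "h = (\<Sum>n=1..<m. (cmod (b n))\<^sup>2 + (cmod (a n))\<^sup>2)" by (simp add: h_def add.commute)
    have RE: "RE \<ge> 0" by (simp add: RE_def)
    have LR: "T * exp (2 * \<rho> * T) * x\<^sup>2 \<le> L * x\<^sup>2" for x using L by (intro mult_right_mono) auto
    have fr: "integral {0..T} (\<lambda>t. (\<Sum>n=1..N. R n * exp (r n * t))\<^sup>2) \<le> L * (\<Sum>n=1..N. \<bar>R n\<bar>)\<^sup>2"
      using integral_const_exp_le(1)[OF T0, of R N] LR by (rule order_trans)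
    have fe: "integral {0..T} (\<lambda>t. (E * exp (- \<eta> * t))\<^sup>2) \<le> L * E\<^sup>2"
      using integral_const_exp_le(2)[OF T0, of E] LR by (rule order_trans)
    have lre: "L * (\<Sum>n=1..N. \<bar>R n\<bar>)\<^sup>2 \<le> L * RE" "L * E\<^sup>2 \<le> L * RE"
      using L by (auto simp: RE_def intro!: mult_left_mono)
    define X1 where "X1 = K1 * (O1 + h + L * RE)"
    define X2 where "X2 = K2 * (O2 + h + L * RE)"
    have "SA \<le> K1 * (O1 + h + integral {0..T} (\<lambda>t. (\<Sum>n=1..N. R n * exp (r n * t))\<^sup>2)) + 1/2 * SB"
      unfolding SA_def SB_def O1_def h_def v1_def
      by (rule inv1) (auto simp: m_def intro!: continuous_intros)
    also have "\<dots> \<le> X1 + 1/2 * SB"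
      unfolding X1_def using fr lre K1 by (intro add_right_mono mult_left_mono add_left_mono) auto
    finally have A1: "SA \<le> X1 + 1/2 * SB" .
    have "SB \<le> K2 * (O2 + h + integral {0..T} (\<lambda>t. (E * exp (- \<eta> * t))\<^sup>2)) + 1/2 * SA"
      unfolding SA_def SB_def O2_def h' v2_def
      by (rule inv2) (auto simp: m_def intro!: continuous_intros)
    also have "\<dots> \<le> X2 + 1/2 * SA"
      unfolding X2_def using fe lre K2 by (intro add_right_mono mult_left_mono add_left_mono) auto
    finally have A2: "SB \<le> X2 + 1/2 * SA" .
    have s: "SA + SB \<le> 2 * (X1 + X2)"
      using A1 A2 by (simp add: field_simps)
    define Z where "Z = observed T a b R E N + nrg a b m + RE"
    have Z: "O1 + h + L * RE \<le> L * (2 * Z)" "O2 + h + L * RE \<le> L * (2 * Z)" "h \<le> Z"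
    proof -
      have z: "O1 + O2 + h + RE \<le> Z" using h by (simp add: Z_def observed_split O1_def O2_def)
      then show "h \<le> Z" using O RE by linarith
      have "L * (O1 + O2 + h + RE) \<le> L * Z" using z L by (intro mult_left_mono) auto
      moreover have "1 * O1 \<le> L * O1" "1 * O2 \<le> L * O2" "1 * h \<le> L * h" "0 \<le> L * RE"
        using mult_right_mono[OF L(1) O(1)] mult_right_mono[OF L(1) O(2)] mult_right_mono[OF L(1) h(1)] L RE by auto
      moreover have "L * (O1 + O2 + h + RE) = L * O1 + L * O2 + L * h + L * RE" "L * (2 * Z) = 2 * (L * Z)"
        by (simp_all add: ring_distribs)
      ultimately show "O1 + h + L * RE \<le> L * (2 * Z)" "O2 + h + L * RE \<le> L * (2 * Z)"
        using O h by argo+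
    qed
    have "nrg a b N \<le> h + (SA + SB)"
    proof -
      have "nrg a b N \<le> (\<Sum>n\<in>{1..<m} \<union> {m..N}. (cmod (a n))\<^sup>2 + (cmod (b n))\<^sup>2)"
        unfolding nrg_def by (intro sum_mono2) auto
      also have "\<dots> = h + (\<Sum>n=m..N. (cmod (a n))\<^sup>2 + (cmod (b n))\<^sup>2)"
        unfolding h_def by (intro sum.union_disjoint) auto
      finally show ?thesis by (simp add: SA_def SB_def sum.distrib)
    qed
    also have "\<dots> \<le> Z + 2 * (K1 * (L * (2 * Z)) + K2 * (L * (2 * Z)))"
    proof -
      have "X1 \<le> K1 * (L * (2 * Z))" "X2 \<le> K2 * (L * (2 * Z))"
        using Z K1 K2 by (auto simp: X1_def X2_def intro!: mult_left_mono)
      then have "2 * (X1 + X2) \<le> 2 * (K1 * (L * (2 * Z)) + K2 * (L * (2 * Z)))" by simp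
      with s have "SA + SB \<le> 2 * (K1 * (L * (2 * Z)) + K2 * (L * (2 * Z)))" by (rule order_trans)
      with Z(3) show ?thesis by (rule add_mono)
    qed
    also have "\<dots> = K * Z" by (simp add: K_def algebra_simps)
    finally show ?thesis by (simp add: Z_def RE_def add.assoc)
  qed
  moreover have "K > 0" using K1 K2 L by (auto simp: K_def intro!: add_pos_nonneg)
  ultimately show ?thesis by blast
qed

end

subsection \<open>Exponential sums and difference quotients\<close>

text \<open>The derivative of the vanishing sum minus \<open>\<mu> j\<close> times the sum is again
  zero and has lost the mode \<open>j\<close>, while every other coefficient is multiplied by the
  nonzero number \<open>\<mu> i - \<mu> j\<close>. This drives the induction on the index
  set.\<close>

lemma exponentials_independent:
  fixes \<mu> p :: "'i \<Rightarrow> complex"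
  assumes "finite I" "inj_on \<mu> I" "T > 0"
    and "\<And>t. t \<in> {0<..<T} \<Longrightarrow> (\<Sum>i\<in>I. p i * exp (\<mu> i * of_real t)) = 0"
  shows "\<forall>i\<in>I. p i = 0"
  using assms
proof (induction I arbitrary: p rule: finite_induct)
  case (insert j I)
  have z: "p j * exp (\<mu> j * of_real t) + (\<Sum>i\<in>I. p i * exp (\<mu> i * of_real t)) = 0" if "t \<in> {0<..<T}" for t
    using insert.prems(3)[OF that] insert.hyps by simp
  have "(\<Sum>i\<in>I. (p i * (\<mu> i - \<mu> j)) * exp (\<mu> i * of_real t)) = 0" if t: "t \<in> {0<..<T}" for t
  proof -
    let ?F = "\<lambda>w. \<Sum>i\<in>insert j I. p i * exp (\<mu> i * w)"
    let ?D = "\<Sum>i\<in>insert j I. p i * \<mu> i * exp (\<mu> i * of_real t)"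
    have "(?F has_field_derivative ?D) (at (of_real t))"
      by (rule DERIV_sum) (auto intro!: derivative_eq_intros)
    then have "((\<lambda>s. ?F (of_real s)) has_vector_derivative ?D) (at t)"
      by (rule has_vector_derivative_real_field)
    then have "((\<lambda>s. 0) has_vector_derivative ?D) (at t)"
      by (rule has_vector_derivative_transform_within_open[where S = "{0<..<T}"])
         (use t insert.prems(3) in auto)
    then have "?D = 0" using vector_derivative_unique_at has_vector_derivative_const by blast
    then have d: "p j * \<mu> j * exp (\<mu> j * of_real t) + (\<Sum>i\<in>I. p i * \<mu> i * exp (\<mu> i * of_real t)) = 0"
      using insert.hyps by simp
    have "(\<Sum>i\<in>I. (p i * (\<mu> i - \<mu> j)) * exp (\<mu> i * of_real t))
       = (\<Sum>i\<in>I. p i * \<mu> i * exp (\<mu> i * of_real t)) - \<mu> j * (\<Sum>i\<in>I. p i * exp (\<mu> i * of_real t))"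
      by (simp add: sum_distrib_left sum_subtractf algebra_simps)
    also have "\<dots> = (p j * \<mu> j * exp (\<mu> j * of_real t) + (\<Sum>i\<in>I. p i * \<mu> i * exp (\<mu> i * of_real t)))
        - \<mu> j * (p j * exp (\<mu> j * of_real t) + (\<Sum>i\<in>I. p i * exp (\<mu> i * of_real t)))"
      by (simp add: algebra_simps)
    finally show ?thesis using d z[OF t] by simp
  qed
  then have "\<forall>i\<in>I. p i * (\<mu> i - \<mu> j) = 0"
    using insert.IH[of "\<lambda>i. p i * (\<mu> i - \<mu> j)"] insert.prems(1,2) by (auto simp: inj_on_def)
  moreover have "\<mu> i \<noteq> \<mu> j" if "i \<in> I" for i
    using insert.prems(1) insert.hyps(2) that by (auto simp: inj_on_def)
  ultimately have I: "\<forall>i\<in>I. p i = 0" by auto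
  then have "p j = 0" using z[of "T / 2"] \<open>T > 0\<close> by simp
  with I show ?case by simp
qed simp

lemma of_real_osc:
  "complex_of_real (osc \<sigma> g N t) = (\<Sum>n=1..N. g n * exp (\<i> * \<sigma> n * of_real t))
     + (\<Sum>n=1..N. cnj (g n) * exp (- \<i> * cnj (\<sigma> n) * of_real t))"
proof -
  have "complex_of_real (2 * Re (g n * exp (\<i> * \<sigma> n * of_real t)))
     = g n * exp (\<i> * \<sigma> n * of_real t) + cnj (g n) * exp (- \<i> * cnj (\<sigma> n) * of_real t)" for n
  proof -
    have "cnj (g n) * exp (- \<i> * cnj (\<sigma> n) * of_real t) = cnj (g n * exp (\<i> * \<sigma> n * of_real t))"
      by (simp add: exp_cnj)
    then show ?thesis by (simp only: complex_add_cnj)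
  qed
  then show ?thesis by (simp only: osc_def of_real_sum sum.distrib)
qed

text \<open>The symbol of the forward difference quotient: replacing \<open>f t\<close> by
  \<open>(f (t + h) - f t) / h\<close> multiplies an exponential of rate \<open>z\<close> by this
  number, which tends to \<open>z\<close> with the step.\<close>

definition expm1_quotient :: "real \<Rightarrow> complex \<Rightarrow> complex" where
  "expm1_quotient h z = (exp (z * of_real h) - 1) / of_real h"

lemma tendsto_expm1_quotient: "((\<lambda>h. expm1_quotient h z) \<longlongrightarrow> z) (at_right 0)"
proof -
  have "((\<lambda>w. exp (z * w)) has_field_derivative z) (at 0)"
    by (auto intro!: derivative_eq_intros)
  then have "((\<lambda>w. (exp (z * w) - 1) / w) \<longlongrightarrow> z) (at 0)"
    by (simp add: has_field_derivative_iff)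
  moreover have "filterlim complex_of_real (at 0) (at_right 0)"
    unfolding filterlim_at
    by (intro conjI tendsto_eq_intros eventually_at_right_less[THEN eventually_mono]) auto
  ultimately show ?thesis
    unfolding expm1_quotient_def by (rule filterlim_compose)
qed

lemma abs_exp_minus_one_le: "\<bar>exp x - 1\<bar> \<le> \<bar>x\<bar> * exp \<bar>x\<bar>" for x :: real
proof (cases "x \<ge> 0")
  case True
  have "1 - x \<le> exp (- x)" using exp_ge_add_one_self[of "- x"] by simp
  then have "(1 - x) * exp x \<le> exp (- x) * exp x" by (intro mult_right_mono) auto
  then show ?thesis using True by (simp add: algebra_simps flip: exp_add)
next
  case False
  then have "\<bar>exp x - 1\<bar> = 1 - exp x" "\<bar>x\<bar> = - x" by auto
  then have "\<bar>exp x - 1\<bar> \<le> \<bar>x\<bar> * 1" using exp_ge_add_one_self[of x] by linarith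
  also have "\<dots> \<le> \<bar>x\<bar> * exp \<bar>x\<bar>" by (intro mult_left_mono) auto
  finally show ?thesis .
qed

lemma osc_expm1_quotient:
  assumes "h \<noteq> 0"
  shows "osc \<sigma> (\<lambda>n. g n * expm1_quotient h (\<i> * \<sigma> n)) N t = (osc \<sigma> g N (t + h) - osc \<sigma> g N t) / h"
proof -
  have "g n * expm1_quotient h (\<i> * \<sigma> n) * exp (\<i> * \<sigma> n * of_real t)
     = (g n * exp (\<i> * \<sigma> n * of_real (t + h)) - g n * exp (\<i> * \<sigma> n * of_real t)) / of_real h" for n
    using assms by (simp add: expm1_quotient_def field_simps flip: exp_add)
  then have "Re (g n * expm1_quotient h (\<i> * \<sigma> n) * exp (\<i> * \<sigma> n * of_real t))
     = (Re (g n * exp (\<i> * \<sigma> n * of_real (t + h))) - Re (g n * exp (\<i> * \<sigma> n * of_real t))) / h" for n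
    by (simp only: Re_divide_of_real minus_complex.simps)
  then show ?thesis
    unfolding osc_def sum_subtractf[symmetric] sum_divide_distrib by (intro sum.cong refl) (simp only: right_diff_distrib times_divide_eq_right)
qed

context coupled_oscillators
begin

definition rq :: "real \<Rightarrow> real \<Rightarrow> real" where "rq h x = (exp (x * h) - 1) / h"

lemma abs_rq_le: "\<lbrakk>0 < h; h \<le> 1; \<bar>x\<bar> \<le> \<rho>\<rbrakk> \<Longrightarrow> \<bar>rq h x\<bar> \<le> \<rho> * exp \<rho>"
proof -
  assume h: "0 < h" "h \<le> 1" "\<bar>x\<bar> \<le> \<rho>"
  have "\<bar>x\<bar> * h \<le> \<rho> * 1" using h by (intro mult_mono) auto
  then have e: "exp \<bar>x * h\<bar> \<le> exp \<rho>" using h by (simp add: abs_mult)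
  have "\<bar>exp (x * h) - 1\<bar> \<le> \<bar>x * h\<bar> * exp \<bar>x * h\<bar>" by (rule abs_exp_minus_one_le)
  also have "\<dots> \<le> (\<rho> * h) * exp \<rho>"
    using h e by (intro mult_mono) (auto simp: abs_mult)
  finally show ?thesis using h by (simp add: rq_def field_simps)
qed

text \<open>The multiplier of a mode depends on its exponent only, hence commutes with the coupling
  weights. A difference quotient of an observation is thus an observation of the same system with
  other coefficients, and the inverse estimate applies to it as it stands.\<close>

lemma v1_difference:
  assumes "h \<noteq> 0"
  shows "v1 (\<lambda>n. a n * expm1_quotient h (\<i> * \<omega> n)) (\<lambda>n. b n * expm1_quotient h (\<i> * \<zeta> n)) (\<lambda>n. R n * rq h (r n)) N t
     = (v1 a b R N (t + h) - v1 a b R N t) / h"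
proof -
  have "(\<Sum>n=1..N. R n * rq h (r n) * exp (r n * t)) = ((\<Sum>n=1..N. R n * exp (r n * (t + h))) - (\<Sum>n=1..N. R n * exp (r n * t))) / h"
    unfolding sum_subtractf[symmetric] sum_divide_distrib
    using assms by (intro sum.cong refl) (simp add: rq_def field_simps flip: exp_add)
  then show ?thesis
    using osc_expm1_quotient[OF assms, of \<omega> a N t] osc_expm1_quotient[OF assms, of \<zeta> "\<lambda>n. e n * b n" N t]
    by (simp add: v1_def mult.assoc add_divide_distrib diff_divide_distrib)
qed

lemma v2_difference:
  assumes "h \<noteq> 0"
  shows "v2 (\<lambda>n. a n * expm1_quotient h (\<i> * \<omega> n)) (\<lambda>n. b n * expm1_quotient h (\<i> * \<zeta> n)) (E * rq h (- \<eta>)) N t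
     = (v2 a b E N (t + h) - v2 a b E N t) / h"
proof -
  have "E * rq h (- \<eta>) * exp (- \<eta> * t) = (E * exp (- \<eta> * (t + h)) - E * exp (- \<eta> * t)) / h"
    using assms by (simp add: rq_def field_simps flip: exp_add)
  then show ?thesis
    using osc_expm1_quotient[OF assms, of \<zeta> b N t] osc_expm1_quotient[OF assms, of \<omega> "\<lambda>n. c n * a n" N t]
    by (simp add: v2_def mult.assoc add_divide_distrib diff_divide_distrib)
qed

lemma observed_mono: "0 \<le> S \<Longrightarrow> S \<le> T \<Longrightarrow> observed S a b R E N \<le> observed T a b R E N"
  unfolding observed_def
  by (intro integral_subset_le integrable_continuous_interval continuous_intros) auto

text \<open>The squared quotient is at most \<open>2 / h\<^sup>2\<close> times the sum of the
  squares at \<open>t\<close> and \<open>t + h\<close>; both times stay in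
  \<open>{0..T + h}\<close>, which gives the factor 4.\<close>

lemma observed_difference_le:
  assumes h: "h > 0" and T: "T \<ge> 0"
  shows "observed T (\<lambda>n. a n * expm1_quotient h (\<i> * \<omega> n)) (\<lambda>n. b n * expm1_quotient h (\<i> * \<zeta> n))
       (\<lambda>n. R n * rq h (r n)) (E * rq h (- \<eta>)) N \<le> 4 / h\<^sup>2 * observed (T + h) a b R E N"
proof -
  let ?f = "\<lambda>t. (v1 a b R N t)\<^sup>2 + (v2 a b E N t)\<^sup>2"
  have sq: "((x - y) / h)\<^sup>2 \<le> 2 / h\<^sup>2 * (x\<^sup>2 + y\<^sup>2)" for x y :: real
    using sum_squares_bound[of x "- y"] h by (simp add: power_divide divide_simps power2_diff)
  have "observed T (\<lambda>n. a n * expm1_quotient h (\<i> * \<omega> n)) (\<lambda>n. b n * expm1_quotient h (\<i> * \<zeta> n))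
       (\<lambda>n. R n * rq h (r n)) (E * rq h (- \<eta>)) N \<le> integral {0..T} (\<lambda>t. 2 / h\<^sup>2 * (?f (t + h) + ?f t))"
    unfolding observed_def
  proof (intro integral_le integrable_continuous_interval continuous_intros)
    fix t
    show "(v1 (\<lambda>n. a n * expm1_quotient h (\<i> * \<omega> n)) (\<lambda>n. b n * expm1_quotient h (\<i> * \<zeta> n)) (\<lambda>n. R n * rq h (r n)) N t)\<^sup>2
      + (v2 (\<lambda>n. a n * expm1_quotient h (\<i> * \<omega> n)) (\<lambda>n. b n * expm1_quotient h (\<i> * \<zeta> n)) (E * rq h (- \<eta>)) N t)\<^sup>2
      \<le> 2 / h\<^sup>2 * (?f (t + h) + ?f t)"
      unfolding v1_difference[OF less_imp_neq[OF h, symmetric]] v2_difference[OF less_imp_neq[OF h, symmetric]]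
      using sq[of "v1 a b R N (t + h)" "v1 a b R N t"] sq[of "v2 a b E N (t + h)" "v2 a b E N t"]
      by (simp only: ring_distribs)
  qed (auto intro!: continuous_on_compose2[OF continuous_on_v(1)[of UNIV]] continuous_on_compose2[OF continuous_on_v(2)[of UNIV]] continuous_intros)
  also have "\<dots> = 2 / h\<^sup>2 * (integral {0..T} (\<lambda>t. ?f (t + h)) + integral {0..T} ?f)"
    by (intro integral_unique has_integral_mult_right has_integral_add integrable_integral integrable_continuous_interval
        continuous_intros continuous_on_compose2[OF continuous_on_v(1)[of UNIV]] continuous_on_compose2[OF continuous_on_v(2)[of UNIV]]) auto
  also have "integral {0..T} (\<lambda>t. ?f (t + h)) = integral {0 + h..T + h} ?f"
    using integral_shift_Icc_real[of 0 T ?f h] by (simp add: comp_def add.commute)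
  also have "\<dots> \<le> observed (T + h) a b R E N"
    unfolding observed_def using h
    by (intro integral_subset_le integrable_continuous_interval continuous_intros) auto
  also have "integral {0..T} ?f \<le> observed (T + h) a b R E N"
    using observed_mono[of T "T + h"] T h unfolding observed_def by simp
  finally show ?thesis using h by (simp add: mult_left_mono divide_right_mono)
qed

lemma observed_iterated_difference_le:
  assumes h: "h > 0" and T: "T \<ge> 0"
  shows "observed T (\<lambda>n. a n * expm1_quotient h (\<i> * \<omega> n) ^ j) (\<lambda>n. b n * expm1_quotient h (\<i> * \<zeta> n) ^ j)
       (\<lambda>n. R n * rq h (r n) ^ j) (E * rq h (- \<eta>) ^ j) N \<le> (4 / h\<^sup>2) ^ j * observed (T + real j * h) a b R E N"
  using T
proof (induction j arbitrary: T)
  case (Suc j)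
  have "observed T (\<lambda>n. a n * expm1_quotient h (\<i> * \<omega> n) ^ Suc j) (\<lambda>n. b n * expm1_quotient h (\<i> * \<zeta> n) ^ Suc j)
       (\<lambda>n. R n * rq h (r n) ^ Suc j) (E * rq h (- \<eta>) ^ Suc j) N
     \<le> 4 / h\<^sup>2 * observed (T + h) (\<lambda>n. a n * expm1_quotient h (\<i> * \<omega> n) ^ j) (\<lambda>n. b n * expm1_quotient h (\<i> * \<zeta> n) ^ j)
       (\<lambda>n. R n * rq h (r n) ^ j) (E * rq h (- \<eta>) ^ j) N"
    using observed_difference_le[OF h Suc.prems, of "\<lambda>n. a n * expm1_quotient h (\<i> * \<omega> n) ^ j"
        "\<lambda>n. b n * expm1_quotient h (\<i> * \<zeta> n) ^ j" "\<lambda>n. R n * rq h (r n) ^ j" "E * rq h (- \<eta>) ^ j" N]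
    by (simp only: mult.assoc power_Suc2)
  also have "\<dots> \<le> 4 / h\<^sup>2 * ((4 / h\<^sup>2) ^ j * observed (T + h + real j * h) a b R E N)"
    using Suc.IH[of "T + h"] Suc.prems h by (intro mult_left_mono) auto
  also have "T + h + real j * h = T + real (Suc j) * h" by (simp add: algebra_simps)
  finally show ?case by simp
qed simp

end

subsection \<open>Compactness and uniqueness\<close>

text \<open>Cauchy-Schwarz. The first factor on the right is the tail from \<open>m\<close> on of
  the series of \<open>(w n)\<^sup>2\<close>; it tends to zero with growing \<open>m\<close>,
  independently of the coefficients.\<close>

lemma sum_abs_le_weighted:
  fixes w R x y :: "nat \<Rightarrow> real"
  assumes w: "\<And>n. w n \<ge> 0" "summable (\<lambda>n. (w n)\<^sup>2)" and m: "m \<ge> 1"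
    and R: "\<And>n. n \<in> {1..N} \<Longrightarrow> \<bar>R n\<bar> \<le> w n * sqrt ((x n)\<^sup>2 + (y n)\<^sup>2)"
  shows "(\<Sum>n=m..N. \<bar>R n\<bar>)\<^sup>2 \<le> ((\<Sum>n. (w n)\<^sup>2) - (\<Sum>n<m. (w n)\<^sup>2)) * (\<Sum>n=1..N. (x n)\<^sup>2 + (y n)\<^sup>2)"
proof -
  have "(\<Sum>n=m..N. \<bar>R n\<bar>)\<^sup>2 \<le> (\<Sum>n=m..N. w n * sqrt ((x n)\<^sup>2 + (y n)\<^sup>2))\<^sup>2"
    using R m by (intro power_mono sum_mono sum_nonneg) auto
  also have "\<dots> \<le> (\<Sum>n=m..N. (w n)\<^sup>2) * (\<Sum>n=m..N. (sqrt ((x n)\<^sup>2 + (y n)\<^sup>2))\<^sup>2)"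
    by (rule Cauchy_Schwarz_ineq_sum)
  also have "\<dots> \<le> ((\<Sum>n. (w n)\<^sup>2) - (\<Sum>n<m. (w n)\<^sup>2)) * (\<Sum>n=1..N. (x n)\<^sup>2 + (y n)\<^sup>2)"
  proof (intro mult_mono)
    have "(\<Sum>n=m..N. (w n)\<^sup>2) + (\<Sum>n<m. (w n)\<^sup>2) = (\<Sum>n\<in>{m..N} \<union> {..<m}. (w n)\<^sup>2)"
      by (intro sum.union_disjoint[symmetric]) auto
    also have "\<dots> \<le> (\<Sum>n. (w n)\<^sup>2)" using w by (intro sum_le_suminf) auto
    finally show "(\<Sum>n=m..N. (w n)\<^sup>2) \<le> (\<Sum>n. (w n)\<^sup>2) - (\<Sum>n<m. (w n)\<^sup>2)" by simp
    show "0 \<le> (\<Sum>n. (w n)\<^sup>2) - (\<Sum>n<m. (w n)\<^sup>2)"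
      using sum_le_suminf[OF w(2), of "{..<m}"] by simp
    show "(\<Sum>n=m..N. (sqrt ((x n)\<^sup>2 + (y n)\<^sup>2))\<^sup>2) \<le> (\<Sum>n=1..N. (x n)\<^sup>2 + (y n)\<^sup>2)"
      using m by (simp, intro sum_mono2) auto
  qed (auto intro: sum_nonneg)
  finally show ?thesis .
qed

section \<open>Truncation, differences and scaling of observations; limits without high
  frequencies\<close>

context coupled_oscillators
begin

lemma v_extend:
  assumes "\<And>n. n > N \<Longrightarrow> a n = 0 \<and> b n = 0 \<and> R n = 0" "N \<le> M"
  shows "v1 a b R M t = v1 a b R N t" "v2 a b E M t = v2 a b E N t" "nrg a b M = nrg a b N"
proof -
  have s: "sum f {1..M} = sum f {1..N}" if "\<And>n. n > N \<Longrightarrow> f n = 0" for f :: "nat \<Rightarrow> real"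
    using that assms(2) by (intro sum.mono_neutral_right) auto
  have o: "osc \<sigma> g M t = osc \<sigma> g N t" if "\<And>n. n > N \<Longrightarrow> g n = 0" for \<sigma> g
    unfolding osc_def by (rule s) (simp add: that)
  show "v1 a b R M t = v1 a b R N t"
    unfolding v1_def using o[of a \<omega>] o[of "\<lambda>n. e n * b n" \<zeta>] s[of "\<lambda>n. R n * exp (r n * t)"] assms(1) by simp
  show "v2 a b E M t = v2 a b E N t"
    unfolding v2_def using o[of b \<zeta>] o[of "\<lambda>n. c n * a n" \<omega>] assms(1) by simp
  show "nrg a b M = nrg a b N" unfolding nrg_def by (rule s) (simp add: assms(1))
qed

lemma v_diff:
  "v1 (\<lambda>n. a n - a' n) (\<lambda>n. b n - b' n) (\<lambda>n. R n - R' n) N t = v1 a b R N t - v1 a' b' R' N t"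
  "v2 (\<lambda>n. a n - a' n) (\<lambda>n. b n - b' n) (E - E') N t = v2 a b E N t - v2 a' b' E' N t"
  by (simp_all add: v1_def v2_def osc_diff right_diff_distrib left_diff_distrib sum_subtractf)

lemma observed_diff_le:
  "observed T (\<lambda>n. a n - a' n) (\<lambda>n. b n - b' n) (\<lambda>n. R n - R' n) (E - E') N
     \<le> 2 * observed T a b R E N + 2 * observed T a' b' R' E' N"
proof -
  have sq: "(x - y)\<^sup>2 \<le> 2 * x\<^sup>2 + 2 * y\<^sup>2" for x y :: real
    using sum_squares_bound[of x "- y"] by (simp add: power2_diff)
  have "observed T (\<lambda>n. a n - a' n) (\<lambda>n. b n - b' n) (\<lambda>n. R n - R' n) (E - E') N
     \<le> integral {0..T} (\<lambda>t. 2 * ((v1 a b R N t)\<^sup>2 + (v2 a b E N t)\<^sup>2) + 2 * ((v1 a' b' R' N t)\<^sup>2 + (v2 a' b' E' N t)\<^sup>2))"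
    unfolding observed_def
  proof (intro integral_le integrable_continuous_interval continuous_intros)
    fix t
    show "(v1 (\<lambda>n. a n - a' n) (\<lambda>n. b n - b' n) (\<lambda>n. R n - R' n) N t)\<^sup>2 + (v2 (\<lambda>n. a n - a' n) (\<lambda>n. b n - b' n) (E - E') N t)\<^sup>2
      \<le> 2 * ((v1 a b R N t)\<^sup>2 + (v2 a b E N t)\<^sup>2) + 2 * ((v1 a' b' R' N t)\<^sup>2 + (v2 a' b' E' N t)\<^sup>2)"
      unfolding v_diff using sq[of "v1 a b R N t" "v1 a' b' R' N t"] sq[of "v2 a b E N t" "v2 a' b' E' N t"] by argo
  qed
  also have "\<dots> = 2 * observed T a b R E N + 2 * observed T a' b' R' E' N"
    unfolding observed_def
    by (intro integral_unique has_integral_add has_integral_mult_right integrable_integral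
        integrable_continuous_interval continuous_intros)
  finally show ?thesis .
qed

lemma osc_scale: "osc \<sigma> (\<lambda>n. complex_of_real s * g n) N t = s * osc \<sigma> g N t"
proof -
  have "Re (complex_of_real s * g n * z) = s * Re (g n * z)" for n z
    by (simp add: algebra_simps)
  then show ?thesis unfolding osc_def sum_distrib_left by (intro sum.cong refl) (simp only: mult.left_commute)
qed

lemma v_scale:
  "v1 (\<lambda>n. complex_of_real s * a n) (\<lambda>n. complex_of_real s * b n) (\<lambda>n. s * R n) N t = s * v1 a b R N t"
  "v2 (\<lambda>n. complex_of_real s * a n) (\<lambda>n. complex_of_real s * b n) (s * E) N t = s * v2 a b E N t"
  by (simp_all add: v1_def v2_def osc_scale mult.left_commute[of _ "complex_of_real s"] ring_distribs sum_distrib_left mult.assoc)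

lemma nrg_scale: "nrg (\<lambda>n. complex_of_real s * a n) (\<lambda>n. complex_of_real s * b n) N = s\<^sup>2 * nrg a b N"
  by (simp add: nrg_def norm_mult power_mult_distrib sum_distrib_left ring_distribs)

lemma observed_scale:
  "observed T (\<lambda>n. complex_of_real s * a n) (\<lambda>n. complex_of_real s * b n) (\<lambda>n. s * R n) (s * E) N = s\<^sup>2 * observed T a b R E N"
  by (simp add: observed_def v_scale power_mult_distrib flip: ring_distribs)

lemma cong_upto:
  assumes "\<And>n. n \<in> {1..N} \<Longrightarrow> a n = a' n \<and> b n = b' n \<and> R n = R' n"
  shows "v1 a b R N = v1 a' b' R' N" "v2 a b E N = v2 a' b' E N" "nrg a b N = nrg a' b' N"
    "observed T a b R E N = observed T a' b' R' E N"
proof -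
  show v: "v1 a b R N = v1 a' b' R' N" "v2 a b E N = v2 a' b' E N"
    unfolding v1_def v2_def osc_def fun_eq_iff using assms by (auto intro!: arg_cong2[of _ _ _ _ "(+)"] sum.cong)
  show "nrg a b N = nrg a' b' N" unfolding nrg_def using assms by (intro sum.cong) auto
  show "observed T a b R E N = observed T a' b' R' E N" by (simp add: observed_def v)
qed

text \<open>The \<open>j\<close>-th difference quotients multiply the \<open>n\<close>-th coefficients by about \<open>(\<i> \<omega>\<^sub>n)\<^sup>j\<close>
  and \<open>(\<i> \<zeta>\<^sub>n)\<^sup>j\<close>, whereas the finitely many low modes, the \<open>R\<close>-part and the \<open>E\<close>-part grow
  only like \<open>\<Lambda>\<^sup>j\<close>. So high modes cannot survive in a limit with vanishing observation.\<close>

lemma limit_bounded_frequency: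
  assumes T: "T > 2 * pi / \<gamma>"
    and lim: "\<And>n. (\<lambda>k. A k n) \<longlonglongrightarrow> a n" "\<And>n. (\<lambda>k. B k n) \<longlonglongrightarrow> b n"
    and sup: "\<And>k n. n > N k \<Longrightarrow> A k n = 0 \<and> B k n = 0"
    and obs: "(\<lambda>k. observed T (A k) (B k) (R k) (E k) (N k)) \<longlonglongrightarrow> 0"
    and bd: "\<And>k. (\<Sum>n=1..N k. \<bar>R k n\<bar>)\<^sup>2 \<le> W" "\<And>k. (E k)\<^sup>2 \<le> W"
  shows "\<exists>\<Lambda>. \<forall>n\<ge>1. (cmod (\<omega> n) > \<Lambda> \<longrightarrow> a n = 0) \<and> (cmod (\<zeta> n) > \<Lambda> \<longrightarrow> b n = 0)"
proof -
  \<comment> \<open>The slack \<open>T - T'\<close> is consumed by the \<open>j\<close> shifts of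
    length \<open>h\<close>; the inverse estimate is used on \<open>{0..T'}\<close>.\<close>
  obtain T' where T': "2 * pi / \<gamma> < T'" "T' < T" using T dense by blast
  have T'0: "T' > 0" using T' \<gamma>_pos pi_gt_zero by (smt (verit) divide_pos_pos)
  obtain K n0 where K: "K > 0" and inv: "\<And>a b R E N. nrg a b N \<le> K * (observed T' a b R E N + nrg a b n0 + (\<Sum>n=1..N. \<bar>R n\<bar>)\<^sup>2 + E\<^sup>2)"
    using nrg_le_observed_mod_finite[OF T'(1)] by blast
  have W: "W \<ge> 0" using bd(2)[of 0] zero_le_power2[of "E 0"] by linarith
  define \<kappa> where "\<kappa> = \<rho> * exp \<rho>"
  have \<kappa>: "\<kappa> \<ge> 0" using \<rho>_nonneg by (simp add: \<kappa>_def)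
  let ?x = "\<lambda>h n. expm1_quotient h (\<i> * \<omega> n)" and ?y = "\<lambda>h n. expm1_quotient h (\<i> * \<zeta> n)"
  \<comment> \<open>Limit in \<open>k\<close> at fixed \<open>h\<close> and \<open>j\<close>: the
    observation term vanishes whatever its factor, leaving the low modes and the bounded
    \<open>R\<close>- and \<open>E\<close>-parts. The left side keeps a single mode, for which
    coefficientwise convergence is enough.\<close>
  have step1: "(cmod (a n * ?x h n ^ j))\<^sup>2 + (cmod (b n * ?y h n ^ j))\<^sup>2
      \<le> K * (nrg (\<lambda>n. a n * ?x h n ^ j) (\<lambda>n. b n * ?y h n ^ j) n0 + (\<kappa>\<^sup>2) ^ j * (2 * W))"
    if h: "0 < h" "h \<le> 1" "T' + real j * h \<le> T" and n: "n \<ge> 1" for h j n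
  proof (rule LIMSEQ_le)
    let ?Z = "\<lambda>k. K * ((4 / h\<^sup>2) ^ j * observed T (A k) (B k) (R k) (E k) (N k)
        + nrg (\<lambda>n. A k n * ?x h n ^ j) (\<lambda>n. B k n * ?y h n ^ j) n0 + (\<kappa>\<^sup>2) ^ j * (2 * W))"
    show "(\<lambda>k. (cmod (A k n * ?x h n ^ j))\<^sup>2 + (cmod (B k n * ?y h n ^ j))\<^sup>2)
       \<longlonglongrightarrow> (cmod (a n * ?x h n ^ j))\<^sup>2 + (cmod (b n * ?y h n ^ j))\<^sup>2"
      by (intro tendsto_intros lim)
    have "?Z
       \<longlonglongrightarrow> K * ((4 / h\<^sup>2) ^ j * 0 + nrg (\<lambda>n. a n * ?x h n ^ j) (\<lambda>n. b n * ?y h n ^ j) n0 + (\<kappa>\<^sup>2) ^ j * (2 * W))"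
      unfolding nrg_def by (intro tendsto_intros lim obs)
    then show "?Z
       \<longlonglongrightarrow> K * (nrg (\<lambda>n. a n * ?x h n ^ j) (\<lambda>n. b n * ?y h n ^ j) n0 + (\<kappa>\<^sup>2) ^ j * (2 * W))" by simp
    have "(cmod (A k n * ?x h n ^ j))\<^sup>2 + (cmod (B k n * ?y h n ^ j))\<^sup>2
      \<le> ?Z k" for k
    proof -
      let ?A = "\<lambda>n. A k n * ?x h n ^ j" and ?B = "\<lambda>n. B k n * ?y h n ^ j"
        and ?R = "\<lambda>n. R k n * rq h (r n) ^ j" and ?E = "E k * rq h (- \<eta>) ^ j"
      have rqj: "\<bar>rq h x ^ j\<bar> \<le> \<kappa> ^ j" if "\<bar>x\<bar> \<le> \<rho>" for x
        unfolding power_abs using abs_rq_le[OF h(1,2) that] by (intro power_mono) (auto simp: \<kappa>_def)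
      have "(cmod (?A n))\<^sup>2 + (cmod (?B n))\<^sup>2 \<le> nrg ?A ?B (N k)"
      proof (cases "n \<le> N k")
        case True
        then show ?thesis unfolding nrg_def using n
          by (intro member_le_sum[where f = "\<lambda>n. (cmod (?A n))\<^sup>2 + (cmod (?B n))\<^sup>2"]) auto
      next
        case False
        then show ?thesis using sup[where k = k and n = n] nrg_nonneg[of ?A ?B] by simp
      qed
      also have "\<dots> \<le> K * (observed T' ?A ?B ?R ?E (N k) + nrg ?A ?B n0 + (\<Sum>n=1..N k. \<bar>?R n\<bar>)\<^sup>2 + ?E\<^sup>2)"
        by (rule inv)
      also have "\<dots> \<le> K * ((4 / h\<^sup>2) ^ j * observed T (A k) (B k) (R k) (E k) (N k) + nrg ?A ?B n0 + (\<kappa>\<^sup>2) ^ j * W + (\<kappa>\<^sup>2) ^ j * W)"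
      proof (intro mult_left_mono add_mono order_refl)
        have "observed T' ?A ?B ?R ?E (N k) \<le> (4 / h\<^sup>2) ^ j * observed (T' + real j * h) (A k) (B k) (R k) (E k) (N k)"
          using T'0 h by (intro observed_iterated_difference_le) auto
        also have "\<dots> \<le> (4 / h\<^sup>2) ^ j * observed T (A k) (B k) (R k) (E k) (N k)"
          using T'0 h by (intro mult_left_mono observed_mono) auto
        finally show "observed T' ?A ?B ?R ?E (N k) \<le> (4 / h\<^sup>2) ^ j * observed T (A k) (B k) (R k) (E k) (N k)" .
        have "(\<Sum>n=1..N k. \<bar>?R n\<bar>) \<le> (\<Sum>n=1..N k. \<kappa> ^ j * \<bar>R k n\<bar>)"
          unfolding abs_mult using rqj[OF r_le] by (intro sum_mono, subst mult.commute) (intro mult_right_mono, auto)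
        then have "(\<Sum>n=1..N k. \<bar>?R n\<bar>)\<^sup>2 \<le> (\<kappa> ^ j * (\<Sum>n=1..N k. \<bar>R k n\<bar>))\<^sup>2"
          unfolding sum_distrib_left by (intro power_mono sum_nonneg) auto
        also have "\<dots> = (\<kappa>\<^sup>2) ^ j * (\<Sum>n=1..N k. \<bar>R k n\<bar>)\<^sup>2"
          by (simp add: power_mult_distrib mult.commute flip: power_mult)
        also have "\<dots> \<le> (\<kappa>\<^sup>2) ^ j * W" by (intro mult_left_mono bd) auto
        finally show "(\<Sum>n=1..N k. \<bar>?R n\<bar>)\<^sup>2 \<le> (\<kappa>\<^sup>2) ^ j * W" .
        have "\<bar>rq h (- \<eta>) ^ j\<bar>\<^sup>2 \<le> (\<kappa> ^ j)\<^sup>2" using rqj[of "- \<eta>"] \<eta>_le by (intro power_mono) auto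
        moreover have "(\<kappa> ^ j)\<^sup>2 = (\<kappa>\<^sup>2) ^ j" by (simp only: power_mult[symmetric] mult.commute)
        ultimately have "?E\<^sup>2 \<le> W * (\<kappa>\<^sup>2) ^ j"
          unfolding power_mult_distrib using bd(2)[of k] W by (intro mult_mono) auto
        then show "?E\<^sup>2 \<le> (\<kappa>\<^sup>2) ^ j * W" by (simp add: mult.commute)
      qed (use K in auto)
      finally show ?thesis by (simp add: algebra_simps)
    qed
    then show "\<exists>M. \<forall>k\<ge>M. (cmod (A k n * ?x h n ^ j))\<^sup>2 + (cmod (B k n * ?y h n ^ j))\<^sup>2
      \<le> ?Z k" by blast
  qed
  have step2: "(cmod (a n * (\<i> * \<omega> n) ^ j))\<^sup>2 + (cmod (b n * (\<i> * \<zeta> n) ^ j))\<^sup>2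
      \<le> K * (nrg (\<lambda>n. a n * (\<i> * \<omega> n) ^ j) (\<lambda>n. b n * (\<i> * \<zeta> n) ^ j) n0 + (\<kappa>\<^sup>2) ^ j * (2 * W))"
    if n: "n \<ge> 1" for j n
  proof (rule tendsto_le[where F = "at_right (0::real)"])
    show "((\<lambda>h. K * (nrg (\<lambda>n. a n * ?x h n ^ j) (\<lambda>n. b n * ?y h n ^ j) n0 + (\<kappa>\<^sup>2) ^ j * (2 * W))) \<longlongrightarrow>
       K * (nrg (\<lambda>n. a n * (\<i> * \<omega> n) ^ j) (\<lambda>n. b n * (\<i> * \<zeta> n) ^ j) n0 + (\<kappa>\<^sup>2) ^ j * (2 * W))) (at_right 0)"
      unfolding nrg_def by (intro tendsto_intros tendsto_expm1_quotient)
    show "((\<lambda>h. (cmod (a n * ?x h n ^ j))\<^sup>2 + (cmod (b n * ?y h n ^ j))\<^sup>2) \<longlongrightarrow>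
       (cmod (a n * (\<i> * \<omega> n) ^ j))\<^sup>2 + (cmod (b n * (\<i> * \<zeta> n) ^ j))\<^sup>2) (at_right 0)"
      by (intro tendsto_intros tendsto_expm1_quotient)
    \<comment> \<open>Steps below \<open>h0\<close> make the \<open>j\<close> shifts fit into
      \<open>T - T'\<close>; the denominator \<open>real j + 1\<close> includes the case
      \<open>j = 0\<close>.\<close>
    define h0 where "h0 = min 1 ((T - T') / (real j + 1))"
    have h0: "h0 > 0" using T' by (simp add: h0_def)
    have "T' + real j * h \<le> T" "h \<le> 1" if "0 < h" "h < h0" for h
    proof -
      have "real j * h \<le> (real j + 1) * h" using that by simp
      also have "\<dots> \<le> (real j + 1) * ((T - T') / (real j + 1))" using that by (intro mult_left_mono) (auto simp: h0_def)
      also have "\<dots> = T - T'" by simp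
      finally show "T' + real j * h \<le> T" by simp
      show "h \<le> 1" using that by (simp add: h0_def)
    qed
    then show "eventually (\<lambda>h. (cmod (a n * ?x h n ^ j))\<^sup>2 + (cmod (b n * ?y h n ^ j))\<^sup>2
      \<le> K * (nrg (\<lambda>n. a n * ?x h n ^ j) (\<lambda>n. b n * ?y h n ^ j) n0 + (\<kappa>\<^sup>2) ^ j * (2 * W))) (at_right 0)"
      unfolding eventually_at_right_field using h0 step1[OF _ _ _ n] by blast
  qed simp
  \<comment> \<open>\<open>\<Lambda>\<close> dominates the frequencies of the first
    \<open>n0\<close> modes and the bound \<open>\<kappa>\<close> of the real multipliers, so the
    whole right side grows at most like \<open>(\<Lambda>\<^sup>2) ^ j\<close>. The summand 1 makes
    \<open>\<Lambda>\<close> safe to divide by.\<close>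
  define \<Lambda> where "\<Lambda> = 1 + \<kappa> + (\<Sum>n=1..n0. cmod (\<omega> n) + cmod (\<zeta> n))"
  have \<Lambda>: "\<Lambda> \<ge> 1" "\<kappa> \<le> \<Lambda>" using \<kappa> by (auto simp: \<Lambda>_def add_nonneg_nonneg sum_nonneg)
  have \<Lambda>n: "cmod (\<omega> n) \<le> \<Lambda>" "cmod (\<zeta> n) \<le> \<Lambda>" if "n \<in> {1..n0}" for n
  proof -
    have "cmod (\<omega> n) + cmod (\<zeta> n) \<le> (\<Sum>n=1..n0. cmod (\<omega> n) + cmod (\<zeta> n))"
      using that by (intro member_le_sum[where f = "\<lambda>n. cmod (\<omega> n) + cmod (\<zeta> n)"]) auto
    then show "cmod (\<omega> n) \<le> \<Lambda>" "cmod (\<zeta> n) \<le> \<Lambda>"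
      using \<kappa> norm_ge_zero[of "\<omega> n"] norm_ge_zero[of "\<zeta> n"] unfolding \<Lambda>_def by linarith+
  qed
  define Z where "Z = K * (nrg a b n0 + 2 * W)"
  have step3: "(cmod (a n))\<^sup>2 * ((cmod (\<omega> n))\<^sup>2) ^ j + (cmod (b n))\<^sup>2 * ((cmod (\<zeta> n))\<^sup>2) ^ j \<le> Z * (\<Lambda>\<^sup>2) ^ j"
    if n: "n \<ge> 1" for j n
  proof -
    have c: "(cmod (x * (\<i> * y) ^ j))\<^sup>2 = (cmod x)\<^sup>2 * ((cmod y)\<^sup>2) ^ j" for x y
      by (simp add: norm_mult norm_power power_mult_distrib mult.commute flip: power_mult)
    have "(cmod (a n))\<^sup>2 * ((cmod (\<omega> n))\<^sup>2) ^ j + (cmod (b n))\<^sup>2 * ((cmod (\<zeta> n))\<^sup>2) ^ j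
       \<le> K * (nrg (\<lambda>n. a n * (\<i> * \<omega> n) ^ j) (\<lambda>n. b n * (\<i> * \<zeta> n) ^ j) n0 + (\<kappa>\<^sup>2) ^ j * (2 * W))"
      using step2[OF n, of j] unfolding c .
    also have "nrg (\<lambda>n. a n * (\<i> * \<omega> n) ^ j) (\<lambda>n. b n * (\<i> * \<zeta> n) ^ j) n0 \<le> nrg a b n0 * (\<Lambda>\<^sup>2) ^ j"
      unfolding nrg_def c sum_distrib_right ring_distribs
      using \<Lambda>n by (intro sum_mono add_mono mult_left_mono power_mono) auto
    also have "(\<kappa>\<^sup>2) ^ j * (2 * W) \<le> (\<Lambda>\<^sup>2) ^ j * (2 * W)"
      using \<Lambda> \<kappa> W by (intro mult_right_mono power_mono) auto
    finally show ?thesis using K by (simp add: Z_def algebra_simps)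
  qed
  \<comment> \<open>A nonzero mode of frequency above \<open>\<Lambda>\<close> would outgrow the
    right side geometrically in \<open>j\<close>.\<close>
  have kill: "x = 0" if bd: "\<And>j. x * (u\<^sup>2) ^ j \<le> Z * (\<Lambda>\<^sup>2) ^ j" and u: "u > \<Lambda>" and x: "x \<ge> 0" for x u :: real
  proof (rule ccontr)
    assume "x \<noteq> 0"
    then have x: "x > 0" using x by simp
    have q: "u\<^sup>2 / \<Lambda>\<^sup>2 > 1" using u \<Lambda> by (simp add: power_strict_mono)
    then obtain j where j: "Z / x < (u\<^sup>2 / \<Lambda>\<^sup>2) ^ j" using real_arch_pow by blast
    have "Z < x * ((u\<^sup>2) ^ j / (\<Lambda>\<^sup>2) ^ j)" using j x by (simp add: power_divide pos_divide_less_eq mult.commute)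
    then have "Z * (\<Lambda>\<^sup>2) ^ j < x * (u\<^sup>2) ^ j" using \<Lambda> by (simp add: pos_less_divide_eq)
    then show False using bd[of j] by simp
  qed
  show ?thesis
  proof (intro exI[of _ \<Lambda>] allI impI conjI)
    fix n :: nat assume n: "n \<ge> 1"
    have s: "(cmod (a n))\<^sup>2 * ((cmod (\<omega> n))\<^sup>2) ^ j \<le> Z * (\<Lambda>\<^sup>2) ^ j" "(cmod (b n))\<^sup>2 * ((cmod (\<zeta> n))\<^sup>2) ^ j \<le> Z * (\<Lambda>\<^sup>2) ^ j" for j
    proof -
      have "0 \<le> (cmod (a n))\<^sup>2 * ((cmod (\<omega> n))\<^sup>2) ^ j" "0 \<le> (cmod (b n))\<^sup>2 * ((cmod (\<zeta> n))\<^sup>2) ^ j" by auto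
      then show "(cmod (a n))\<^sup>2 * ((cmod (\<omega> n))\<^sup>2) ^ j \<le> Z * (\<Lambda>\<^sup>2) ^ j" "(cmod (b n))\<^sup>2 * ((cmod (\<zeta> n))\<^sup>2) ^ j \<le> Z * (\<Lambda>\<^sup>2) ^ j"
        using step3[OF n, of j] by argo+
    qed
    show "a n = 0" if "\<Lambda> < cmod (\<omega> n)" using kill[OF s(1) that] by simp
    show "b n = 0" if "\<Lambda> < cmod (\<zeta> n)" using kill[OF s(2) that] by simp
  qed
qed

end

section \<open>Uniqueness for finite sums and exclusion of vanishing observations\<close>

lemma inj_on_case_sum:
  assumes "inj_on f A" "inj_on g B" "\<And>x y. x \<in> A \<Longrightarrow> y \<in> B \<Longrightarrow> f x \<noteq> g y"
  shows "inj_on (case_sum f g) (A <+> B)"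
proof (rule inj_onI)
  fix x y assume "x \<in> A <+> B" "y \<in> A <+> B" "case_sum f g x = case_sum f g y"
  then show "x = y" using assms by (elim PlusE) (auto dest: inj_onD, metis+)
qed

text \<open>A positive gap makes the real parts grow linearly. This serves twice: it leaves finitely
  many modes below any frequency, and it makes the coupling weights \<open>c n\<close> and
  \<open>1 / d n\<close> vanish in the limit.\<close>

lemma filterlim_cmod_at_top_gap:
  fixes \<sigma> :: "nat \<Rightarrow> complex"
  assumes gap: "\<And>\<gamma>'. \<gamma>' < \<gamma> \<Longrightarrow> eventually (\<lambda>n. \<gamma>' < Re (\<sigma> (Suc n)) - Re (\<sigma> n)) sequentially" and \<gamma>: "\<gamma> > 0"
  shows "filterlim (\<lambda>n. cmod (\<sigma> n)) at_top sequentially"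
proof (rule filterlim_at_top_mono)
  show "filterlim (\<lambda>n. \<gamma> / 2 * real n) at_top sequentially"
    using \<gamma> by (intro filterlim_tendsto_pos_mult_at_top[OF tendsto_const _ filterlim_real_sequentially]) simp
  obtain n0 where "\<forall>n\<ge>n0. \<gamma> / 2 * real n \<le> Re (\<sigma> n)"
    by (rule eventually_gap_linear[of \<gamma> "\<lambda>n. Re (\<sigma> n)" "\<gamma> / 2"]) (use gap \<gamma> that in auto)
  then have "\<gamma> / 2 * real n \<le> cmod (\<sigma> n)" if "n \<ge> n0" for n
    using order_trans[OF _ complex_Re_le_cmod] that by blast
  then show "eventually (\<lambda>n. \<gamma> / 2 * real n \<le> cmod (\<sigma> n)) sequentially"
    by (auto simp: eventually_sequentially)
qed

locale distinct_coupled_oscillators = coupled_oscillators +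
  assumes inj: "inj_on \<omega> {1..}" "inj_on r {1..}" "inj_on \<zeta> {1..}"
    and distinct: "\<And>n m. n \<ge> 1 \<Longrightarrow> m \<ge> 1 \<Longrightarrow> \<omega> n \<noteq> \<zeta> m"
    and Re_pos: "\<And>n. n \<ge> 1 \<Longrightarrow> Re (\<omega> n) > 0" "\<And>n. n \<ge> 1 \<Longrightarrow> Re (\<zeta> n) > 0"
begin

text \<open>Positive real parts separate the exponents: \<open>\<i> * \<omega> n\<close> and
  \<open>\<i> * \<zeta> n\<close> lie in the upper half plane, their mirror images in the lower one,
  the real exponents between them. The second component yields \<open>b n = 0\<close> and
  \<open>E = 0\<close>, but for the other family only \<open>c n * a n = 0\<close>, and
  \<open>c n\<close> may be zero. Therefore \<open>a\<close> and \<open>R\<close> are read off from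
  the first component, from which \<open>b\<close> has by then disappeared.\<close>

lemma finite_unique_continuation:
  assumes T: "T > 0" and v1: "\<And>t. t \<in> {0<..<T} \<Longrightarrow> v1 a b R N t = 0" and v2: "\<And>t. t \<in> {0<..<T} \<Longrightarrow> v2 a b E N t = 0"
  shows "E = 0" "\<forall>n\<in>{1..N}. a n = 0 \<and> b n = 0 \<and> R n = 0"
proof -
  let ?I = "{1..N}"
  have I: "n \<ge> 1" if "n \<in> ?I" for n using that by simp
  have im: "Im (\<i> * \<omega> n) > 0" "Im (\<i> * \<zeta> n) > 0" "Im (- \<i> * cnj (\<omega> n)) < 0" "Im (- \<i> * cnj (\<zeta> n)) < 0" if "n \<ge> 1" for n
    using Re_pos[OF that] by simp_all
  have imz: "\<And>n m. n \<ge> 1 \<Longrightarrow> m \<ge> 1 \<Longrightarrow> \<i> * \<omega> n \<noteq> - \<i> * cnj (\<omega> m)" "\<And>n m. n \<ge> 1 \<Longrightarrow> m \<ge> 1 \<Longrightarrow> \<i> * \<zeta> n \<noteq> - \<i> * cnj (\<zeta> m)"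
     "\<And>n m. n \<ge> 1 \<Longrightarrow> m \<ge> 1 \<Longrightarrow> \<i> * \<omega> n \<noteq> - \<i> * cnj (\<zeta> m)" "\<And>n m. n \<ge> 1 \<Longrightarrow> m \<ge> 1 \<Longrightarrow> \<i> * \<zeta> n \<noteq> - \<i> * cnj (\<omega> m)"
     "\<And>n x. n \<ge> 1 \<Longrightarrow> \<i> * \<omega> n \<noteq> complex_of_real x" "\<And>n x. n \<ge> 1 \<Longrightarrow> \<i> * \<zeta> n \<noteq> complex_of_real x"
     "\<And>n x. n \<ge> 1 \<Longrightarrow> - \<i> * cnj (\<omega> n) \<noteq> complex_of_real x" "\<And>n x. n \<ge> 1 \<Longrightarrow> - \<i> * cnj (\<zeta> n) \<noteq> complex_of_real x"
    using im by (metis Im_complex_of_real less_asym less_irrefl)+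
  have \<omega>\<zeta>: "\<i> * \<omega> n \<noteq> \<i> * \<zeta> m" "- \<i> * cnj (\<omega> n) \<noteq> - \<i> * cnj (\<zeta> m)" if "n \<ge> 1" "m \<ge> 1" for n m
    using distinct[OF that] by auto
  have inj': "inj_on (\<lambda>n. \<i> * \<omega> n) ?I" "inj_on (\<lambda>n. - \<i> * cnj (\<omega> n)) ?I" "inj_on (\<lambda>n. \<i> * \<zeta> n) ?I" "inj_on (\<lambda>n. - \<i> * cnj (\<zeta> n)) ?I"
    "inj_on (\<lambda>n. complex_of_real (r n)) ?I"
    using inj by (auto simp: inj_on_def)
  \<comment> \<open>The nested sum type keeps the five groups of exponents apart, so that
    independence can be applied once to a single injective family.\<close>
  define \<mu> where "\<mu> = case_sum (case_sum (case_sum (\<lambda>n. \<i> * \<zeta> n) (\<lambda>n. - \<i> * cnj (\<zeta> n))) (case_sum (\<lambda>n. \<i> * \<omega> n) (\<lambda>n. - \<i> * cnj (\<omega> n)))) (\<lambda>_::unit. complex_of_real (- \<eta>))"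
  define p where "p = case_sum (case_sum (case_sum b (\<lambda>n. cnj (b n))) (case_sum (\<lambda>n. c n * a n) (\<lambda>n. cnj (c n * a n)))) (\<lambda>_::unit. complex_of_real E)"
  define J where "J = ((?I <+> ?I) <+> (?I <+> ?I)) <+> (UNIV :: unit set)"
  have "inj_on \<mu> J"
  proof -
    have "inj_on (case_sum (case_sum (\<lambda>n. \<i> * \<zeta> n) (\<lambda>n. - \<i> * cnj (\<zeta> n))) (case_sum (\<lambda>n. \<i> * \<omega> n) (\<lambda>n. - \<i> * cnj (\<omega> n)))) ((?I <+> ?I) <+> (?I <+> ?I))"
    proof -
      have "inj_on (case_sum (\<lambda>n. \<i> * \<zeta> n) (\<lambda>n. - \<i> * cnj (\<zeta> n))) (?I <+> ?I)"
        by (rule inj_on_case_sum[OF inj'(3,4) imz(2)[OF I I]])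
      moreover have "inj_on (case_sum (\<lambda>n. \<i> * \<omega> n) (\<lambda>n. - \<i> * cnj (\<omega> n))) (?I <+> ?I)"
        by (rule inj_on_case_sum[OF inj'(1,2) imz(1)[OF I I]])
      ultimately show ?thesis
        by (rule inj_on_case_sum) (elim PlusE; simp only: sum.case;
            rule \<omega>\<zeta>(1)[OF I I, symmetric] \<omega>\<zeta>(2)[OF I I, symmetric] imz(4)[OF I I] imz(3)[OF I I, symmetric]; assumption)
    qed
    then show ?thesis unfolding \<mu>_def J_def
    proof (rule inj_on_case_sum)
      show "inj_on (\<lambda>_::unit. complex_of_real (- \<eta>)) UNIV" by (simp add: inj_on_def)
    qed (elim PlusE; simp only: sum.case; metis imz atLeastAtMost_iff)
  qed
  moreover have "(\<Sum>i\<in>J. p i * exp (\<mu> i * of_real t)) = 0" if "t \<in> {0<..<T}" for t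
  proof -
    have "(\<Sum>i\<in>J. p i * exp (\<mu> i * of_real t)) = complex_of_real (v2 a b E N t)"
      unfolding J_def v2_def of_real_add of_real_osc
      by (simp add: sum.Plus \<mu>_def p_def o_def flip: exp_of_real)
    then show ?thesis using v2[OF that] by simp
  qed
  moreover have "finite J" by (simp add: J_def)
  ultimately have pz: "\<forall>i\<in>J. p i = 0" using exponentials_independent[OF _ _ T] by blast
  have b: "b n = 0" if "n \<in> ?I" for n
    using pz[rule_format, of "Inl (Inl (Inl n))"] that by (simp add: J_def p_def InlI InrI)
  show "E = 0" using pz[rule_format, of "Inr ()"] by (simp add: J_def p_def InlI InrI)
  define \<mu>' where "\<mu>' = case_sum (case_sum (\<lambda>n. \<i> * \<omega> n) (\<lambda>n. - \<i> * cnj (\<omega> n))) (\<lambda>n. complex_of_real (r n))"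
  define p' where "p' = case_sum (case_sum a (\<lambda>n. cnj (a n))) (\<lambda>n. complex_of_real (R n))"
  define J' where "J' = (?I <+> ?I) <+> ?I"
  have "inj_on \<mu>' J'"
    unfolding \<mu>'_def J'_def
  proof (rule inj_on_case_sum[OF _ inj'(5)])
    show "inj_on (case_sum (\<lambda>n. \<i> * \<omega> n) (\<lambda>n. - \<i> * cnj (\<omega> n))) (?I <+> ?I)"
      by (rule inj_on_case_sum[OF inj'(1,2) imz(1)[OF I I]])
  qed (elim PlusE; simp only: sum.case; rule imz(5)[OF I] imz(7)[OF I]; assumption)
  moreover have "(\<Sum>i\<in>J'. p' i * exp (\<mu>' i * of_real t)) = 0" if "t \<in> {0<..<T}" for t
  proof -
    have z: "osc \<zeta> (\<lambda>n. e n * b n) N t = 0" unfolding osc_def by (intro sum.neutral) (simp add: b)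
    have "(\<Sum>i\<in>J'. p' i * exp (\<mu>' i * of_real t)) = complex_of_real (v1 a b R N t)"
      unfolding J'_def v1_def z of_real_add of_real_osc
      by (simp add: sum.Plus \<mu>'_def p'_def o_def flip: exp_of_real)
    then show ?thesis using v1[OF that] by simp
  qed
  moreover have "finite J'" by (simp add: J'_def)
  ultimately have pz': "\<forall>i\<in>J'. p' i = 0" using exponentials_independent[OF _ _ T] by blast
  have "a n = 0" "R n = 0" if "n \<in> ?I" for n
    using pz'[rule_format, of "Inl (Inl n)"] pz'[rule_format, of "Inr n"] that by (simp_all add: J'_def p'_def InlI InrI)
  with b show "\<forall>n\<in>{1..N}. a n = 0 \<and> b n = 0 \<and> R n = 0" by simp
qed

lemma eventually_frequency_large:
  "eventually (\<lambda>n. cmod (\<omega> n) > \<Lambda> \<and> cmod (\<zeta> n) > \<Lambda>) sequentially"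
  using filterlim_cmod_at_top_gap[OF gap_\<omega> \<gamma>_pos] filterlim_cmod_at_top_gap[OF gap_\<zeta> \<gamma>_pos]
  unfolding filterlim_at_top_dense by (auto intro: eventually_conj)

lemma observed_extend:
  assumes "\<And>n. n > N \<Longrightarrow> a n = 0 \<and> b n = 0 \<and> R n = 0" "N \<le> M"
  shows "observed T a b R E M = observed T a b R E N"
proof -
  have "v1 a b R M = v1 a b R N" "v2 a b E M = v2 a b E N"
    using v_extend(1,2)[of N a b R M, OF assms] by auto
  then show ?thesis by (simp add: observed_def)
qed

text \<open>The hypotheses describe a normalised counterexample to the lower bound after passage to
  a subsequence. Coefficientwise convergence could lose energy to ever higher modes; this is
  excluded by bounding the distance to the limit, asymptotically, by a multiple of a tail of the
  squared weights.\<close>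

lemma no_concentration:
  fixes A B :: "nat \<Rightarrow> nat \<Rightarrow> complex" and R :: "nat \<Rightarrow> nat \<Rightarrow> real" and E :: "nat \<Rightarrow> real"
  assumes T: "T > 2 * pi / \<gamma>"
    and w: "\<And>n. w n \<ge> 0" "summable (\<lambda>n. (w n)\<^sup>2)"
    and lim: "\<And>n. (\<lambda>k. A k n) \<longlonglongrightarrow> a n" "\<And>n. (\<lambda>k. B k n) \<longlonglongrightarrow> b n" "\<And>n. (\<lambda>k. R k n) \<longlonglongrightarrow> S n" "E \<longlonglongrightarrow> F"
    and sup: "\<And>k n. n > N k \<Longrightarrow> A k n = 0 \<and> B k n = 0 \<and> R k n = 0"
    and valid: "\<And>k n. \<bar>R k n\<bar> \<le> w n * sqrt ((cmod (A k n))\<^sup>2 + (cmod (B k n))\<^sup>2)"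
    and norm1: "\<And>k. nrg (A k) (B k) (N k) + (E k)\<^sup>2 = 1"
    and obs: "(\<lambda>k. observed T (A k) (B k) (R k) (E k) (N k)) \<longlonglongrightarrow> 0"
  shows False
proof -
  have T0: "T > 0" using T \<gamma>_pos pi_gt_zero by (smt (verit) divide_pos_pos)
  let ?Q = "\<lambda>k. observed T (A k) (B k) (R k) (E k) (N k)"
  define U where "U = (\<lambda>m. (\<Sum>n. (w n)\<^sup>2) - (\<Sum>n<m. (w n)\<^sup>2))"
  have U: "U \<longlonglongrightarrow> 0"
    unfolding U_def using tendsto_diff[OF tendsto_const[of "\<Sum>n. (w n)\<^sup>2"] summable_LIMSEQ[OF w(2)]] by simp
  have nrg1: "nrg (A k) (B k) (N k) \<le> 1" "(E k)\<^sup>2 \<le> 1" for k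
    using norm1[of k] nrg_nonneg[of "A k" "B k" "N k"] zero_le_power2[of "E k"] by linarith+
  have nrgM: "nrg (A k) (B k) M \<le> 1" for k M
  proof (cases "M \<le> N k")
    case True
    show ?thesis by (rule order_trans[OF nrg_mono[OF True] nrg1(1)])
  next
    case False
    then show ?thesis using v_extend(3)[of "N k" "A k" "B k" "R k" M] sup nrg1(1)[of k] by simp
  qed
  have U0: "U m \<ge> 0" for m unfolding U_def using sum_le_suminf[OF w(2), of "{..<m}"] by simp
  have tailR: "(\<Sum>n=m..M. \<bar>R k n\<bar>) \<le> sqrt (U m)" if "m \<ge> 1" for k m M
  proof -
    have "(\<Sum>n=m..M. \<bar>R k n\<bar>)\<^sup>2 \<le> U m * nrg (A k) (B k) M"
      unfolding U_def nrg_def by (rule sum_abs_le_weighted[OF w that valid])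
    also have "\<dots> \<le> U m * 1" using nrgM U0 by (intro mult_left_mono)
    finally show ?thesis by (intro real_le_rsqrt) simp
  qed
  have tailS: "(\<Sum>n=m..M. \<bar>S n\<bar>) \<le> sqrt (U m)" if "m \<ge> 1" for m M
    by (rule LIMSEQ_le_const2[where X = "\<lambda>k. \<Sum>n=m..M. \<bar>R k n\<bar>"])
       (use tailR[OF that] in \<open>auto intro!: tendsto_intros lim\<close>)
  have splitR: "(\<Sum>n=1..M. \<bar>x n - y n\<bar>) \<le> (\<Sum>n=1..<m. \<bar>x n - y n\<bar>) + 2 * sqrt (U m)"
    if m: "m \<ge> 1" and x: "(\<Sum>n=m..M. \<bar>x n\<bar>) \<le> sqrt (U m)" "(\<Sum>n=m..M. \<bar>y n\<bar>) \<le> sqrt (U m)" for x y :: "nat \<Rightarrow> real" and m M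
  proof -
    have "(\<Sum>n=1..M. \<bar>x n - y n\<bar>) \<le> (\<Sum>n\<in>{1..<m} \<union> {m..M}. \<bar>x n - y n\<bar>)" by (intro sum_mono2) auto
    also have "\<dots> = (\<Sum>n=1..<m. \<bar>x n - y n\<bar>) + (\<Sum>n=m..M. \<bar>x n - y n\<bar>)" by (intro sum.union_disjoint) auto
    finally have "(\<Sum>n=1..M. \<bar>x n - y n\<bar>) \<le> (\<Sum>n=1..<m. \<bar>x n - y n\<bar>) + (\<Sum>n=m..M. \<bar>x n - y n\<bar>)" .
    moreover have "(\<Sum>n=m..M. \<bar>x n - y n\<bar>) \<le> (\<Sum>n=m..M. \<bar>x n\<bar>) + (\<Sum>n=m..M. \<bar>y n\<bar>)"
      unfolding sum.distrib[symmetric] by (intro sum_mono abs_triangle_ineq4)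
    ultimately show ?thesis using x by argo
  qed
  obtain K n0 where K: "K > 0" and inv: "\<And>a b R E N. nrg a b N \<le> K * (observed T a b R E N + nrg a b n0 + (\<Sum>n=1..N. \<bar>R n\<bar>)\<^sup>2 + E\<^sup>2)"
    using nrg_le_observed_mod_finite[OF T] by blast
  \<comment> \<open>\<open>G k m\<close> will bound the energy distance to the limit. The cut
    \<open>m\<close> separates finitely many converging \<open>R\<close>-terms from the others,
    which contribute at most \<open>2 * sqrt (U m)\<close>. So \<open>k\<close> tends to infinity
    first, leaving \<open>4 * K * U m\<close>, and \<open>m\<close> afterwards.\<close>
  define G where "G = (\<lambda>k m. K * (2 * ?Q k + nrg (\<lambda>n. A k n - a n) (\<lambda>n. B k n - b n) n0
      + ((\<Sum>n=1..<m. \<bar>R k n - S n\<bar>) + 2 * sqrt (U m))\<^sup>2 + (E k - F)\<^sup>2))"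
  \<comment> \<open>The inverse estimate is applied to two members of the sequence, which are finite
    sums, and then \<open>l\<close> tends to infinity with \<open>k\<close> and \<open>M\<close>
    fixed. In this way the limit does not have to be known to be finite yet.\<close>
  have strong: "nrg (\<lambda>n. A k n - a n) (\<lambda>n. B k n - b n) M \<le> G k m" if m: "m \<ge> 1" for k m M
  proof (rule LIMSEQ_le)
    let ?Z = "\<lambda>l. K * ((2 * ?Q k + 2 * ?Q l) + nrg (\<lambda>n. A k n - A l n) (\<lambda>n. B k n - B l n) n0
      + ((\<Sum>n=1..<m. \<bar>R k n - R l n\<bar>) + 2 * sqrt (U m))\<^sup>2 + (E k - E l)\<^sup>2)"
    show "(\<lambda>l. nrg (\<lambda>n. A k n - A l n) (\<lambda>n. B k n - B l n) M) \<longlonglongrightarrow> nrg (\<lambda>n. A k n - a n) (\<lambda>n. B k n - b n) M"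
      unfolding nrg_def by (intro tendsto_intros lim)
    have "?Z \<longlonglongrightarrow>
      K * ((2 * ?Q k + 2 * 0) + nrg (\<lambda>n. A k n - a n) (\<lambda>n. B k n - b n) n0
      + ((\<Sum>n=1..<m. \<bar>R k n - S n\<bar>) + 2 * sqrt (U m))\<^sup>2 + (E k - F)\<^sup>2)"
      unfolding nrg_def by (intro tendsto_intros lim obs)
    then show "?Z \<longlonglongrightarrow> G k m"
      unfolding G_def by simp
    have "nrg (\<lambda>n. A k n - A l n) (\<lambda>n. B k n - B l n) M \<le> ?Z l" for l
    proof -
      let ?a = "\<lambda>n. A k n - A l n" and ?b = "\<lambda>n. B k n - B l n" and ?r = "\<lambda>n. R k n - R l n"
      \<comment> \<open>A common length for both members; each vanishes beyond its own length, so
        its observation is unchanged.\<close>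
      define P where "P = max M (max (N k) (N l))"
      have P: "M \<le> P" "N k \<le> P" "N l \<le> P" by (auto simp: P_def)
      have "nrg ?a ?b M \<le> nrg ?a ?b P" by (rule nrg_mono[OF P(1)])
      also have "\<dots> \<le> K * (observed T ?a ?b ?r (E k - E l) P + nrg ?a ?b n0 + (\<Sum>n=1..P. \<bar>?r n\<bar>)\<^sup>2 + (E k - E l)\<^sup>2)"
        by (rule inv)
      also have "\<dots> \<le> K * ((2 * ?Q k + 2 * ?Q l) + nrg ?a ?b n0 + ((\<Sum>n=1..<m. \<bar>R k n - R l n\<bar>) + 2 * sqrt (U m))\<^sup>2 + (E k - E l)\<^sup>2)"
      proof (intro mult_left_mono add_mono order_refl)
        have "observed T ?a ?b ?r (E k - E l) P \<le> 2 * observed T (A k) (B k) (R k) (E k) P + 2 * observed T (A l) (B l) (R l) (E l) P"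
          by (rule observed_diff_le)
        also have "observed T (A k) (B k) (R k) (E k) P = ?Q k" using sup P(2) by (rule observed_extend)
        also have "observed T (A l) (B l) (R l) (E l) P = ?Q l" using sup P(3) by (rule observed_extend)
        finally show "observed T ?a ?b ?r (E k - E l) P \<le> 2 * ?Q k + 2 * ?Q l" .
        show "(\<Sum>n=1..P. \<bar>?r n\<bar>)\<^sup>2 \<le> ((\<Sum>n=1..<m. \<bar>R k n - R l n\<bar>) + 2 * sqrt (U m))\<^sup>2"
          by (intro power_mono splitR m tailR sum_nonneg) auto
      qed (use K in auto)
      finally show ?thesis .
    qed
    then show "\<exists>L. \<forall>l\<ge>L. nrg (\<lambda>n. A k n - A l n) (\<lambda>n. B k n - B l n) M \<le> ?Z l" by blast
  qed
  have G: "(\<lambda>k. G k m) \<longlonglongrightarrow> 4 * K * U m" for m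
  proof -
    have "(\<lambda>k. G k m) \<longlonglongrightarrow> K * (2 * 0 + nrg (\<lambda>n. a n - a n) (\<lambda>n. b n - b n) n0
      + ((\<Sum>n=1..<m. \<bar>S n - S n\<bar>) + 2 * sqrt (U m))\<^sup>2 + (F - F)\<^sup>2)"
      unfolding G_def nrg_def by (intro tendsto_intros lim obs)
    then show ?thesis using U0[of m] by (simp add: nrg_def power_mult_distrib mult_ac)
  qed
  have R1: "(\<Sum>n=1..N k. \<bar>R k n\<bar>)\<^sup>2 \<le> max 1 (U 1)" for k
  proof -
    have "(\<Sum>n=1..N k. \<bar>R k n\<bar>)\<^sup>2 \<le> (sqrt (U 1))\<^sup>2" by (intro power_mono tailR sum_nonneg) auto
    also have "\<dots> = U 1" using U0[of 1] by simp
    finally show ?thesis by simp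
  qed
  have E1: "(E k)\<^sup>2 \<le> max 1 (U 1)" for k using nrg1(2)[of k] by linarith
  have sup': "A k n = 0 \<and> B k n = 0" if "n > N k" for k n using sup[OF that] by simp
  obtain \<Lambda> where \<Lambda>: "\<forall>n\<ge>1. (cmod (\<omega> n) > \<Lambda> \<longrightarrow> a n = 0) \<and> (cmod (\<zeta> n) > \<Lambda> \<longrightarrow> b n = 0)"
    using limit_bounded_frequency[OF T lim(1,2) sup' obs R1 E1] by blast
  obtain n1 where n1: "\<And>n. n \<ge> n1 \<Longrightarrow> cmod (\<omega> n) > \<Lambda> \<and> cmod (\<zeta> n) > \<Lambda>"
    using eventually_frequency_large[of \<Lambda>] by (auto simp: eventually_sequentially)
  define Nx where "Nx = max 1 n1"
  have fin: "a n = 0 \<and> b n = 0 \<and> S n = 0" if "n > Nx" for n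
  proof -
    have ab: "a n = 0" "b n = 0" using \<Lambda> n1[of n] that by (auto simp: Nx_def)
    have "\<bar>S n\<bar> \<le> w n * sqrt ((cmod (a n))\<^sup>2 + (cmod (b n))\<^sup>2)"
    proof (rule LIMSEQ_le)
      show "(\<lambda>k. \<bar>R k n\<bar>) \<longlonglongrightarrow> \<bar>S n\<bar>" by (intro tendsto_intros lim)
      show "(\<lambda>k. w n * sqrt ((cmod (A k n))\<^sup>2 + (cmod (B k n))\<^sup>2)) \<longlonglongrightarrow> w n * sqrt ((cmod (a n))\<^sup>2 + (cmod (b n))\<^sup>2)"
        by (intro tendsto_intros lim)
    qed (use valid in blast)
    then show ?thesis using ab by simp
  qed
  obtain C where C: "C > 0" and dir: "\<And>a b R E N. observed T a b R E N \<le> C * (nrg a b N + (\<Sum>n=1..N. \<bar>R n\<bar>)\<^sup>2 + E\<^sup>2)"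
    using observed_le[OF T0] by blast
  \<comment> \<open>The limit is written as a member minus its difference from the limit; the direct
    inequality then converts closeness in energy into closeness of the observations.\<close>
  have lim_obs: "observed T a b S F Nx \<le> 2 * ?Q k + 2 * (C * (G k m + ((\<Sum>n=1..<m. \<bar>R k n - S n\<bar>) + 2 * sqrt (U m))\<^sup>2 + (E k - F)\<^sup>2))"
    if m: "m \<ge> 1" for k m
  proof -
    define P where "P = max Nx (N k)"
    have P: "Nx \<le> P" "N k \<le> P" by (auto simp: P_def)
    let ?a = "\<lambda>n. A k n - a n" and ?b = "\<lambda>n. B k n - b n" and ?r = "\<lambda>n. R k n - S n"
    have "observed T a b S F Nx = observed T a b S F P" using fin P(1) by (rule observed_extend[symmetric])
    also have "\<dots> = observed T (\<lambda>n. A k n - ?a n) (\<lambda>n. B k n - ?b n) (\<lambda>n. R k n - ?r n) (E k - (E k - F)) P" by simp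
    also have "\<dots> \<le> 2 * observed T (A k) (B k) (R k) (E k) P + 2 * observed T ?a ?b ?r (E k - F) P"
      by (rule observed_diff_le)
    also have "observed T (A k) (B k) (R k) (E k) P = ?Q k" using sup P(2) by (rule observed_extend)
    also have "observed T ?a ?b ?r (E k - F) P \<le> C * (nrg ?a ?b P + (\<Sum>n=1..P. \<bar>?r n\<bar>)\<^sup>2 + (E k - F)\<^sup>2)" by (rule dir)
    also have "\<dots> \<le> C * (G k m + ((\<Sum>n=1..<m. \<bar>R k n - S n\<bar>) + 2 * sqrt (U m))\<^sup>2 + (E k - F)\<^sup>2)"
      using C by (intro mult_left_mono add_mono order_refl strong m power_mono splitR tailR tailS sum_nonneg) auto
    finally show ?thesis by simp
  qed
  have "observed T a b S F Nx \<le> 8 * C * (K + 1) * U m" if m: "m \<ge> 1" for m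
  proof (rule LIMSEQ_le_const)
    have "(\<lambda>k. 2 * ?Q k + 2 * (C * (G k m + ((\<Sum>n=1..<m. \<bar>R k n - S n\<bar>) + 2 * sqrt (U m))\<^sup>2 + (E k - F)\<^sup>2)))
      \<longlonglongrightarrow> 2 * 0 + 2 * (C * (4 * K * U m + ((\<Sum>n=1..<m. \<bar>S n - S n\<bar>) + 2 * sqrt (U m))\<^sup>2 + (F - F)\<^sup>2))"
      by (intro tendsto_intros lim obs G)
    then show "(\<lambda>k. 2 * ?Q k + 2 * (C * (G k m + ((\<Sum>n=1..<m. \<bar>R k n - S n\<bar>) + 2 * sqrt (U m))\<^sup>2 + (E k - F)\<^sup>2)))
      \<longlonglongrightarrow> 8 * C * (K + 1) * U m" using U0[of m] by (simp add: power_mult_distrib algebra_simps)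
  qed (use lim_obs[OF m] in blast)
  moreover have "(\<lambda>m. 8 * C * (K + 1) * U m) \<longlonglongrightarrow> 8 * C * (K + 1) * 0" by (intro tendsto_intros U)
  ultimately have "observed T a b S F Nx \<le> 8 * C * (K + 1) * 0"
    by (intro LIMSEQ_le_const) auto
  then have o0: "observed T a b S F Nx = 0" using observed_nonneg[of T a b S F Nx] by simp
  have "(v1 a b S Nx t)\<^sup>2 + (v2 a b F Nx t)\<^sup>2 = 0" if "t \<in> {0..T}" for t
  proof -
    have "continuous_on {0..T} (\<lambda>t. (v1 a b S Nx t)\<^sup>2 + (v2 a b F Nx t)\<^sup>2)" by (intro continuous_intros)
    from integral_eq_0_iff[OF this T0] o0 that show ?thesis by (auto simp: observed_def)
  qed
  then have v0: "v1 a b S Nx t = 0" "v2 a b F Nx t = 0" if "t \<in> {0<..<T}" for t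
    using that by (auto simp: sum_power2_eq_zero_iff)
  have F0: "F = 0" and X0: "\<forall>n\<in>{1..Nx}. a n = 0 \<and> b n = 0 \<and> S n = 0"
    using finite_unique_continuation[OF T0 v0] by auto
  have ab0: "a n = 0" "b n = 0" if "n \<ge> 1" for n using fin[of n] X0 that by (cases "n > Nx"; simp)+
  \<comment> \<open>As the limit is zero, the distance \<open>G k m\<close> together with
    \<open>(E k)\<^sup>2\<close> carries the whole norm 1, while \<open>E k\<close> tends to
    \<open>F = 0\<close>. Letting \<open>m\<close> grow afterwards gives
    \<open>1 \<le> 0\<close>.\<close>
  have "1 \<le> 4 * K * U m" if m: "m \<ge> 1" for m
  proof (rule LIMSEQ_le_const)
    have "(\<lambda>k. G k m + (E k)\<^sup>2) \<longlonglongrightarrow> 4 * K * U m + F\<^sup>2" by (intro tendsto_intros lim G)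
    then show "(\<lambda>k. G k m + (E k)\<^sup>2) \<longlonglongrightarrow> 4 * K * U m" by (simp add: F0)
    have "1 \<le> G k m + (E k)\<^sup>2" for k
    proof -
      have "nrg (A k) (B k) (N k) = nrg (\<lambda>n. A k n - a n) (\<lambda>n. B k n - b n) (N k)"
        unfolding nrg_def by (intro sum.cong) (auto simp: ab0)
      also have "\<dots> \<le> G k m" by (rule strong[OF m])
      finally show ?thesis using norm1[of k] by linarith
    qed
    then show "\<exists>L. \<forall>k\<ge>L. 1 \<le> G k m + (E k)\<^sup>2" by blast
  qed
  moreover have "(\<lambda>m. 4 * K * U m) \<longlonglongrightarrow> 4 * K * 0" by (intro tendsto_intros U)
  ultimately have "(1::real) \<le> 4 * K * 0" by (intro LIMSEQ_le_const) auto
  then show False by simp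
qed

text \<open>Contradiction and homogeneity: tuples violating the bound with constant
  \<open>1 / (k + 1)\<close> are scaled to norm 1 and a subsequence is handed to
  \<open>no_concentration\<close>. Here \<open>E\<close> is a free coordinate, not tied to the
  energy.\<close>

lemma observed_lower_bound:
  assumes T: "T > 2 * pi / \<gamma>" and w: "\<And>n. w n \<ge> 0" "summable (\<lambda>n. (w n)\<^sup>2)"
  shows "\<exists>\<delta>>0. \<forall>a b R E N. (\<forall>n\<in>{1..N}. \<bar>R n\<bar> \<le> w n * sqrt ((cmod (a n))\<^sup>2 + (cmod (b n))\<^sup>2)) \<longrightarrow>
     \<delta> * (nrg a b N + E\<^sup>2) \<le> observed T a b R E N"
proof (rule ccontr)
  assume neg: "\<not> ?thesis"
  have "\<exists>a b R E N. (\<forall>n. \<bar>R n\<bar> \<le> w n * sqrt ((cmod (a n))\<^sup>2 + (cmod (b n))\<^sup>2)) \<and> (\<forall>n. n > N \<or> n = 0 \<longrightarrow> a n = 0 \<and> b n = 0 \<and> R n = 0)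
      \<and> nrg a b N + E\<^sup>2 = 1 \<and> observed T a b R E N < inverse (real (Suc k))" for k
  proof -
    have "inverse (real (Suc k)) > 0" by simp
    then obtain a b R E N where v: "\<forall>n\<in>{1..N}. \<bar>R n\<bar> \<le> w n * sqrt ((cmod (a n))\<^sup>2 + (cmod (b n))\<^sup>2)"
      and o: "observed T a b R E N < inverse (real (Suc k)) * (nrg a b N + E\<^sup>2)"
      using neg not_le by metis
    define X where "X = nrg a b N + E\<^sup>2"
    \<comment> \<open>The norm cannot vanish, because a nonnegative observation lies strictly below
      a multiple of it.\<close>
    have "0 < inverse (real (Suc k)) * X"
      unfolding X_def using observed_nonneg o by (rule order.strict_trans1)
    then have X: "X > 0" by (rule zero_less_mult_pos) simp
    define s where "s = 1 / sqrt X"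
    have s: "s > 0" "s\<^sup>2 * X = 1" using X by (auto simp: s_def power_divide)
    \<comment> \<open>Cutting to \<open>{1..N}\<close> along with the scaling makes the bound on
      \<open>R\<close> valid at every index, as the coefficientwise limits require.\<close>
    define cut where "cut = (\<lambda>n. if n \<in> {1..N} then s else 0)"
    define a' where "a' = (\<lambda>n. complex_of_real (cut n) * a n)"
    define b' where "b' = (\<lambda>n. complex_of_real (cut n) * b n)"
    define R' where "R' = (\<lambda>n. cut n * R n)"
    have agree: "a' n = complex_of_real s * a n \<and> b' n = complex_of_real s * b n \<and> R' n = s * R n" if "n \<in> {1..N}" for n
      using that by (simp add: a'_def b'_def R'_def cut_def)
    have nrg': "nrg a' b' N = s\<^sup>2 * nrg a b N"
      unfolding nrg_scale[symmetric] by (rule cong_upto(3)[OF agree])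
    have observed': "observed T a' b' R' (s * E) N = s\<^sup>2 * observed T a b R E N"
      unfolding observed_scale[symmetric] by (rule cong_upto(4)[OF agree])
    have "\<bar>R' n\<bar> \<le> w n * sqrt ((cmod (a' n))\<^sup>2 + (cmod (b' n))\<^sup>2)" for n
    proof (cases "n \<in> {1..N}")
      case True
      have "s * \<bar>R n\<bar> \<le> s * (w n * sqrt ((cmod (a n))\<^sup>2 + (cmod (b n))\<^sup>2))"
        using v True s by (intro mult_left_mono) auto
      also have "\<dots> = w n * (\<bar>s\<bar> * sqrt ((cmod (a n))\<^sup>2 + (cmod (b n))\<^sup>2))" using s by simp
      also have "\<bar>s\<bar> * sqrt ((cmod (a n))\<^sup>2 + (cmod (b n))\<^sup>2) = sqrt ((cmod (a' n))\<^sup>2 + (cmod (b' n))\<^sup>2)"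
        using agree[OF True] by (simp add: norm_mult power_mult_distrib real_sqrt_mult flip: ring_distribs)
      finally show ?thesis using agree[OF True] s by (simp add: abs_mult)
    next
      case False
      then have "cut n = 0" by (simp only: cut_def if_False)
      then show ?thesis by (simp add: R'_def a'_def b'_def)
    qed
    moreover have "\<forall>n. n > N \<or> n = 0 \<longrightarrow> a' n = 0 \<and> b' n = 0 \<and> R' n = 0"
      by (auto simp: a'_def b'_def R'_def cut_def)
    moreover have "nrg a' b' N + (s * E)\<^sup>2 = 1"
      unfolding nrg' using s by (simp add: X_def power_mult_distrib ring_distribs)
    moreover have "observed T a' b' R' (s * E) N < inverse (real (Suc k))"
    proof -
      have "s\<^sup>2 * observed T a b R E N < s\<^sup>2 * (inverse (real (Suc k)) * X)"
        using o s by (intro mult_strict_left_mono) (auto simp: X_def)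
      also have "\<dots> = inverse (real (Suc k)) * (s\<^sup>2 * X)" by (rule mult.left_commute)
      finally show ?thesis unfolding observed' by (simp only: s mult_1_right)
    qed
    ultimately show ?thesis by blast
  qed
  then obtain A B R E N where
    valid: "\<And>k n. \<bar>R k n\<bar> \<le> w n * sqrt ((cmod (A k n))\<^sup>2 + (cmod (B k n))\<^sup>2)"
    and sup: "\<And>k n. n > N k \<or> n = 0 \<Longrightarrow> A k n = 0 \<and> B k n = 0 \<and> R k n = 0"
    and norm1: "\<And>k. nrg (A k) (B k) (N k) + (E k)\<^sup>2 = 1"
    and obs: "\<And>k. observed T (A k) (B k) (R k) (E k) (N k) < inverse (real (Suc k))"
    by metis
  define W where "W = sqrt (\<Sum>n. (w n)\<^sup>2)"
  have W: "w n \<le> W" for n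
    unfolding W_def using sum_le_suminf[OF w(2), of "{n}"] by (intro real_le_rsqrt) simp
  have coeff: "(cmod (A k n))\<^sup>2 + (cmod (B k n))\<^sup>2 \<le> 1" "(E k)\<^sup>2 \<le> 1" for k n
  proof -
    have n1: "nrg (A k) (B k) (N k) \<le> 1" using norm1[of k] zero_le_power2[of "E k"] by linarith
    show "(E k)\<^sup>2 \<le> 1" using norm1[of k] nrg_nonneg[of "A k" "B k" "N k"] by linarith
    show "(cmod (A k n))\<^sup>2 + (cmod (B k n))\<^sup>2 \<le> 1"
    proof (cases "n \<in> {1..N k}")
      case True
      then have "(cmod (A k n))\<^sup>2 + (cmod (B k n))\<^sup>2 \<le> nrg (A k) (B k) (N k)"
        unfolding nrg_def by (intro member_le_sum[where f = "\<lambda>n. (cmod (A k n))\<^sup>2 + (cmod (B k n))\<^sup>2"]) auto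
      then show ?thesis using n1 by linarith
    next
      case False
      then show ?thesis using sup[of k n] by (auto simp: not_le)
    qed
  qed
  have bd: "cmod (A k n) \<le> 1" "cmod (B k n) \<le> 1" "\<bar>R k n\<bar> \<le> W" "\<bar>E k\<bar> \<le> 1" for k n
  proof -
    have "(cmod (A k n))\<^sup>2 \<le> 1" "(cmod (B k n))\<^sup>2 \<le> 1"
      using coeff(1)[of k n] zero_le_power2[of "cmod (A k n)"] zero_le_power2[of "cmod (B k n)"] by linarith+
    then show "cmod (A k n) \<le> 1" "cmod (B k n) \<le> 1"
      using abs_square_le_1[of "cmod (A k n)"] abs_square_le_1[of "cmod (B k n)"] by auto
    show "\<bar>E k\<bar> \<le> 1" using coeff(2)[of k] abs_square_le_1 by blast
    have "sqrt ((cmod (A k n))\<^sup>2 + (cmod (B k n))\<^sup>2) \<le> 1" using coeff(1)[of k n] by simp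
    then have "w n * sqrt ((cmod (A k n))\<^sup>2 + (cmod (B k n))\<^sup>2) \<le> w n * 1" using w(1) by (intro mult_left_mono) auto
    then show "\<bar>R k n\<bar> \<le> W" using valid[of k n] W[of n] by linarith
  qed
  \<comment> \<open>Tuples let a single diagonal extraction serve all coefficients and
    \<open>E\<close> at once; the last component is the same for every \<open>n\<close> and is read
    at 0.\<close>
  define f where "f = (\<lambda>k n. (A k n, B k n, R k n, E k))"
  have "norm (f k n) \<le> 1 + (1 + (W + 1))" for k n
    unfolding f_def
    by (intro order_trans[OF norm_Pair_le] add_mono) (use bd in auto)
  then obtain s where s: "strict_mono (s :: nat \<Rightarrow> nat)" and conv: "\<And>n. \<exists>l. (\<lambda>k. f (s k) n) \<longlonglongrightarrow> l"
    using function_convergent_subsequence[of "UNIV :: nat set" f] by (metis UNIV_I countableI_type)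
  obtain l where l: "\<And>n. (\<lambda>k. f (s k) n) \<longlonglongrightarrow> l n" using conv by metis
  have c1: "(\<lambda>k. A (s k) n) \<longlonglongrightarrow> fst (l n)" for n using tendsto_fst[OF l[of n]] by (simp add: f_def)
  have c2: "(\<lambda>k. B (s k) n) \<longlonglongrightarrow> fst (snd (l n))" for n using tendsto_fst[OF tendsto_snd[OF l[of n]]] by (simp add: f_def)
  have c3: "(\<lambda>k. R (s k) n) \<longlonglongrightarrow> fst (snd (snd (l n)))" for n
    using tendsto_fst[OF tendsto_snd[OF tendsto_snd[OF l[of n]]]] by (simp add: f_def)
  have c4: "(\<lambda>k. E (s k)) \<longlonglongrightarrow> snd (snd (snd (l 0)))"
    using tendsto_snd[OF tendsto_snd[OF tendsto_snd[OF l[of 0]]]] by (simp add: f_def)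
  have "(\<lambda>k. observed T (A k) (B k) (R k) (E k) (N k)) \<longlonglongrightarrow> 0"
    by (rule tendsto_sandwich[OF _ _ tendsto_const LIMSEQ_inverse_real_of_nat])
       (rule always_eventually, rule allI, rule observed_nonneg less_imp_le[OF obs])+
  then have c5: "(\<lambda>k. observed T (A (s k)) (B (s k)) (R (s k)) (E (s k)) (N (s k))) \<longlonglongrightarrow> 0"
    using LIMSEQ_subseq_LIMSEQ[OF _ s] by (auto simp: o_def)
  show False
    by (rule no_concentration[OF T w c1 c2 c3 c4 _ valid norm1 c5]) (use sup in auto)
qed

end

subsection \<open>Mean-square limits\<close>

text \<open>A bridge from the gauge integral to the nonnegative Lebesgue integral, where monotone
  summation and Fatou's lemma are available; the next lemma leads back.\<close>

lemma nn_integral_Icc_continuous: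
  fixes h :: "real \<Rightarrow> real"
  assumes "continuous_on {a..b} h" "\<And>t. h t \<ge> 0"
  shows "(\<integral>\<^sup>+t. ennreal (indicator {a..b} t * h t) \<partial>lborel) = ennreal (integral {a..b} h)"
  using nn_integral_has_integral_lebesgue[OF assms(2) integrable_integral[OF integrable_continuous_interval[OF assms(1)]]]
  by simp

lemma integrable_on_Icc_nn_integral:
  fixes h :: "real \<Rightarrow> real"
  assumes h: "h \<in> borel_measurable borel" "\<And>t. h t \<ge> 0"
    and le: "(\<integral>\<^sup>+t. ennreal (indicator {a..b} t * h t) \<partial>lborel) \<le> ennreal r" and r: "r \<ge> 0"
  shows "h integrable_on {a..b}" "integral {a..b} h \<le> r"
proof -
  obtain r' where r': "r' \<ge> 0" "(\<integral>\<^sup>+t. ennreal (indicator {a..b} t * h t) \<partial>lborel) = ennreal r'"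
    using le_less_trans[OF le ennreal_less_top] by (auto simp: less_top_ennreal)
  have "((\<lambda>t. indicator {a..b} t * h t) has_integral r') UNIV"
    using h r' by (intro nn_integral_has_integral) auto
  moreover have "(\<lambda>t. indicator {a..b} t * h t) = (\<lambda>t. if t \<in> {a..b} then h t else 0)" by (auto simp: indicator_def)
  ultimately have "(h has_integral r') {a..b}" by (simp only: has_integral_restrict_UNIV)
  moreover have "r' \<le> r" using le r' r by simp
  ultimately show "h integrable_on {a..b}" "integral {a..b} h \<le> r" by (auto simp: integral_unique)
qed

text \<open>The value of \<open>integral\<close> is 0 for a function that is not integrable, so the
  integrability clauses are what gives the convergence its meaning.\<close>

definition L2_limit :: "real \<Rightarrow> (nat \<Rightarrow> real \<Rightarrow> real) \<Rightarrow> (real \<Rightarrow> real) \<Rightarrow> bool" where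
  "L2_limit T S U \<longleftrightarrow> (\<lambda>t. (U t)\<^sup>2) integrable_on {0..T} \<and> (\<forall>N. (\<lambda>t. (U t - S N t)\<^sup>2) integrable_on {0..T})
     \<and> (\<lambda>N. integral {0..T} (\<lambda>t. (U t - S N t)\<^sup>2)) \<longlonglongrightarrow> 0"

text \<open>A subsequence with geometrically decreasing increments converges almost everywhere, and
  Fatou's lemma identifies its limit as the limit in mean square.\<close>

lemma L2_limit_of_continuous:
  fixes S :: "nat \<Rightarrow> real \<Rightarrow> real"
  assumes T: "T \<ge> 0" and cont: "\<And>N. continuous_on UNIV (S N)"
    and cauchy: "\<And>\<epsilon>. \<epsilon> > 0 \<Longrightarrow> \<exists>K. \<forall>m\<ge>K. \<forall>n\<ge>K. integral {0..T} (\<lambda>t. (S m t - S n t)\<^sup>2) \<le> \<epsilon>"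
  shows "\<exists>U. L2_limit T S U"
proof -
  have cS: "continuous_on A (S N)" for A N using cont continuous_on_subset by blast
  have meas [measurable]: "S N \<in> borel_measurable borel" for N
    by (rule borel_measurable_continuous_onI[OF cont])
  define J where "J = (\<lambda>h::real \<Rightarrow> real. \<integral>\<^sup>+t. ennreal (indicator {0..T} t * h t) \<partial>lborel)"
  have Jc: "J h = ennreal (integral {0..T} h)" if "continuous_on {0..T} h" "\<And>t. h t \<ge> 0" for h
    unfolding J_def using that by (rule nn_integral_Icc_continuous)
  obtain \<kappa> where \<kappa>: "\<And>i m n. m \<ge> \<kappa> i \<Longrightarrow> n \<ge> \<kappa> i \<Longrightarrow> integral {0..T} (\<lambda>t. (S m t - S n t)\<^sup>2) \<le> (1/4) ^ i"
  proof -
    have "\<forall>i. \<exists>K. \<forall>m\<ge>K. \<forall>n\<ge>K. integral {0..T} (\<lambda>t. (S m t - S n t)\<^sup>2) \<le> (1/4) ^ i"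
      by (intro allI cauchy) simp
    then show ?thesis using that by metis
  qed
  \<comment> \<open>Cumulative sums make \<open>p k\<close> at least \<open>\<kappa> i\<close> for
    every \<open>i \<le> k\<close>, although \<open>\<kappa>\<close> need not be monotone.\<close>
  define p where "p = (\<lambda>k. \<Sum>i\<le>k. \<kappa> i)"
  have p: "p k \<ge> \<kappa> i" if "i \<le> k" for i k
    unfolding p_def using that by (intro member_le_sum) auto
  define d where "d = (\<lambda>k t. \<bar>S (p (Suc k)) t - S (p k) t\<bar>)"
  have Jd: "J (d k) \<le> ennreal ((T + 1) * (1/2) ^ k)" for k
  proof -
    \<comment> \<open>The bound \<open>x \<le> 1 / q + q * x\<^sup>2\<close> with
      \<open>q = 2 ^ k\<close> leads from the integral of the square, at most
      \<open>(1/4) ^ k\<close>, to a summable bound for the integral of \<open>d k\<close>.\<close>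
    define g where "g = (\<lambda>t. (1/2) ^ k + 2 ^ k * (S (p (Suc k)) t - S (p k) t)\<^sup>2)"
    have "x \<le> (1/2) ^ k + 2 ^ k * x\<^sup>2" for x :: real
    proof -
      define q :: real where "q = 2 ^ k"
      have q: "q > 0" "(1/2) ^ k = 1 / q" by (auto simp: q_def power_one_over)
      have "0 \<le> (q * x - 1)\<^sup>2 + q * (q * x\<^sup>2) + 1" using q by (intro add_nonneg_nonneg) auto
      then have "2 * (q * x) \<le> 2 * (1 + q * (q * x\<^sup>2))" by (simp add: power2_eq_square algebra_simps)
      then have "x \<le> (1 + q * (q * x\<^sup>2)) / q" using q by (simp add: field_simps)
      also have "\<dots> = 1 / q + q * x\<^sup>2" using q by (simp add: field_simps)
      finally show ?thesis by (simp only: q q_def[symmetric])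
    qed
    from this[of "\<bar>_\<bar>"] have "J (d k) \<le> J g"
      unfolding J_def d_def g_def
      by (intro nn_integral_mono ennreal_leI mult_left_mono) (auto simp: power2_abs)
    also have "J g = ennreal (integral {0..T} g)"
      by (rule Jc) (auto simp: g_def intro!: continuous_intros cS)
    also have "integral {0..T} g = T * (1/2) ^ k + 2 ^ k * integral {0..T} (\<lambda>t. (S (p (Suc k)) t - S (p k) t)\<^sup>2)"
    proof -
      have "((\<lambda>t. (1/2) ^ k) has_integral T * (1/2) ^ k) {0..T}"
        using has_integral_const_real[of "(1/2::real) ^ k" 0 T] T by simp
      then show ?thesis unfolding g_def
        by (intro integral_unique has_integral_add has_integral_mult_right integrable_integral
            integrable_continuous_interval continuous_intros cS)
    qed
    also have "\<dots> \<le> T * (1/2) ^ k + 2 ^ k * (1/4) ^ k"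
      using p[of k "Suc k"] p[of k k] by (intro add_left_mono mult_left_mono \<kappa>) auto
    also have "\<dots> = (T + 1) * (1/2) ^ k" by (simp add: ring_distribs flip: power_mult_distrib)
    finally show ?thesis by (simp add: ennreal_leI)
  qed
  have "(\<integral>\<^sup>+t. (\<Sum>k. ennreal (indicator {0..T} t * d k t)) \<partial>lborel) = (\<Sum>k. J (d k))"
    unfolding J_def by (rule nn_integral_suminf) (auto simp: d_def)
  also have "\<dots> \<le> (\<Sum>k. ennreal ((T + 1) * (1/2) ^ k))" by (intro suminf_le Jd) auto
  also have "\<dots> = ennreal (\<Sum>k. (T + 1) * (1/2) ^ k)"
    using T by (intro suminf_ennreal2 summable_mult summable_geometric) auto
  finally have "(\<integral>\<^sup>+t. (\<Sum>k. ennreal (indicator {0..T} t * d k t)) \<partial>lborel) \<noteq> \<infinity>" by (auto simp: top_unique)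
  then have "AE t in lborel. (\<Sum>k. ennreal (indicator {0..T} t * d k t)) \<noteq> \<infinity>"
    by (intro nn_integral_PInf_AE) (auto simp: d_def)
  then have conv: "AE t in lborel. t \<in> {0..T} \<longrightarrow> convergent (\<lambda>k. S (p k) t)"
  proof (rule AE_mp, intro AE_I2 impI)
    fix t assume fin: "(\<Sum>k. ennreal (indicator {0..T} t * d k t)) \<noteq> \<infinity>" and t: "t \<in> {0..T}"
    have "summable (\<lambda>k. d k t)"
      using fin t by (intro summable_suminf_not_top) (auto simp: d_def)
    then have "summable (\<lambda>k. S (p (Suc k)) t - S (p k) t)" unfolding d_def by (rule summable_rabs_cancel)
    then have "convergent (\<lambda>k. \<Sum>i<k. S (p (Suc i)) t - S (p i) t)" by (simp add: summable_iff_convergent)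
    then have "convergent (\<lambda>k. S (p k) t - S (p 0) t)" by (simp only: sum_lessThan_telescope[of "\<lambda>i. S (p i) t"])
    then have "convergent (\<lambda>k. (S (p k) t - S (p 0) t) + S (p 0) t)" by (intro convergent_add convergent_const)
    then show "convergent (\<lambda>k. S (p k) t)" by simp
  qed
  define U where "U = (\<lambda>t. lim (\<lambda>k. S (p k) t))"
  have [measurable]: "U \<in> borel_measurable borel"
    unfolding U_def by (rule borel_measurable_lim_metric) measurable
  \<comment> \<open>Any bound valid along the subsequence passes to \<open>U\<close>. The points of
    \<open>{0..T}\<close> without convergence form a null set, so the value that \<open>lim\<close>
    takes there does not affect the integral.\<close>
  have fatou: "J (\<lambda>t. (U t - S N t)\<^sup>2) \<le> ennreal r"
    if r: "\<And>k. k \<ge> i \<Longrightarrow> integral {0..T} (\<lambda>t. (S (p k) t - S N t)\<^sup>2) \<le> r" for N r i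
  proof -
    have "J (\<lambda>t. (U t - S N t)\<^sup>2) = (\<integral>\<^sup>+t. liminf (\<lambda>k. ennreal (indicator {0..T} t * (S (p k) t - S N t)\<^sup>2)) \<partial>lborel)"
      unfolding J_def
    proof (rule nn_integral_cong_AE, use conv in eventually_elim)
      case (elim t)
      have "(\<lambda>k. ennreal (indicator {0..T} t * (S (p k) t - S N t)\<^sup>2)) \<longlonglongrightarrow> ennreal (indicator {0..T} t * (U t - S N t)\<^sup>2)"
      proof (cases "t \<in> {0..T}")
        case True
        then have "(\<lambda>k. S (p k) t) \<longlonglongrightarrow> U t" using elim by (simp add: U_def convergent_LIMSEQ_iff)
        then show ?thesis by (intro tendsto_ennrealI tendsto_intros)
      qed simp
      from lim_imp_Liminf[OF _ this] show ?case by simp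
    qed
    also have "\<dots> \<le> liminf (\<lambda>k. J (\<lambda>t. (S (p k) t - S N t)\<^sup>2))"
      unfolding J_def by (rule nn_integral_liminf) measurable
    also have "\<dots> \<le> liminf (\<lambda>k. ennreal r)"
    proof (rule Liminf_mono, rule eventually_sequentiallyI[of i])
      fix k assume "k \<ge> i"
      then show "J (\<lambda>t. (S (p k) t - S N t)\<^sup>2) \<le> ennreal r"
        by (subst Jc) (auto intro!: continuous_intros cS ennreal_leI r)
    qed
    also have "\<dots> = ennreal r" by (simp add: Liminf_const)
    finally show ?thesis .
  qed
  have good: "J (\<lambda>t. (U t - S N t)\<^sup>2) \<le> ennreal ((1/4) ^ i)" if "N \<ge> \<kappa> i" for N i
    by (rule fatou[of i]) (use \<kappa> p that in auto)
  have close: "integral {0..T} (\<lambda>t. (U t - S N t)\<^sup>2) \<le> (1/4) ^ i" if "N \<ge> \<kappa> i" for N i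
    by (rule integrable_on_Icc_nn_integral(2)) (use good[OF that] in \<open>auto simp: J_def\<close>)
  \<comment> \<open>Integrability is also claimed for \<open>g = 0\<close> and for early partial
    sums, which may be far from \<open>U\<close>. The detour over \<open>S (\<kappa> 0)\<close>,
    whose square distance from \<open>U\<close> is at most 1, covers every continuous
    \<open>g\<close>.\<close>
  have plus: "(\<lambda>t. (U t - g t)\<^sup>2) integrable_on {0..T}" if g: "continuous_on UNIV g" for g
  proof -
    have [measurable]: "g \<in> borel_measurable borel" by (rule borel_measurable_continuous_onI[OF g])
    have cg: "continuous_on {0..T} g" using g continuous_on_subset by blast
    let ?s = "S (\<kappa> 0)"
    have "J (\<lambda>t. (U t - g t)\<^sup>2) \<le> (\<integral>\<^sup>+t. 2 * ennreal (indicator {0..T} t * (U t - ?s t)\<^sup>2) + ennreal (indicator {0..T} t * (2 * (?s t - g t)\<^sup>2)) \<partial>lborel)"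
      unfolding J_def
    proof (rule nn_integral_mono)
      fix t
      have "(U t - g t)\<^sup>2 \<le> 2 * (U t - ?s t)\<^sup>2 + 2 * (?s t - g t)\<^sup>2"
        using sum_squares_bound[of "U t - ?s t" "?s t - g t"] by (simp add: power2_eq_square algebra_simps)
      then have "ennreal (indicator {0..T} t * (U t - g t)\<^sup>2)
         \<le> ennreal (2 * (indicator {0..T} t * (U t - ?s t)\<^sup>2) + indicator {0..T} t * (2 * (?s t - g t)\<^sup>2))"
        by (intro ennreal_leI) (auto simp: indicator_def)
      also have "\<dots> = 2 * ennreal (indicator {0..T} t * (U t - ?s t)\<^sup>2) + ennreal (indicator {0..T} t * (2 * (?s t - g t)\<^sup>2))"
        by (simp add: ennreal_plus ennreal_mult')
      finally show "ennreal (indicator {0..T} t * (U t - g t)\<^sup>2)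
         \<le> 2 * ennreal (indicator {0..T} t * (U t - ?s t)\<^sup>2) + ennreal (indicator {0..T} t * (2 * (?s t - g t)\<^sup>2))" .
    qed
    also have "\<dots> = 2 * J (\<lambda>t. (U t - ?s t)\<^sup>2) + J (\<lambda>t. 2 * (?s t - g t)\<^sup>2)"
      unfolding J_def by (subst nn_integral_add) (auto simp: nn_integral_cmult)
    also have "\<dots> \<le> 2 * ennreal 1 + ennreal (integral {0..T} (\<lambda>t. 2 * (?s t - g t)\<^sup>2))"
    proof (intro add_mono mult_left_mono)
      show "J (\<lambda>t. (U t - ?s t)\<^sup>2) \<le> ennreal 1" using good[of 0 "\<kappa> 0"] by simp
      show "J (\<lambda>t. 2 * (?s t - g t)\<^sup>2) \<le> ennreal (integral {0..T} (\<lambda>t. 2 * (?s t - g t)\<^sup>2))"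
        by (rule order_eq_refl, rule Jc) (auto intro!: continuous_intros cS cg)
    qed simp
    also have "\<dots> = ennreal (2 + integral {0..T} (\<lambda>t. 2 * (?s t - g t)\<^sup>2))"
      by (subst ennreal_plus) (auto intro!: integral_nonneg integrable_continuous_interval continuous_intros cS cg)
    finally have le: "J (\<lambda>t. (U t - g t)\<^sup>2) \<le> ennreal (2 + integral {0..T} (\<lambda>t. 2 * (?s t - g t)\<^sup>2))" .
    show ?thesis
      by (rule integrable_on_Icc_nn_integral(1)[OF _ _ le[unfolded J_def]])
         (auto intro!: add_nonneg_nonneg integral_nonneg integrable_continuous_interval continuous_intros cS cg)
  qed
  show ?thesis unfolding L2_limit_def
  proof (intro exI[of _ U] conjI allI)
    show "(\<lambda>t. (U t)\<^sup>2) integrable_on {0..T}" using plus[of "\<lambda>_. 0"] by simp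
    show int: "(\<lambda>t. (U t - S N t)\<^sup>2) integrable_on {0..T}" for N by (rule plus[OF cont])
    show "(\<lambda>N. integral {0..T} (\<lambda>t. (U t - S N t)\<^sup>2)) \<longlonglongrightarrow> 0"
    proof (rule LIMSEQ_I)
      fix \<epsilon> :: real assume "\<epsilon> > 0"
      then obtain i where i: "(1/4::real) ^ i < \<epsilon>" using real_arch_pow_inv[of \<epsilon> "1/4"] by auto
      have "norm (integral {0..T} (\<lambda>t. (U t - S N t)\<^sup>2) - 0) < \<epsilon>" if "N \<ge> \<kappa> i" for N
        using close[OF that] i integral_nonneg[OF int[of N]] by simp
      then show "\<exists>K. \<forall>N\<ge>K. norm (integral {0..T} (\<lambda>t. (U t - S N t)\<^sup>2) - 0) < \<epsilon>" by blast
    qed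
  qed
qed

section \<open>Observability for infinite sums\<close>

context distinct_coupled_oscillators
begin

text \<open>The difference of two partial sums is the observation of the coefficients with indices
  above \<open>m\<close>, the \<open>E\<close>-terms cancelling. The direct inequality then makes
  the partial sums Cauchy in mean square once the energies converge.\<close>

lemma integral_increment_le:
  assumes T: "T > 0" and w: "\<And>n. w n \<ge> 0" "summable (\<lambda>n. (w n)\<^sup>2)"
  shows "\<exists>B>0. \<forall>a b R E m n. (\<forall>k\<ge>1. \<bar>R k\<bar> \<le> w k * sqrt ((cmod (a k))\<^sup>2 + (cmod (b k))\<^sup>2)) \<longrightarrow> m \<le> n \<longrightarrow>
     integral {0..T} (\<lambda>t. (v1 a b R n t - v1 a b R m t)\<^sup>2) + integral {0..T} (\<lambda>t. (v2 a b E n t - v2 a b E m t)\<^sup>2)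
       \<le> B * (nrg a b n - nrg a b m)"
proof -
  obtain B where B: "B > 0" and dir: "\<And>a b R E N. observed T a b R E N \<le> B * (nrg a b N + (\<Sum>n=1..N. \<bar>R n\<bar>)\<^sup>2 + E\<^sup>2)"
    using observed_le[OF T] by blast
  define W where "W = (\<Sum>n. (w n)\<^sup>2) - (\<Sum>n<1. (w n)\<^sup>2)"
  have W: "W \<ge> 0" unfolding W_def using sum_le_suminf[OF w(2), of "{..<1}"] by simp
  have "integral {0..T} (\<lambda>t. (v1 a b R n t - v1 a b R m t)\<^sup>2) + integral {0..T} (\<lambda>t. (v2 a b E n t - v2 a b E m t)\<^sup>2)
       \<le> B * (1 + W) * (nrg a b n - nrg a b m)"
    if R: "\<forall>k\<ge>1. \<bar>R k\<bar> \<le> w k * sqrt ((cmod (a k))\<^sup>2 + (cmod (b k))\<^sup>2)" and mn: "m \<le> n" for a b R E m n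
  proof -
    define a1 where "a1 = (\<lambda>k. if k \<le> m then a k else 0)"
    define b1 where "b1 = (\<lambda>k. if k \<le> m then b k else 0)"
    define R1 where "R1 = (\<lambda>k. if k \<le> m then R k else 0)"
    let ?a = "\<lambda>k. a k - a1 k" and ?b = "\<lambda>k. b k - b1 k" and ?r = "\<lambda>k. R k - R1 k"
    have z: "a1 k = 0 \<and> b1 k = 0 \<and> R1 k = 0" if "k > m" for k using that by (simp add: a1_def b1_def R1_def)
    have c: "a1 k = a k \<and> b1 k = b k \<and> R1 k = R k" if "k \<in> {1..m}" for k using that by (simp add: a1_def b1_def R1_def)
    have "v1 a1 b1 R1 n t = v1 a1 b1 R1 m t" for t using z mn by (rule v_extend(1))
    moreover have "v1 a1 b1 R1 m = v1 a b R m" using c by (rule cong_upto(1))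
    ultimately have v1: "v1 ?a ?b ?r n t = v1 a b R n t - v1 a b R m t" for t
      unfolding v_diff by simp
    have "v2 a1 b1 E n t = v2 a1 b1 E m t" for t using z mn by (rule v_extend(2))
    moreover have "v2 a1 b1 E m = v2 a b E m" using c by (rule cong_upto(2))
    ultimately have v2: "v2 ?a ?b (E - E) n t = v2 a b E n t - v2 a b E m t" for t
      unfolding v_diff by simp
    have nrg: "nrg ?a ?b n = nrg a b n - nrg a b m"
    proof -
      have "nrg a b n = (\<Sum>k\<in>{1..m} \<union> {m<..n}. (cmod (a k))\<^sup>2 + (cmod (b k))\<^sup>2)"
        unfolding nrg_def using mn by (intro sum.cong) auto
      also have "\<dots> = nrg a b m + (\<Sum>k\<in>{m<..n}. (cmod (a k))\<^sup>2 + (cmod (b k))\<^sup>2)"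
        unfolding nrg_def by (intro sum.union_disjoint) auto
      also have "(\<Sum>k\<in>{m<..n}. (cmod (a k))\<^sup>2 + (cmod (b k))\<^sup>2) = nrg ?a ?b n"
        unfolding nrg_def by (intro sum.mono_neutral_cong_left) (auto simp: a1_def b1_def)
      finally show ?thesis by simp
    qed
    have "(\<Sum>k=1..n. \<bar>?r k\<bar>)\<^sup>2 \<le> W * nrg ?a ?b n"
      unfolding W_def nrg_def
      by (rule sum_abs_le_weighted[OF w]) (use R in \<open>auto simp: a1_def b1_def R1_def\<close>)
    then have "nrg ?a ?b n + (\<Sum>k=1..n. \<bar>?r k\<bar>)\<^sup>2 + (E - E)\<^sup>2 \<le> (1 + W) * nrg ?a ?b n"
      by (simp add: ring_distribs)
    then have "B * (nrg ?a ?b n + (\<Sum>k=1..n. \<bar>?r k\<bar>)\<^sup>2 + (E - E)\<^sup>2) \<le> B * ((1 + W) * nrg ?a ?b n)"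
      using B by (intro mult_left_mono) auto
    with dir have "observed T ?a ?b ?r (E - E) n \<le> B * ((1 + W) * nrg ?a ?b n)" by (rule order_trans)
    then show ?thesis unfolding observed_split v1 v2 nrg by simp
  qed
  moreover have "B * (1 + W) > 0" using B W by (intro mult_pos_pos) auto
  ultimately show ?thesis by blast
qed

lemma L2_limits_exist:
  assumes T: "T > 0" and w: "\<And>n. w n \<ge> 0" "summable (\<lambda>n. (w n)\<^sup>2)"
    and R: "\<forall>n\<ge>1. \<bar>R n\<bar> \<le> w n * sqrt ((cmod (a n))\<^sup>2 + (cmod (b n))\<^sup>2)"
    and en: "(\<lambda>N. nrg a b N) \<longlonglongrightarrow> en"
  shows "\<exists>U1. L2_limit T (v1 a b R) U1" "\<exists>U2. L2_limit T (v2 a b E) U2"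
proof -
  obtain B where B: "B > 0" and inc: "\<And>m n. m \<le> n \<Longrightarrow>
     integral {0..T} (\<lambda>t. (v1 a b R n t - v1 a b R m t)\<^sup>2) + integral {0..T} (\<lambda>t. (v2 a b E n t - v2 a b E m t)\<^sup>2)
       \<le> B * (nrg a b n - nrg a b m)"
    using integral_increment_le[OF T w] R by blast
  have nn: "integral {0..T} (\<lambda>t. (v1 a b R n t - v1 a b R m t)\<^sup>2) \<ge> 0" "integral {0..T} (\<lambda>t. (v2 a b E n t - v2 a b E m t)\<^sup>2) \<ge> 0" for n m
    by (rule integral_nonneg; auto intro!: integrable_continuous_interval continuous_intros)+
  have cauchy: "\<exists>K. \<forall>m\<ge>K. \<forall>n\<ge>K. integral {0..T} (\<lambda>t. (v1 a b R m t - v1 a b R n t)\<^sup>2) \<le> \<epsilon>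
      \<and> integral {0..T} (\<lambda>t. (v2 a b E m t - v2 a b E n t)\<^sup>2) \<le> \<epsilon>" if \<epsilon>: "\<epsilon> > 0" for \<epsilon>
  proof -
    have "Cauchy (nrg a b)" using en by (rule LIMSEQ_imp_Cauchy)
    then obtain K where K: "\<And>m n. m \<ge> K \<Longrightarrow> n \<ge> K \<Longrightarrow> norm (nrg a b m - nrg a b n) < \<epsilon> / B"
      using CauchyD[of "nrg a b" "\<epsilon> / B"] B \<epsilon> by (auto simp: divide_pos_pos)
    have ord: "integral {0..T} (\<lambda>t. (v1 a b R n t - v1 a b R m t)\<^sup>2) \<le> \<epsilon> \<and> integral {0..T} (\<lambda>t. (v2 a b E n t - v2 a b E m t)\<^sup>2) \<le> \<epsilon>"
      if "m \<le> n" "m \<ge> K" for m n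
    proof -
      have "nrg a b n - nrg a b m < \<epsilon> / B" using K[of n m] that by simp
      then have "B * (nrg a b n - nrg a b m) \<le> \<epsilon>" using B by (simp add: field_simps)
      then show ?thesis using inc[OF that(1)] nn[of n m] by linarith
    qed
    show ?thesis
    proof (intro exI[of _ K] allI impI)
      fix m n assume "m \<ge> K" "n \<ge> K"
      then show "integral {0..T} (\<lambda>t. (v1 a b R m t - v1 a b R n t)\<^sup>2) \<le> \<epsilon> \<and> integral {0..T} (\<lambda>t. (v2 a b E m t - v2 a b E n t)\<^sup>2) \<le> \<epsilon>"
        using ord[of n m] ord[of m n] by (cases "m \<le> n") (auto simp: power2_commute)
    qed
  qed
  have cauchy1: "\<exists>K. \<forall>m\<ge>K. \<forall>n\<ge>K. integral {0..T} (\<lambda>t. (v1 a b R m t - v1 a b R n t)\<^sup>2) \<le> \<epsilon>"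
    and cauchy2: "\<exists>K. \<forall>m\<ge>K. \<forall>n\<ge>K. integral {0..T} (\<lambda>t. (v2 a b E m t - v2 a b E n t)\<^sup>2) \<le> \<epsilon>" if "\<epsilon> > 0" for \<epsilon>
    using cauchy[OF that] by blast+
  show "\<exists>U1. L2_limit T (v1 a b R) U1"
    using T continuous_on_v(1) cauchy1 by (intro L2_limit_of_continuous) auto
  show "\<exists>U2. L2_limit T (v2 a b E) U2"
    using T continuous_on_v(2) cauchy2 by (intro L2_limit_of_continuous) auto
qed

text \<open>The inequalities for partial sums have constants independent of the length and survive
  the limit; comparing a partial sum with its limit costs a factor 2 in either direction plus the
  error \<open>err N\<close>, which tends to zero. The upper estimate absorbs
  \<open>E\<^sup>2\<close> through \<open>E\<^sup>2 \<le> M * en\<close>.\<close>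

lemma observability:
  assumes T: "T > 2 * pi / \<gamma>" and w: "\<And>n. w n \<ge> 0" "summable (\<lambda>n. (w n)\<^sup>2)" and M: "M > 0"
  shows "\<exists>A B. 0 < A \<and> A \<le> B \<and> (\<forall>a b R E en.
      (\<forall>n\<ge>1. \<bar>R n\<bar> \<le> w n * sqrt ((cmod (a n))\<^sup>2 + (cmod (b n))\<^sup>2)) \<and> (\<lambda>N. nrg a b N) \<longlonglongrightarrow> en \<and> E\<^sup>2 \<le> M * en \<longrightarrow>
      (\<exists>U1 U2. L2_limit T (v1 a b R) U1 \<and> L2_limit T (v2 a b E) U2
        \<and> A * en \<le> integral {0..T} (\<lambda>t. (U1 t)\<^sup>2 + (U2 t)\<^sup>2) \<and> integral {0..T} (\<lambda>t. (U1 t)\<^sup>2 + (U2 t)\<^sup>2) \<le> B * en))"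
proof -
  have T0: "T > 0" using T \<gamma>_pos pi_gt_zero by (smt (verit) divide_pos_pos)
  obtain \<delta> where \<delta>: "\<delta> > 0" and low: "\<And>a b R E N. (\<forall>n\<in>{1..N}. \<bar>R n\<bar> \<le> w n * sqrt ((cmod (a n))\<^sup>2 + (cmod (b n))\<^sup>2)) \<Longrightarrow>
     \<delta> * (nrg a b N + E\<^sup>2) \<le> observed T a b R E N"
    using observed_lower_bound[OF T w] by blast
  obtain B where B: "B > 0" and dir: "\<And>a b R E N. observed T a b R E N \<le> B * (nrg a b N + (\<Sum>n=1..N. \<bar>R n\<bar>)\<^sup>2 + E\<^sup>2)"
    using observed_le[OF T0] by blast
  define W where "W = (\<Sum>n. (w n)\<^sup>2) - (\<Sum>n<1. (w n)\<^sup>2)"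
  have W: "W \<ge> 0" unfolding W_def using sum_le_suminf[OF w(2), of "{..<1}"] by simp
  \<comment> \<open>The maximum ensures that the upper constant is not below the lower one,
    \<open>\<delta> / 2\<close>.\<close>
  define B' where "B' = max (\<delta> / 2) (2 * B * (1 + W + M))"
  have main: "\<exists>U1 U2. L2_limit T (v1 a b R) U1 \<and> L2_limit T (v2 a b E) U2
        \<and> \<delta> / 2 * en \<le> integral {0..T} (\<lambda>t. (U1 t)\<^sup>2 + (U2 t)\<^sup>2) \<and> integral {0..T} (\<lambda>t. (U1 t)\<^sup>2 + (U2 t)\<^sup>2) \<le> B' * en"
    if R: "\<forall>n\<ge>1. \<bar>R n\<bar> \<le> w n * sqrt ((cmod (a n))\<^sup>2 + (cmod (b n))\<^sup>2)" and en: "(\<lambda>N. nrg a b N) \<longlonglongrightarrow> en" and E: "E\<^sup>2 \<le> M * en"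
    for a b R E en
  proof -
    obtain U1 U2 where L2: "L2_limit T (v1 a b R) U1" "L2_limit T (v2 a b E) U2"
      using L2_limits_exist[OF T0 w R en] by blast
    then have U: "(\<lambda>t. (U1 t)\<^sup>2) integrable_on {0..T}" "(\<lambda>t. (U2 t)\<^sup>2) integrable_on {0..T}"
      and UN: "\<And>N. (\<lambda>t. (U1 t - v1 a b R N t)\<^sup>2) integrable_on {0..T}" "\<And>N. (\<lambda>t. (U2 t - v2 a b E N t)\<^sup>2) integrable_on {0..T}"
      and lim: "(\<lambda>N. integral {0..T} (\<lambda>t. (U1 t - v1 a b R N t)\<^sup>2)) \<longlonglongrightarrow> 0"
        "(\<lambda>N. integral {0..T} (\<lambda>t. (U2 t - v2 a b E N t)\<^sup>2)) \<longlonglongrightarrow> 0"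
      by (auto simp: L2_limit_def)
    define I where "I = integral {0..T} (\<lambda>t. (U1 t)\<^sup>2 + (U2 t)\<^sup>2)"
    define err where "err = (\<lambda>N. integral {0..T} (\<lambda>t. (U1 t - v1 a b R N t)\<^sup>2) + integral {0..T} (\<lambda>t. (U2 t - v2 a b E N t)\<^sup>2))"
    have err: "err \<longlonglongrightarrow> 0" unfolding err_def using tendsto_add[OF lim] by simp
    have I: "I = integral {0..T} (\<lambda>t. (U1 t)\<^sup>2) + integral {0..T} (\<lambda>t. (U2 t)\<^sup>2)"
      unfolding I_def using U by (rule integral_add)
    have iv: "(\<lambda>t. (v1 a b R N t)\<^sup>2) integrable_on {0..T}" "(\<lambda>t. (v2 a b E N t)\<^sup>2) integrable_on {0..T}" for N
      by (intro integrable_continuous_interval continuous_intros)+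
    have cmp: "integral {0..T} (\<lambda>t. (f t)\<^sup>2) \<le> 2 * integral {0..T} (\<lambda>t. (g t)\<^sup>2) + 2 * integral {0..T} (\<lambda>t. (h t)\<^sup>2)"
      if "(\<lambda>t. (f t)\<^sup>2) integrable_on {0..T}" "(\<lambda>t. (g t)\<^sup>2) integrable_on {0..T}" "(\<lambda>t. (h t)\<^sup>2) integrable_on {0..T}"
        "\<And>t. f t = g t + h t \<or> f t = g t - h t" for f g h :: "real \<Rightarrow> real"
    proof -
      have "integral {0..T} (\<lambda>t. (f t)\<^sup>2) \<le> integral {0..T} (\<lambda>t. 2 * (g t)\<^sup>2 + 2 * (h t)\<^sup>2)"
      proof (intro integral_le integrable_add integrable_on_mult_right that)
        fix t
        show "(f t)\<^sup>2 \<le> 2 * (g t)\<^sup>2 + 2 * (h t)\<^sup>2"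
          using that(4)[of t] sum_squares_bound[of "g t" "h t"] sum_squares_bound[of "g t" "- h t"]
          by (auto simp: power2_sum power2_diff)
      qed
      also have "\<dots> = 2 * integral {0..T} (\<lambda>t. (g t)\<^sup>2) + 2 * integral {0..T} (\<lambda>t. (h t)\<^sup>2)"
        using that by (intro integral_unique has_integral_add has_integral_mult_right integrable_integral)
      finally show ?thesis .
    qed
    have up: "I \<le> 2 * observed T a b R E N + 2 * err N" for N
      using cmp[OF U(1) iv(1)[of N] UN(1)[of N]] cmp[OF U(2) iv(2)[of N] UN(2)[of N]]
      unfolding I observed_split err_def by auto
    have dn: "observed T a b R E N \<le> 2 * I + 2 * err N" for N
      using cmp[OF iv(1)[of N] U(1) UN(1)[of N]] cmp[OF iv(2)[of N] U(2) UN(2)[of N]]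
      unfolding I observed_split err_def by auto
    have "I \<le> 2 * (B * (en + W * en + M * en)) + 2 * 0"
    proof (rule LIMSEQ_le_const)
      show "(\<lambda>N. 2 * (B * (nrg a b N + W * nrg a b N + M * en)) + 2 * err N) \<longlonglongrightarrow> 2 * (B * (en + W * en + M * en)) + 2 * 0"
        by (intro tendsto_intros en err)
      have "I \<le> 2 * (B * (nrg a b N + W * nrg a b N + M * en)) + 2 * err N" for N
      proof -
        have "(\<Sum>n=1..N. \<bar>R n\<bar>)\<^sup>2 \<le> W * nrg a b N"
          unfolding W_def nrg_def by (rule sum_abs_le_weighted[OF w]) (use R in auto)
        then have "B * (nrg a b N + (\<Sum>n=1..N. \<bar>R n\<bar>)\<^sup>2 + E\<^sup>2) \<le> B * (nrg a b N + W * nrg a b N + M * en)"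
          using B E by (intro mult_left_mono add_mono) auto
        with dir have "observed T a b R E N \<le> B * (nrg a b N + W * nrg a b N + M * en)" by (rule order_trans)
        then show ?thesis using up[of N] by argo
      qed
      then show "\<exists>K. \<forall>N\<ge>K. I \<le> 2 * (B * (nrg a b N + W * nrg a b N + M * en)) + 2 * err N" by blast
    qed
    also have "\<dots> = (2 * B * (1 + W + M)) * en" by (simp add: algebra_simps)
    also have "\<dots> \<le> B' * en"
    proof (rule mult_right_mono)
      show "en \<ge> 0" by (rule LIMSEQ_le_const[OF en]) (use nrg_nonneg in blast)
    qed (simp add: B'_def)
    finally have u: "I \<le> B' * en" .
    have "\<delta> * (en + E\<^sup>2) \<le> 2 * I + 2 * 0"
    proof (rule LIMSEQ_le)
      show "(\<lambda>N. \<delta> * (nrg a b N + E\<^sup>2)) \<longlonglongrightarrow> \<delta> * (en + E\<^sup>2)" by (intro tendsto_intros en)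
      show "(\<lambda>N. 2 * I + 2 * err N) \<longlonglongrightarrow> 2 * I + 2 * 0" by (intro tendsto_intros err)
      have "\<delta> * (nrg a b N + E\<^sup>2) \<le> 2 * I + 2 * err N" for N
        by (rule order_trans[OF low dn]) (use R in auto)
      then show "\<exists>K. \<forall>N\<ge>K. \<delta> * (nrg a b N + E\<^sup>2) \<le> 2 * I + 2 * err N" by blast
    qed
    moreover have "\<delta> * en \<le> \<delta> * (en + E\<^sup>2)" using \<delta> by (intro mult_left_mono) auto
    ultimately have "\<delta> / 2 * en \<le> I" by simp
    with u L2 show ?thesis unfolding I_def by blast
  qed
  have "0 < \<delta> / 2" "\<delta> / 2 \<le> B'" using \<delta> by (auto simp: B'_def)
  with main show ?thesis by blast
qed

end

section \<open>Return to the original sequences\<close>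

theorem theorem5p16:
  fixes \<omega> \<zeta> c d :: "nat \<Rightarrow> complex" and r :: "nat \<Rightarrow> real"
    and \<gamma> \<alpha> \<chi>\<^sub>0 \<mu> \<nu> M c\<^sub>1 c\<^sub>2 \<eta> T :: real and n' :: nat
  assumes S_const: "\<gamma> > 0" "\<alpha> > 0" "\<chi>\<^sub>0 < 0" "\<mu> > 0" "\<nu> > 1/2" "M > 0" "0 < c\<^sub>1" "c\<^sub>1 \<le> c\<^sub>2"
    and H1: "liminf (\<lambda>n. ereal (Re (\<omega> (Suc n)) - Re (\<omega> n))) = ereal \<gamma>"
            "liminf (\<lambda>n. ereal (Re (\<zeta> (Suc n)) - Re (\<zeta> n))) = ereal \<gamma>"
    and H2: "(\<lambda>n. Im (\<omega> n)) \<longlonglongrightarrow> \<alpha>" "r \<longlonglongrightarrow> \<chi>\<^sub>0" "(\<lambda>n. Im (\<zeta> n)) \<longlonglongrightarrow> 0"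
    and H3: "\<forall>n\<ge>1. \<omega> n \<noteq> 0 \<and> \<zeta> n \<noteq> 0 \<and> c\<^sub>1 * cmod (\<zeta> n) \<le> cmod (d n)
                \<and> cmod (d n) \<le> c\<^sub>2 * cmod (\<zeta> n) \<and> cmod (c n) \<le> M / cmod (\<omega> n)"
    and D_inj: "inj_on \<omega> {1..}" "inj_on r {1..}" "inj_on \<zeta> {1..}"
    and D_dist: "\<forall>n\<ge>1. \<forall>m\<ge>1. \<omega> n \<noteq> \<zeta> m \<and> \<omega> n \<noteq> cnj (\<zeta> m)
                \<and> complex_of_real (r n) \<noteq> \<i> * \<omega> m \<and> complex_of_real (r n) \<noteq> \<i> * \<zeta> m
                \<and> r n \<noteq> - \<eta>"
    and D_pos: "\<forall>n\<ge>1. Re (\<omega> n) > 0 \<and> Re (\<zeta> n) > 0"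
    and gap: "\<gamma> > 4 * \<alpha>"
    and T: "T > 2 * pi / sqrt (\<gamma>\<^sup>2 - 16 * \<alpha>\<^sup>2)"
  shows "\<exists>A B. 0 < A \<and> A \<le> B \<and>
    (\<forall>(C :: nat \<Rightarrow> complex) (D :: nat \<Rightarrow> complex) (R :: nat \<Rightarrow> real) (\<E> :: real).
      (\<forall>n\<ge>n'. \<bar>R n\<bar> \<le> \<mu> * real n powr (- \<nu>) * sqrt ((cmod (C n))\<^sup>2 + (cmod (d n * D n))\<^sup>2))
      \<and> (\<forall>n. 1 \<le> n \<and> n \<le> n' \<longrightarrow> \<bar>R n\<bar> \<le> \<mu> * sqrt ((cmod (C n))\<^sup>2 + (cmod (d n * D n))\<^sup>2))
      \<and> summable (\<lambda>n. (cmod (C (Suc n)))\<^sup>2 + (cmod (d (Suc n) * D (Suc n)))\<^sup>2)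
      \<and> \<E>\<^sup>2 \<le> M * energy C D d
      \<longrightarrow> (\<exists>U1 U2 :: real \<Rightarrow> complex.
            (\<lambda>t. (cmod (U1 t))\<^sup>2) integrable_on {0..T}
          \<and> (\<lambda>t. (cmod (U2 t))\<^sup>2) integrable_on {0..T}
          \<and> (\<forall>N. (\<lambda>t. (cmod (U1 t - u1_part \<omega> \<zeta> r C D R N t))\<^sup>2) integrable_on {0..T})
          \<and> (\<forall>N. (\<lambda>t. (cmod (U2 t - u2_part \<omega> \<zeta> c d C D \<E> \<eta> N t))\<^sup>2) integrable_on {0..T})
          \<and> (\<lambda>N. integral {0..T} (\<lambda>t. (cmod (U1 t - u1_part \<omega> \<zeta> r C D R N t))\<^sup>2)) \<longlonglongrightarrow> 0
          \<and> (\<lambda>N. integral {0..T} (\<lambda>t. (cmod (U2 t - u2_part \<omega> \<zeta> c d C D \<E> \<eta> N t))\<^sup>2)) \<longlonglongrightarrow> 0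
          \<and> A * energy C D d \<le> integral {0..T} (\<lambda>t. (cmod (U1 t))\<^sup>2 + (cmod (U2 t))\<^sup>2)
          \<and> integral {0..T} (\<lambda>t. (cmod (U1 t))\<^sup>2 + (cmod (U2 t))\<^sup>2) \<le> B * energy C D d))"
proof -
  have \<gamma>: "\<gamma> > 0" by (rule S_const(1))
  have gap\<omega>: "eventually (\<lambda>n. \<gamma>' < Re (\<omega> (Suc n)) - Re (\<omega> n)) sequentially" if "\<gamma>' < \<gamma>" for \<gamma>'
    using less_LiminfD[of "ereal \<gamma>'" sequentially "\<lambda>n. ereal (Re (\<omega> (Suc n)) - Re (\<omega> n))"] H1(1) that by simp
  have gap\<zeta>: "eventually (\<lambda>n. \<gamma>' < Re (\<zeta> (Suc n)) - Re (\<zeta> n)) sequentially" if "\<gamma>' < \<gamma>" for \<gamma>'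
    using less_LiminfD[of "ereal \<gamma>'" sequentially "\<lambda>n. ereal (Re (\<zeta> (Suc n)) - Re (\<zeta> n))"] H1(2) that by simp
  have inv0: "(\<lambda>n. inverse (cmod (\<omega> n))) \<longlonglongrightarrow> 0" "(\<lambda>n. inverse (cmod (\<zeta> n))) \<longlonglongrightarrow> 0"
    using filterlim_cmod_at_top_gap[OF gap\<omega> \<gamma>] filterlim_cmod_at_top_gap[OF gap\<zeta> \<gamma>]
    by (auto intro: tendsto_inverse_0_at_top)
  define e where "e = (\<lambda>n. 1 / d n)"
  have d0: "d n \<noteq> 0" if "n \<ge> 1" for n
  proof -
    have "0 < c\<^sub>1 * cmod (\<zeta> n)" using H3 that S_const(7) by simp
    then show ?thesis using H3 that by (metis norm_zero not_less)
  qed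
  have c_lim: "c \<longlonglongrightarrow> 0"
  proof (rule Lim_null_comparison)
    show "eventually (\<lambda>n. norm (c n) \<le> M * inverse (cmod (\<omega> n))) sequentially"
      using eventually_ge_at_top[of 1] by eventually_elim (use H3 in \<open>auto simp: divide_inverse\<close>)
    show "(\<lambda>n. M * inverse (cmod (\<omega> n))) \<longlonglongrightarrow> 0" using tendsto_mult_left[OF inv0(1), of M] by simp
  qed
  have e_lim: "e \<longlonglongrightarrow> 0"
  proof (rule Lim_null_comparison)
    show "eventually (\<lambda>n. norm (e n) \<le> inverse c\<^sub>1 * inverse (cmod (\<zeta> n))) sequentially"
      using eventually_ge_at_top[of 1]
    proof eventually_elim
      case (elim n)
      have "0 < c\<^sub>1 * cmod (\<zeta> n)" "c\<^sub>1 * cmod (\<zeta> n) \<le> cmod (d n)" using H3 elim S_const(7) by simp_all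
      then have "inverse (cmod (d n)) \<le> inverse (c\<^sub>1 * cmod (\<zeta> n))" by (intro le_imp_inverse_le)
      then show ?case by (simp add: e_def norm_divide divide_inverse norm_inverse)
    qed
    show "(\<lambda>n. inverse c\<^sub>1 * inverse (cmod (\<zeta> n))) \<longlonglongrightarrow> 0" using tendsto_mult_left[OF inv0(2), of "inverse c\<^sub>1"] by simp
  qed
  obtain \<rho>0 where \<rho>0: "\<And>n. \<bar>r n\<bar> \<le> \<rho>0"
    using convergent_imp_Bseq[OF convergentI[OF H2(2)]] by (auto simp: Bseq_def)
  define \<rho> where "\<rho> = max \<rho>0 \<bar>\<eta>\<bar>"
  have \<rho>: "\<bar>r n\<bar> \<le> \<rho>" "\<bar>\<eta>\<bar> \<le> \<rho>" for n using \<rho>0[of n] by (auto simp: \<rho>_def)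
  interpret distinct_coupled_oscillators \<omega> \<zeta> c e r \<gamma> \<alpha> 0 \<eta> \<rho>
    by unfold_locales (use gap\<omega> gap\<zeta> H2 \<gamma> c_lim e_lim \<rho> D_inj D_dist D_pos in auto)
  \<comment> \<open>One weight for both bounds on \<open>R\<close>; at \<open>n'\<close>, where both
    hold, the decaying one is taken. The finitely many constant values do not disturb the
    summability of the squares, which comes from \<open>2 * \<nu> > 1\<close>.\<close>
  define w where "w = (\<lambda>n. if n < n' then \<mu> else \<mu> * real n powr (- \<nu>))"
  have w0: "w n \<ge> 0" for n using S_const(4) by (simp add: w_def)
  have "summable (\<lambda>n. \<mu>\<^sup>2 * real n powr (- 2 * \<nu>))"
    using S_const(5) by (intro summable_mult) (simp add: summable_real_powr_iff)
  then have w2: "summable (\<lambda>n. (w n)\<^sup>2)"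
  proof (rule summable_cong[THEN iffD1, rotated])
    show "eventually (\<lambda>n. \<mu>\<^sup>2 * real n powr (- 2 * \<nu>) = (w n)\<^sup>2) sequentially"
      using eventually_ge_at_top[of n']
      by eventually_elim (simp add: w_def power_mult_distrib power2_eq_square flip: powr_add)
  qed
  \<comment> \<open>The assumption \<open>\<gamma> > 4 * \<alpha>\<close> makes the square root
    positive, and it is at most \<open>\<gamma>\<close>.\<close>
  have T\<gamma>: "T > 2 * pi / \<gamma>"
  proof -
    have "(4 * \<alpha>)\<^sup>2 < \<gamma>\<^sup>2" using gap S_const(2) by (intro power_strict_mono) auto
    then have "0 < sqrt (\<gamma>\<^sup>2 - 16 * \<alpha>\<^sup>2)" by (simp add: power_mult_distrib)
    moreover have "sqrt (\<gamma>\<^sup>2 - 16 * \<alpha>\<^sup>2) \<le> \<gamma>" using \<gamma> by (intro real_le_lsqrt) auto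
    ultimately have "2 * pi / \<gamma> \<le> 2 * pi / sqrt (\<gamma>\<^sup>2 - 16 * \<alpha>\<^sup>2)" by (intro frac_le) auto
    then show ?thesis using T by linarith
  qed
  obtain A B where AB: "0 < A" "A \<le> B" and main: "\<And>a b R E en.
      (\<forall>n\<ge>1. \<bar>R n\<bar> \<le> w n * sqrt ((cmod (a n))\<^sup>2 + (cmod (b n))\<^sup>2)) \<Longrightarrow> (\<lambda>N. nrg a b N) \<longlonglongrightarrow> en \<Longrightarrow> E\<^sup>2 \<le> M * en \<Longrightarrow>
      (\<exists>U1 U2. L2_limit T (v1 a b R) U1 \<and> L2_limit T (v2 a b E) U2
        \<and> A * en \<le> integral {0..T} (\<lambda>t. (U1 t)\<^sup>2 + (U2 t)\<^sup>2) \<and> integral {0..T} (\<lambda>t. (U1 t)\<^sup>2 + (U2 t)\<^sup>2) \<le> B * en)"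
    using observability[OF T\<gamma> w0 w2 S_const(6)] by blast
  show ?thesis
  proof (rule exI[of _ A], rule exI[of _ B], intro conjI AB allI impI)
    fix C D :: "nat \<Rightarrow> complex" and R :: "nat \<Rightarrow> real" and \<E> :: real
    assume asm: "(\<forall>n\<ge>n'. \<bar>R n\<bar> \<le> \<mu> * real n powr (- \<nu>) * sqrt ((cmod (C n))\<^sup>2 + (cmod (d n * D n))\<^sup>2))
      \<and> (\<forall>n. 1 \<le> n \<and> n \<le> n' \<longrightarrow> \<bar>R n\<bar> \<le> \<mu> * sqrt ((cmod (C n))\<^sup>2 + (cmod (d n * D n))\<^sup>2))
      \<and> summable (\<lambda>n. (cmod (C (Suc n)))\<^sup>2 + (cmod (d (Suc n) * D (Suc n)))\<^sup>2)
      \<and> \<E>\<^sup>2 \<le> M * energy C D d"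
    define b where "b = (\<lambda>n. d n * D n)"
    have R: "\<forall>n\<ge>1. \<bar>R n\<bar> \<le> w n * sqrt ((cmod (C n))\<^sup>2 + (cmod (b n))\<^sup>2)"
      using asm by (auto simp: w_def b_def)
    have "nrg C b N = (\<Sum>n<N. (cmod (C (Suc n)))\<^sup>2 + (cmod (d (Suc n) * D (Suc n)))\<^sup>2)" for N
      unfolding nrg_def b_def by (rule sum.reindex_bij_witness[of _ Suc "\<lambda>n. n - 1"]) auto
    then have en: "(\<lambda>N. nrg C b N) \<longlonglongrightarrow> energy C D d"
      unfolding energy_def using asm by (simp add: summable_LIMSEQ)
    \<comment> \<open>Since \<open>d n\<close> is nonzero for \<open>n \<ge> 1\<close>, the weight
      \<open>e n\<close> turns \<open>b n\<close> back into \<open>D n\<close>, so \<open>v1\<close>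
      and \<open>v2\<close> are exactly the given partial sums.\<close>
    have eb: "osc \<zeta> (\<lambda>n. e n * b n) N t = osc \<zeta> D N t" for N t
      unfolding osc_def by (intro sum.cong) (auto simp: e_def b_def d0)
    have U1: "u1_part \<omega> \<zeta> r C D R N t = complex_of_real (v1 C b R N t)" for N t
      unfolding u1_part_def v1_def eb of_real_add of_real_osc of_real_sum by (simp add: sum.distrib)
    have U2: "u2_part \<omega> \<zeta> c d C D \<E> \<eta> N t = complex_of_real (v2 C b \<E> N t)" for N t
      unfolding u2_part_def v2_def of_real_add of_real_osc by (simp add: sum.distrib b_def)
    have cm: "(cmod (complex_of_real x - complex_of_real y))\<^sup>2 = (x - y)\<^sup>2" "(cmod (complex_of_real x))\<^sup>2 = x\<^sup>2" for x y
      unfolding of_real_diff[symmetric] norm_of_real power2_abs by (rule refl)+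
    obtain V1 V2 where V: "L2_limit T (v1 C b R) V1" "L2_limit T (v2 C b \<E>) V2"
        "A * energy C D d \<le> integral {0..T} (\<lambda>t. (V1 t)\<^sup>2 + (V2 t)\<^sup>2)"
        "integral {0..T} (\<lambda>t. (V1 t)\<^sup>2 + (V2 t)\<^sup>2) \<le> B * energy C D d"
      using main[OF R en, of \<E>] asm by blast
    show "\<exists>U1 U2 :: real \<Rightarrow> complex.
            (\<lambda>t. (cmod (U1 t))\<^sup>2) integrable_on {0..T}
          \<and> (\<lambda>t. (cmod (U2 t))\<^sup>2) integrable_on {0..T}
          \<and> (\<forall>N. (\<lambda>t. (cmod (U1 t - u1_part \<omega> \<zeta> r C D R N t))\<^sup>2) integrable_on {0..T})
          \<and> (\<forall>N. (\<lambda>t. (cmod (U2 t - u2_part \<omega> \<zeta> c d C D \<E> \<eta> N t))\<^sup>2) integrable_on {0..T})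
          \<and> (\<lambda>N. integral {0..T} (\<lambda>t. (cmod (U1 t - u1_part \<omega> \<zeta> r C D R N t))\<^sup>2)) \<longlonglongrightarrow> 0
          \<and> (\<lambda>N. integral {0..T} (\<lambda>t. (cmod (U2 t - u2_part \<omega> \<zeta> c d C D \<E> \<eta> N t))\<^sup>2)) \<longlonglongrightarrow> 0
          \<and> A * energy C D d \<le> integral {0..T} (\<lambda>t. (cmod (U1 t))\<^sup>2 + (cmod (U2 t))\<^sup>2)
          \<and> integral {0..T} (\<lambda>t. (cmod (U1 t))\<^sup>2 + (cmod (U2 t))\<^sup>2) \<le> B * energy C D d"
      by (rule exI[of _ "\<lambda>t. complex_of_real (V1 t)"], rule exI[of _ "\<lambda>t. complex_of_real (V2 t)"])
         (unfold U1 U2 cm, use V in \<open>simp add: L2_limit_def\<close>)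
  qed
qed

end
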